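(* Let $d\in\mathbb{N}$, $\alpha\in(0,1)$, $\beta\in(0,2)$, and let the spectral measure $\nu$ satisfy the standing assumption stated in the context. Let $f:[0,\infty)\to[0,\infty)$ be locally Lipschitz continuous and non-decreasing, with $f(0)=0$ and $f>0$ on $(0,\infty)$, and of Osgood-type (with some exponent $k>1$). If $u_0\in L_\infty(\mathbb{R}^d)$ is non-negative, then the problem $$\partial_t^{\alpha}(u-u_0)+\Psi_\beta(-i\nabla)u=f(u),\quad t>0,\ x\in\mathbb{R}^d,$$ has a unique global integral solution $u\in L_{\infty,\mathrm{loc}}((0,\infty);L_\infty(\mathbb{R}^d))$.
   Context: Notation: $g_\rho(t)=\frac{1}{\Gamma(\rho)}t^{\rho-1}$ for $\rho>0$, $t>0$; $\partial_t^\alpha v=\frac{d}{dt}\int_0^t g_{1-\alpha}(t-s)v(s)\,ds$ is the Riemann–Liouville derivative. $\Psi_\beta(-i\nabla)$ is the pseudo-differential operator with symbol $\psi_\beta(\xi)=|\xi|^\beta\omega_\nu(\xi/|\xi|)$, where $\omega_\nu(\theta)=\int_{\mathbb{S}^{d-1}}|\theta\cdot\eta|^\beta\,\nu(d\eta)$ for $\theta\in\mathbb{S}^{d-1}$ and $\nu$ is a (spectral) measure on $\mathbb{S}^{d-1}$. Standing assumption on $\nu$: $\nu$ has a strictly positive density, such that $\omega_\nu$ is strictly positive and $(d+1+[\beta])$-times continuously differentiable on $\mathbb{S}^{d-1}$, where $[\beta]$ is the integer part of $\beta$. Kernels: $G(t,x)=(2\pi)^{-d}\int_{\mathbb{R}^d}e^{ix\cdot\xi}e^{-t\psi_\beta(\xi)}\,d\xi$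 is the Green function of $\partial_t v+\Psi_\beta(-i\nabla)v=0$ with $G(0,\cdot)=\delta_0$. $G_\alpha(t,s)$ is the Green function of $\partial_t v(t,s)+\frac{d^\alpha}{ds^\alpha}v(t,s)=0$ with $G_\alpha(0,\cdot)=\delta_0$, where $\frac{d^\alpha}{ds^\alpha}h(s)=\frac{1}{\Gamma(-\alpha)}\int_0^\infty\frac{h(s-\tau)-h(s)}{\tau^{1+\alpha}}\,d\tau$; that is, $G_\alpha(t,\cdot)$ is the density on $(0,\infty)$ with $\int_0^\infty e^{-\lambda s}G_\alpha(t,s)\,ds=e^{-t\lambda^\alpha}$, $\lambda\ge0$. Then $$Z(t,x)=\frac1\alpha\int_0^\infty G(t^\alpha s,x)\,s^{-1-\frac1\alpha}\,G_\alpha(1,s^{-\frac1\alpha})\,ds,$$ and $Y$ is the unique solution of $Z(t,x)=\int_0^t g_{1-\alpha}(t-s)Y(s,x)\,ds$. Integral solution: given non-negative $u_0,f$, a function $u:[0,T)\times\mathbb{R}^d\to[0,\infty]$ is an integral solution of the problem if it is measurable, finite almost everywhere, and for almost every $(t,x)\in(0,T)\times\mathbb{R}^d$ satisfies $u(t,x)=\int_{\mathbb{R}^d}Z(t,x-y)u_0(y)\,dy+\int_0^t\int_{\mathbb{R}^d}Y(t-s,x-y)f(u(s,y))\,dy\,ds$. It is global if $T$ can be arbitrarily large. Solutions are identified when equal almost everywhere. Osgood-type functions: for $k>1$ and a fixed $\phi_0>2^{1/(k-1)}$ put $\phi_i=\phi_{i-1}^k$ for $i\ge1$, and define $f^{[k]}:[0,\infty)\to[0,\infty)$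 by $f^{[k]}(s)=(1-\phi_0^{1-k})s^k$ for $s\in[0,\phi_0]$; $f^{[k]}(s)=\phi_i-\phi_{i-1}$ for $s\in[\phi_{i-1},\phi_i/2]$, $i\ge1$; and, for $s\in(\phi_i/2,\phi_i)$, $i\ge1$, $f^{[k]}(s)$ is the affine interpolation between the values of $f^{[k]}$ at $\phi_i/2$ and $\phi_i$. A continuous $f:[0,\infty)\to[0,\infty)$ is of Osgood-type with exponent $k>1$ if (for such an $f^{[k]}$) there are constants $c,C>0$ with $c\,f^{[k]}(s)\le f(s)\le C\,f^{[k]}(s)$ for all $s\ge0$. $L_{\infty,\mathrm{loc}}((0,\infty);L_\infty(\mathbb{R}^d))$ denotes here the space of measurable functions that are essentially bounded on $(0,T)\times\mathbb{R}^d$ for every $T>0$. *)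

theory Defs
  imports "HOL-Analysis.Analysis"
begin

text \<open>
  The dimension \<open>d\<close> is \<open>DIM('a)\<close> for a type \<open>'a\<close> of class \<open>euclidean_space\<close>.
\<close>

subsection \<open>The spectral measure and the symbol\<close>

text \<open>
  Surface measure on the unit sphere as cone measure:
  \<open>\<sigma>(A) = d \<cdot> \<lambda>({r \<theta> | 0 < r < 1, \<theta> \<in> A})\<close>. For \<open>d = 1\<close> this is counting measure on \<open>{-1, 1}\<close>.
\<close>

definition sphere_measure :: "'a::euclidean_space measure" where
  "sphere_measure = scale_measure (of_nat DIM('a))
     (distr (restrict_space lborel (ball 0 1 - {0})) (restrict_space borel (sphere 0 1))
       (\<lambda>x. x /\<^sub>R norm x))"

lemma emeasure_sphere_measure:
  assumes "A \<in> sets (restrict_space borel (sphere 0 1))"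
  shows "emeasure (sphere_measure :: 'a::euclidean_space measure) A =
    of_nat DIM('a) * emeasure lborel {x \<in> ball 0 1 - {0}. x /\<^sub>R norm x \<in> A}"
proof -
  have m: "(\<lambda>x::'a. x /\<^sub>R norm x) \<in> measurable (restrict_space lborel (ball 0 1 - {0})) (restrict_space borel (sphere 0 1))"
    by (intro measurable_restrict_space2) (auto simp: space_restrict_space intro!: measurable_restrict_space1)
  show ?thesis using assms
    unfolding sphere_measure_def
    apply (simp add: emeasure_distr[OF m] emeasure_restrict_space)
    apply (rule arg_cong[where f="\<lambda>y. _ * y"], rule arg_cong[where f="emeasure lborel"])
    by (auto simp: space_restrict_space)
qed

definition spectral_fun :: "real \<Rightarrow> 'a::euclidean_space measure \<Rightarrow> 'a \<Rightarrow> real" where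
  "spectral_fun \<beta> \<nu> \<theta> = (LINT \<eta>|\<nu>. \<bar>\<theta> \<bullet> \<eta>\<bar> powr \<beta>)"

definition symbol :: "real \<Rightarrow> 'a::euclidean_space measure \<Rightarrow> 'a \<Rightarrow> real" where
  "symbol \<beta> \<nu> \<xi> = norm \<xi> powr \<beta> * spectral_fun \<beta> \<nu> (\<xi> /\<^sub>R norm \<xi>)"

text \<open>\<open>m\<close> times continuously differentiable; to be used for open \<open>S\<close> only.\<close>

primrec Ck_on :: "nat \<Rightarrow> 'a::euclidean_space set \<Rightarrow> ('a \<Rightarrow> real) \<Rightarrow> bool" where
  "Ck_on 0 S h \<longleftrightarrow> continuous_on S h"
| "Ck_on (Suc m) S h \<longleftrightarrow> (\<forall>x\<in>S. h differentiable (at x)) \<and>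
     (\<forall>v. Ck_on m S (\<lambda>x. frechet_derivative h (at x) v))"

text \<open>
  A function on the sphere is \<open>m\<close> times continuously differentiable iff its extension to
  \<open>x \<noteq> 0\<close> that is constant along rays is.
\<close>

definition Ck_sphere :: "nat \<Rightarrow> ('a::euclidean_space \<Rightarrow> real) \<Rightarrow> bool" where
  "Ck_sphere m h \<longleftrightarrow> Ck_on m (- {0}) (\<lambda>x. h (x /\<^sub>R norm x))"

definition admissible_spectral_measure :: "real \<Rightarrow> 'a::euclidean_space measure \<Rightarrow> bool" where
  "admissible_spectral_measure \<beta> \<nu> \<longleftrightarrow>
     finite_measure \<nu> \<and>
     (\<exists>p :: 'a \<Rightarrow> real. p \<in> borel_measurable sphere_measure \<and> (\<forall>\<theta>\<in>sphere 0 1. 0 < p \<theta>) \<and>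
        \<nu> = density sphere_measure (\<lambda>\<theta>. ennreal (p \<theta>))) \<and>
     (\<forall>\<theta>\<in>sphere 0 1. 0 < spectral_fun \<beta> \<nu> \<theta>) \<and>
     Ck_sphere (DIM('a) + 1 + nat \<lfloor>\<beta>\<rfloor>) (spectral_fun \<beta> \<nu>)"

subsection \<open>Kernels\<close>

text \<open>The symbol is even, so the integral is real and \<open>Re\<close> only changes the type.\<close>

definition space_green :: "real \<Rightarrow> 'a::euclidean_space measure \<Rightarrow> real \<Rightarrow> 'a \<Rightarrow> real" where
  "space_green \<beta> \<nu> t x =
     Re (complex_of_real ((2 * pi) powr (- real DIM('a))) *
       (LINT \<xi>|lborel. exp (\<i> * complex_of_real (x \<bullet> \<xi>)) *
          complex_of_real (exp (- t * symbol \<beta> \<nu> \<xi>))))"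

text \<open>
  The density of the \<open>\<alpha>\<close>-stable subordinator. Its Laplace transform determines it almost
  everywhere on \<open>(0, \<infinity>)\<close>; the description picks the continuous version, extended by \<open>0\<close>.
\<close>

definition stable_density :: "real \<Rightarrow> real \<Rightarrow> real \<Rightarrow> real" where
  "stable_density \<alpha> t = (THE p.
     continuous_on {0<..} p \<and> (\<forall>s>0. 0 \<le> p s) \<and> (\<forall>s\<le>0. p s = 0) \<and>
     (\<forall>l\<ge>0. has_bochner_integral lborel
        (\<lambda>s. indicator {0<..} s * (exp (- l * s) * p s)) (exp (- t * l powr \<alpha>))))"

definition Z_kernel :: "real \<Rightarrow> real \<Rightarrow> 'a::euclidean_space measure \<Rightarrow> real \<Rightarrow> 'a \<Rightarrow> real" where
  "Z_kernel \<alpha> \<beta> \<nu> t x = 1 / \<alpha> *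
     (LINT s:{0<..}|lborel. space_green \<beta> \<nu> (t powr \<alpha> * s) x * s powr (- 1 - 1 / \<alpha>) *
        stable_density \<alpha> 1 (s powr (- 1 / \<alpha>)))"

definition rl_kernel :: "real \<Rightarrow> real \<Rightarrow> real" where
  "rl_kernel \<rho> t = t powr (\<rho> - 1) / Gamma \<rho>"

text \<open>
  For fixed \<open>x\<close> the Volterra equation \<open>Z(t,x) = \<integral>\<^sub>0\<^sup>t g\<^bsub>1-\<alpha>\<^esub>(t-s) Y(s,x) ds\<close>, \<open>t > 0\<close>, determines
  \<open>Y(\<cdot>,x)\<close> almost everywhere; again the continuous version on \<open>(0, \<infinity>)\<close> is taken. Only \<open>x \<noteq> 0\<close>
  matters: \<open>Z\<close> and \<open>Y\<close> may be singular at \<open>x = 0\<close>, where the values below are irrelevant because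
  the kernels only occur under an integral in \<open>x\<close>.
\<close>

definition Y_kernel :: "real \<Rightarrow> real \<Rightarrow> 'a::euclidean_space measure \<Rightarrow> real \<Rightarrow> 'a \<Rightarrow> real" where
  "Y_kernel \<alpha> \<beta> \<nu> t x = (THE y.
     continuous_on {0<..} y \<and> (\<forall>\<tau>\<le>0. y \<tau> = 0) \<and>
     (\<forall>\<tau>>0. has_bochner_integral lborel
        (\<lambda>s. indicator {0<..<\<tau>} s * (rl_kernel (1 - \<alpha>) (\<tau> - s) * y s))
        (Z_kernel \<alpha> \<beta> \<nu> \<tau> x))) t"

subsection \<open>Integral solutions\<close>

text \<open>
  The kernels are non-negative, so the integrals are taken in \<open>[0, \<infinity>]\<close>. Since \<open>u\<close> is finite almost
  everywhere, the value \<open>f 0\<close> used where \<open>u = \<infinity>\<close> does not matter.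
\<close>

definition integral_solution ::
  "real \<Rightarrow> real \<Rightarrow> 'a::euclidean_space measure \<Rightarrow> (real \<Rightarrow> real) \<Rightarrow> ('a \<Rightarrow> real) \<Rightarrow> real \<Rightarrow>
    (real \<times> 'a \<Rightarrow> ennreal) \<Rightarrow> bool" where
  "integral_solution \<alpha> \<beta> \<nu> f u0 T u \<longleftrightarrow>
     u \<in> borel_measurable (lebesgue_on ({0..<T} \<times> UNIV)) \<and>
     (AE (t, x) in lebesgue. t \<in> {0..<T} \<longrightarrow> u (t, x) < \<infinity>) \<and>
     (AE (t, x) in lebesgue. t \<in> {0<..<T} \<longrightarrow>
        u (t, x) =
          (\<integral>\<^sup>+y. ennreal (Z_kernel \<alpha> \<beta> \<nu> t (x - y)) * ennreal (u0 y) \<partial>lebesgue) +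
          (\<integral>\<^sup>+s. (\<integral>\<^sup>+y. ennreal (Y_kernel \<alpha> \<beta> \<nu> (t - s) (x - y)) *
             ennreal (f (enn2real (u (s, y)))) \<partial>lebesgue) * indicator {0<..<t} s \<partial>lebesgue))"

definition global_integral_solution ::
  "real \<Rightarrow> real \<Rightarrow> 'a::euclidean_space measure \<Rightarrow> (real \<Rightarrow> real) \<Rightarrow> ('a \<Rightarrow> real) \<Rightarrow>
    (real \<times> 'a \<Rightarrow> ennreal) \<Rightarrow> bool" where
  "global_integral_solution \<alpha> \<beta> \<nu> f u0 u \<longleftrightarrow> (\<forall>T>0. integral_solution \<alpha> \<beta> \<nu> f u0 T u)"

definition Linf_loc :: "(real \<times> 'a::euclidean_space \<Rightarrow> ennreal) set" where
  "Linf_loc = {u. u \<in> borel_measurable (lebesgue_on ({0<..} \<times> UNIV)) \<and>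
     (\<forall>T>0. \<exists>M::real. AE (t, x) in lebesgue. t \<in> {0<..<T} \<longrightarrow> u (t, x) \<le> ennreal M)}"

subsection \<open>Osgood-type functions\<close>

primrec osgood_seq :: "real \<Rightarrow> real \<Rightarrow> nat \<Rightarrow> real" where
  "osgood_seq k \<phi>0 0 = \<phi>0"
| "osgood_seq k \<phi>0 (Suc i) = osgood_seq k \<phi>0 i powr k"

text \<open>For \<open>s > \<phi>0\<close> the index \<open>i \<ge> 1\<close> is the one with \<open>\<phi>\<^bsub>i-1\<^esub> < s \<le> \<phi>\<^sub>i\<close>.\<close>

definition osgood_fun :: "real \<Rightarrow> real \<Rightarrow> real \<Rightarrow> real" where
  "osgood_fun k \<phi>0 s =
     (if s \<le> \<phi>0 then (1 - \<phi>0 powr (1 - k)) * s powr k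
      else let \<phi> = osgood_seq k \<phi>0;
               i = (LEAST i. s \<le> \<phi> i);
               a = \<phi> i - \<phi> (i - 1);
               b = \<phi> (Suc i) - \<phi> i
           in if s \<le> \<phi> i / 2 then a
              else a + (s - \<phi> i / 2) / (\<phi> i - \<phi> i / 2) * (b - a))"

lemma osgood_seq_step:
  assumes k: "1 < k" and p: "2 powr (1 / (k - 1)) < \<phi>0"
  shows "\<phi>0 \<le> osgood_seq k \<phi>0 i \<and> 2 * osgood_seq k \<phi>0 i < osgood_seq k \<phi>0 (Suc i)"
proof -
  have p0: "0 < \<phi>0" using p powr_ge_zero[of 2 "1 / (k - 1)"] by linarith
  have *: "2 * x < x powr k" if "\<phi>0 \<le> x" for x
  proof -
    have x: "0 < x" using that p0 by linarith
    have "2 powr (1 / (k - 1)) < x" using that p by linarith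
    then have "(2 powr (1 / (k - 1))) powr (k - 1) < x powr (k - 1)"
      using k by (intro powr_less_mono2) auto
    moreover have "(2 powr (1 / (k - 1))) powr (k - 1) = (2::real)" using k by (simp add: powr_powr)
    ultimately have "2 < x powr (k - 1)" by simp
    then have "x * 2 < x * x powr (k - 1)" using x by simp
    also have "\<dots> = x powr k" using x by (simp add: powr_mult_base)
    finally show ?thesis by simp
  qed
  have "\<phi>0 \<le> osgood_seq k \<phi>0 i"
  proof (induction i)
    case (Suc i) then show ?case using *[OF Suc] p0 by simp
  qed simp
  then show ?thesis using * by simp
qed

lemma osgood_fun_clauses:
  assumes k: "1 < k" and p: "2 powr (1 / (k - 1)) < \<phi>0"
  defines "\<phi> \<equiv> osgood_seq k \<phi>0" and "F \<equiv> osgood_fun k \<phi>0"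
  shows "s \<le> \<phi>0 \<Longrightarrow> F s = (1 - \<phi>0 powr (1 - k)) * s powr k"
    and "s \<in> {\<phi> i .. \<phi> (Suc i) / 2} \<Longrightarrow> F s = \<phi> (Suc i) - \<phi> i"
    and "s \<in> {\<phi> (Suc i) / 2 <..< \<phi> (Suc i)} \<Longrightarrow>
      F s = F (\<phi> (Suc i) / 2) + (s - \<phi> (Suc i) / 2) / (\<phi> (Suc i) - \<phi> (Suc i) / 2) *
        (F (\<phi> (Suc i)) - F (\<phi> (Suc i) / 2))"
proof -
  have st: "\<phi>0 \<le> \<phi> i" "2 * \<phi> i < \<phi> (Suc i)" for i
    using osgood_seq_step[OF k p] unfolding \<phi>_def by auto
  have p0: "0 < \<phi>0" using p powr_ge_zero[of 2 "1 / (k - 1)"] by linarith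
  have sm: "strict_mono \<phi>" unfolding strict_mono_Suc_iff using st p0 by (smt (verit))
  have L: "(LEAST i. s \<le> \<phi> i) = Suc i" if "\<phi> i < s" "s \<le> \<phi> (Suc i)" for s i
  proof (rule Least_equality)
    fix j assume "s \<le> \<phi> j" then have "\<phi> i < \<phi> j" using that by linarith
    then show "Suc i \<le> j" using sm by (simp add: strict_mono_less Suc_le_eq)
  qed fact
  have E: "F s = (if s \<le> \<phi> (Suc i) / 2 then \<phi> (Suc i) - \<phi> i else
     (\<phi> (Suc i) - \<phi> i) + (s - \<phi> (Suc i) / 2) / (\<phi> (Suc i) - \<phi> (Suc i) / 2) *
        ((\<phi> (Suc (Suc i)) - \<phi> (Suc i)) - (\<phi> (Suc i) - \<phi> i)))"
    if "\<phi> i < s" "s \<le> \<phi> (Suc i)" for s i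
    using st[of i] that L[OF that] unfolding F_def osgood_fun_def \<phi>_def[symmetric] Let_def by simp
  have V0: "F \<phi>0 = \<phi> 1 - \<phi> 0"
    using p0 by (simp add: F_def osgood_fun_def \<phi>_def algebra_simps flip: powr_add)
  have V: "F (\<phi> i) = \<phi> (Suc i) - \<phi> i" for i
  proof (cases i)
    case 0 then show ?thesis using V0 by (simp add: \<phi>_def)
  next
    case (Suc j)
    have "\<phi> j < \<phi> i" "\<phi> i > 0" using st[of j] st[of i] p0 Suc by (smt (verit))+
    then show ?thesis using E[of j "\<phi> i"] Suc by (simp add: field_simps)
  qed
  show "F s = (1 - \<phi>0 powr (1 - k)) * s powr k" if "s \<le> \<phi>0"
    using that by (simp add: F_def osgood_fun_def)
  show c: "F s = \<phi> (Suc i) - \<phi> i" if "s \<in> {\<phi> i .. \<phi> (Suc i) / 2}" for s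
    using that V[of i] E[of i s] st[of i] p0 by (cases "s = \<phi> i") auto
  show "F s = F (\<phi> (Suc i) / 2) + (s - \<phi> (Suc i) / 2) / (\<phi> (Suc i) - \<phi> (Suc i) / 2) *
        (F (\<phi> (Suc i)) - F (\<phi> (Suc i) / 2))" if "s \<in> {\<phi> (Suc i) / 2 <..< \<phi> (Suc i)}"
    using that V[of "Suc i"] E[of i s] st[of i] p0 c[of "\<phi> (Suc i) / 2"] by auto
qed

definition osgood_type :: "real \<Rightarrow> (real \<Rightarrow> real) \<Rightarrow> bool" where
  "osgood_type k f \<longleftrightarrow> 1 < k \<and> continuous_on {0..} f \<and> (\<forall>s\<ge>0. 0 \<le> f s) \<and>
     (\<exists>\<phi>0 c C. 2 powr (1 / (k - 1)) < \<phi>0 \<and> 0 < c \<and> 0 < C \<and>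
       (\<forall>s\<ge>0. c * osgood_fun k \<phi>0 s \<le> f s \<and> f s \<le> C * osgood_fun k \<phi>0 s))"

end

theory Submission
  imports Defs "HOL-Complex_Analysis.Cauchy_Integral_Formula" "HOL-Real_Asymp.Real_Asymp"
begin

text \<open>
  Both kernels are mixtures of the Green functions \<open>G(\<tau>, \<cdot>)\<close> in operational time \<open>\<tau>\<close>:
  with the one-sided stable density \<open>p\<close>,
  \<open>Y(t, x) = \<integral> G(\<tau>, x) \<tau>\<^sup>-\<^sup>1\<^sup>/\<^sup>\<alpha> p(t \<tau>\<^sup>-\<^sup>1\<^sup>/\<^sup>\<alpha>) d\<tau>\<close>, and the Volterra equation linking \<open>Y\<close> to \<open>Z\<close>
  reduces to the identity \<open>r p(r) = \<alpha> (g\<^bsub>1-\<alpha>\<^esub> * p)(r)\<close>, which is the differentiated Laplace transform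
  \<open>e\<^bsup>-\<lambda>^\<alpha>\<^esup>\<close>. Since \<open>G(\<tau>, \<cdot>) \<ge> 0\<close> has mass at most \<open>1\<close>, \<open>Z\<close> and \<open>Y\<close> are bounded in \<open>L\<^sub>1\<close> by a
  constant and by a multiple of \<open>t\<^bsup>\<alpha>-1\<^esup>\<close>, and no pointwise kernel estimates are needed.

  The plateaus of an Osgood-type function give \<open>f(v) \<le> C v\<close> along a sequence \<open>v \<rightarrow> \<infinity>\<close> with one constant
  \<open>C\<close>. Hence a step function with a fixed step length and values in this sequence is a supersolution for
  all times, below which monotone iteration converges. Uniqueness follows from a contraction in an
  exponentially weighted supremum norm.
\<close>

subsection \<open>Integrals on half lines and Cauchy's formula on a half plane\<close>

text \<open>\<open>stable_density\<close> and \<open>Y_kernel\<close> are definite descriptions, so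
  nothing is known about them until the described function is shown to exist and to be unique. For
  the density, existence is complex inversion of the Laplace transform; sign and uniqueness both
  come from iterated differences of the transform. For \<open>Y_kernel\<close>, uniqueness is that
  of Abel's equation, and the candidate is known to be continuous in time only at points x where
  certain mixtures converge; without pointwise bounds these are merely almost all x. Nonnegativity
  of G is positive definiteness of exp(-t \<psi>), reached as a limit of characteristic functions of
  compound Poisson laws. The L1 bounds on Z and Y rest on the tail of p, which the convolution
  identity for p yields by bootstrapping. The equation has memory, so a supersolution cannot be
  restarted after each time step. But the contribution of earlier steps does not involve the current
  value: it is absorbed by choosing that value large, while the linear bound with one constant C
  controls the current step over a length that does not depend on the value.\<close>

lemma exp_minus_le_inverse_power:
  fixes x :: real assumes "0 < x"
  shows "exp (- x) \<le> fact n / x ^ n"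
proof -
  have "x ^ n / fact n \<le> exp x"
    using sum_le_suminf[OF sums_summable[OF exp_converges[of x]], of "{n}"] assms
    by (simp add: exp_def divide_inverse_commute)
  then show ?thesis using assms by (simp add: exp_minus field_simps)
qed

lemma nn_integral_powr_from_0:
  assumes "-1 < e" "0 \<le> c"
  shows "(\<integral>\<^sup>+x. ennreal (x powr e) * indicator {0..c} x \<partial>lborel) = ennreal (c powr (e + 1) / (e + 1))"
  by (rule nn_integral_has_integral_lebesgue'[OF _ has_integral_powr_from_0[OF assms]]) simp

lemma nn_integral_powr_to_inf:
  fixes c e :: real
  assumes "e < -1" "0 < c"
  shows "(\<integral>\<^sup>+x. ennreal (x powr e) * indicator {c..} x \<partial>lborel) = ennreal (- (c powr (e + 1) / (e + 1)))"
  using nn_integral_has_integral_lebesgue'[OF _ has_integral_powr_to_inf[OF assms]] by simp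

lemma integrable_exp_minus_powr:
  fixes a c :: real assumes a: "0 < a" and c: "0 < c"
  shows "integrable lborel (\<lambda>x::real. exp (- c * \<bar>x\<bar> powr a))"
proof -
  \<comment> \<open>With a n > 2 the bound n! / (c x^a)^n of the exponential is integrable at
    infinity.\<close>
  obtain n :: nat where n: "2 / a < real n" using reals_Archimedean2 by blast
  then have n2: "2 < a * real n" using a by (simp add: field_simps)
  have pos: "integrable lborel (\<lambda>x. indicator {0..} x * exp (- c * \<bar>x\<bar> powr a))"
  proof (rule integrableI_nonneg)
    have "(\<integral>\<^sup>+x. ennreal (indicator {0..} x * exp (- c * \<bar>x\<bar> powr a)) \<partial>lborel)
      \<le> (\<integral>\<^sup>+x. indicator {0..1} x + ennreal (fact n / c ^ n) * (ennreal (x powr (- (a * real n))) * indicator {1..} x) \<partial>lborel)"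
    proof (rule nn_integral_mono)
      fix x :: real
      show "ennreal (indicator {0..} x * exp (- c * \<bar>x\<bar> powr a)) \<le> indicator {0..1} x + ennreal (fact n / c ^ n) * (ennreal (x powr (- (a * real n))) * indicator {1..} x)"
      proof (cases "1 < x")
        case True
        have "exp (- (c * x powr a)) \<le> fact n / (c * x powr a) ^ n"
          using True c by (intro exp_minus_le_inverse_power) simp
        also have "\<dots> = fact n / c ^ n * x powr (- (a * real n))"
          using True by (simp add: power_mult_distrib powr_powr powr_minus field_simps flip: powr_realpow)
        finally show ?thesis using True c by (simp add: ennreal_mult[symmetric] ennreal_leI)
      qed (use c in \<open>auto simp: indicator_def ennreal_le_1 intro: add_increasing2\<close>)
    qed
    also have "\<dots> = 1 + ennreal (fact n / c ^ n) * ennreal (- (1 powr (- (a * real n) + 1) / (- (a * real n) + 1)))"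
      using nn_integral_powr_to_inf[of "- (a * real n)" 1] n2
      by (subst nn_integral_add) (auto simp: nn_integral_cmult)
    also have "\<dots> < \<infinity>" by (simp add: ennreal_mult_less_top)
    finally show "(\<integral>\<^sup>+x. ennreal (indicator {0..} x * exp (- c * \<bar>x\<bar> powr a)) \<partial>lborel) < \<infinity>" .
  qed auto
  have "integrable lborel (\<lambda>x. indicator {0..} (- x) * exp (- c * \<bar>- x\<bar> powr a))"
    using lborel_integrable_real_affine[OF pos, of "-1" 0] by simp
  from Bochner_Integration.integrable_add[OF pos this]
  show ?thesis
    by (rule Bochner_Integration.integrable_bound) (auto simp: indicator_def)
qed

lemma has_bochner_integral_exp_complex:
  fixes w :: complex assumes w: "0 < Re w"
  shows "has_bochner_integral lborel (\<lambda>s::real. indicator {0<..} s *\<^sub>R exp (- (w * of_real s))) (1 / w)"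
proof -
  have w0: "w \<noteq> 0" using w by auto
  have int: "set_integrable lborel (einterval 0 \<infinity>) (\<lambda>s. exp (- (w * complex_of_real s)))"
  proof -
    have "integrable lborel (\<lambda>s. indicator {0..} s * exp (- Re w * s))"
    proof (rule integrableI_nonneg)
      have "(\<integral>\<^sup>+s. ennreal (exp (- Re w * s)) * indicator {0..} s \<partial>lborel) = ennreal (exp (- Re w * 0) / Re w)"
        by (rule nn_integral_has_integral_lebesgue'[OF _ has_integral_exp_minus_to_infinity[OF w]]) simp
      then show "(\<integral>\<^sup>+s. ennreal (indicator {0..} s * exp (- Re w * s)) \<partial>lborel) < \<infinity>"
        by (simp add: ennreal_mult mult.commute ennreal_indicator)
    qed auto
    then show ?thesis unfolding set_integrable_def
      by (rule Bochner_Integration.integrable_bound)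
         (auto simp: einterval_def indicator_def zero_ereal_def)
  qed
  have lim: "((\<lambda>s. - exp (- (w * complex_of_real s)) / w) \<longlongrightarrow> 0) at_top"
  proof (rule Lim_null_comparison)
    show "\<forall>\<^sub>F s in at_top. norm (- exp (- (w * complex_of_real s)) / w) \<le> exp (- Re w * s) / norm w"
      by (simp add: norm_divide)
    show "((\<lambda>s. exp (- Re w * s) / norm w) \<longlongrightarrow> 0) at_top"
      using w w0 by real_asymp
  qed
  have "(LBINT s=0..\<infinity>. exp (- (w * complex_of_real s))) = 0 - (- 1 / w)"
  proof (rule interval_integral_FTC_integrable[where F = "\<lambda>s. - exp (- (w * complex_of_real s)) / w"])
    show "((\<lambda>s. - exp (- (w * complex_of_real s)) / w) has_vector_derivative exp (- (w * complex_of_real s))) (at s)" for s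
      using w0 by (auto intro!: derivative_eq_intros has_vector_derivative_real_field simp: field_simps)
    show "((((\<lambda>s. - exp (- (w * complex_of_real s)) / w) \<circ> real_of_ereal) \<longlongrightarrow> - 1 / w) (at_right 0))"
      unfolding zero_ereal_def ereal_tendsto_simps
      by (rule tendsto_eq_intros refl | use w0 in simp)+
    show "((((\<lambda>s. - exp (- (w * complex_of_real s)) / w) \<circ> real_of_ereal) \<longlongrightarrow> 0) (at_left \<infinity>))"
      unfolding ereal_tendsto_simps using lim .
  qed (use int in \<open>auto intro!: continuous_intros\<close>)
  moreover have e: "einterval 0 \<infinity> = {0::real<..}" by (auto simp: einterval_def zero_ereal_def)
  ultimately show ?thesis
    using int unfolding has_bochner_integral_iff set_integrable_def e
    by (simp add: interval_lebesgue_integral_def set_lebesgue_integral_def e zero_ereal_def)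
qed

text \<open>Integrate f(w) / (w - l) around the rectangle with corners -iR, R - iR, R + iR, iR. On
  the three outer sides, of total length 4R, the norm of w is at least R, so the decay of f makes
  them vanish as R grows. The side on the imaginary axis is what remains, and reversing its
  orientation turns w - l into l - iy.\<close>

lemma Cauchy_integral_formula_half_plane:
  fixes f :: "complex \<Rightarrow> complex" and a c l :: real
  assumes cont: "continuous_on {z. 0 \<le> Re z} f" and holo: "f holomorphic_on {z. 0 < Re z}"
    and bound: "\<And>z. 0 \<le> Re z \<Longrightarrow> norm (f z) \<le> exp (- c * norm z powr a)"
    and a: "0 < a" and c: "0 < c" and l: "0 < l"
  shows "has_bochner_integral lborel (\<lambda>y. f (\<i> * of_real y) / (of_real l - \<i> * of_real y)) (2 * pi * f (of_real l))"
proof -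
  let ?S = "{z. 0 \<le> Re z}"
  let ?h = "\<lambda>y. f (\<i> * complex_of_real y) / (complex_of_real l - \<i> * complex_of_real y)"
  have S: "convex ?S" "interior ?S = {z. 0 < Re z}"
    using convex_halfspace_Re_ge[of 0] interior_halfspace_ge[of "1::complex" 0] by (auto simp: inner_complex_def)
  have nl: "l \<le> norm (complex_of_real l - \<i> * complex_of_real y)" for y
    using abs_Re_le_cmod[of "complex_of_real l - \<i> * complex_of_real y"] l by simp
  have nz: "complex_of_real l - \<i> * complex_of_real y \<noteq> 0" for y
    using nl[of y] l by auto
  have conth: "continuous_on UNIV ?h"
    by (intro continuous_intros continuous_on_compose2[OF cont]) (use l in \<open>auto simp: nz\<close>)
  have int: "integrable lborel ?h"
  proof (rule Bochner_Integration.integrable_bound)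
    show "integrable lborel (\<lambda>y::real. exp (- c * \<bar>y\<bar> powr a) / l)"
      using integrable_exp_minus_powr[OF a c] by simp
    show "?h \<in> borel_measurable lborel" using borel_measurable_continuous_onI[OF conth] by simp
    have "norm (?h y) \<le> exp (- c * \<bar>y\<bar> powr a) / l" for y
      unfolding norm_divide using bound[of "\<i> * complex_of_real y"] nl[of y] l
      by (intro frac_le) (auto simp: norm_mult)
    then show "AE y in lborel. norm (?h y) \<le> norm (exp (- c * \<bar>y\<bar> powr a) / l)" using l by simp
  qed
  have est: "norm (integral {-R..R} ?h - 2 * pi * f (of_real l)) \<le> exp (- c * R powr a) / (R - l) * (4 * R)"
    if R: "l < R" for R
  proof -
    let ?g = "\<lambda>w. f w / (w - of_real l)"
    define a1 a2 a3 a4 where "a1 = Complex 0 (-R)" and "a2 = Complex R (-R)" and "a3 = Complex R R" and "a4 = Complex 0 R"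
    note ad = a1_def a2_def a3_def a4_def
    have box: "complex_of_real l \<in> box a1 a3" using R l by (auto simp: in_box_complex_iff ad)
    \<comment> \<open>The left side lies on the imaginary axis, where f is only continuous, so the
      version of Cauchy's formula that asks for differentiability in the interior alone is
      used.\<close>
    have "(?g has_contour_integral (2*pi * \<i> * winding_number (rectpath a1 a3) (of_real l) * f (of_real l))) (rectpath a1 a3)"
    proof (rule Cauchy_integral_formula_weak[OF S(1) finite.emptyI cont])
      show "\<And>x. x \<in> interior ?S - {} \<Longrightarrow> f field_differentiable at x"
        using holo unfolding S(2) by (auto simp: holomorphic_on_open field_differentiable_def open_halfspace_Re_gt)
      show "complex_of_real l \<in> interior ?S - {}" unfolding S(2) using l by simp
      have "path_image (rectpath a1 a3) = cbox a1 a3 - box a1 a3"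
        using R l by (intro path_image_rectpath_cbox_minus_box) (simp_all add: ad)
      then show "path_image (rectpath a1 a3) \<subseteq> ?S - {complex_of_real l}"
        using box by (force simp: in_cbox_complex_iff a1_def)
    qed (auto)
    then have "(?g has_contour_integral (2*pi * \<i> * f (of_real l))) (linepath a1 a2 +++ linepath a2 a3 +++ linepath a3 a4 +++ linepath a4 a1)"
      unfolding winding_number_rectpath[OF box] by (simp add: rectpath_def Let_def ad)
    moreover from this have ci: "?g contour_integrable_on linepath a1 a2" "?g contour_integrable_on linepath a2 a3"
      "?g contour_integrable_on linepath a3 a4" "?g contour_integrable_on linepath a4 a1"
      by (auto dest!: has_contour_integral_integrable)
    ultimately have sum: "2*pi * \<i> * f (of_real l) = contour_integral (linepath a1 a2) ?g
       + (contour_integral (linepath a2 a3) ?g + (contour_integral (linepath a3 a4) ?g + contour_integral (linepath a4 a1) ?g))"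
      by (auto dest!: contour_integral_unique)
    have "contour_integral (linepath a4 a1) ?g = - contour_integral (linepath a1 a4) ?g"
      using contour_integral_reverse_linepath[of a4 a1 ?g] contour_integral_reversepath[of "linepath a1 a4" ?g] by simp
    also have "contour_integral (linepath a1 a4) ?g = \<i> * integral {-R..R} (\<lambda>y. ?g (Complex 0 y))"
      using R l by (intro contour_integral_linepath_same_Re) (auto simp: ad)
    also have "(\<lambda>y. ?g (Complex 0 y)) = (\<lambda>y. - ?h y)"
      by (auto simp: fun_eq_iff Complex_eq divide_simps nz) (auto simp: algebra_simps)
    finally have left: "contour_integral (linepath a4 a1) ?g = \<i> * integral {-R..R} ?h" by simp
    have gb: "norm (?g w) \<le> exp (- c * R powr a) / (R - l)" if "0 \<le> Re w" "R \<le> norm w" for w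
    proof -
      have "norm (f w) \<le> exp (- c * norm w powr a)" using bound that by simp
      also have "\<dots> \<le> exp (- c * R powr a)"
        using that R l c a by (auto intro!: powr_mono2)
      finally have 1: "norm (f w) \<le> exp (- c * R powr a)" .
      have "R - l \<le> norm (w - of_real l)"
        using norm_triangle_ineq2[of w "of_real l"] that l by simp
      with 1 show ?thesis unfolding norm_divide using R by (intro frac_le) auto
    qed
    have B0: "0 \<le> exp (- c * R powr a) / (R - l)" using R by simp
    have seg: "0 \<le> Re w \<and> R \<le> norm w" if "w \<in> closed_segment a1 a2 \<union> closed_segment a2 a3 \<union> closed_segment a3 a4" for w
    proof -
      have "w \<in> closed_segment a1 a2 \<or> w \<in> closed_segment a2 a3 \<or> w \<in> closed_segment a3 a4" using that by auto
      then have "\<bar>Im w\<bar> = R \<or> Re w = R"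
        using R l by (auto simp: closed_segment_def ad algebra_simps complex_eq_iff)
      moreover have "closed_segment a1 a2 \<subseteq> ?S" "closed_segment a2 a3 \<subseteq> ?S" "closed_segment a3 a4 \<subseteq> ?S"
        by (intro closed_segment_subset S(1); use R l in \<open>simp add: ad\<close>)+
      ultimately show ?thesis using that abs_Im_le_cmod[of w] abs_Re_le_cmod[of w] R l by auto
    qed
    have nrm: "norm (a2 - a1) = R" "norm (a3 - a2) = 2 * R" "norm (a4 - a3) = R"
      using R l cmod_eq_Re[of "a2 - a1"] cmod_eq_Im[of "a3 - a2"] cmod_eq_Re[of "a4 - a3"] by (simp_all add: ad)
    have n1: "norm (contour_integral (linepath a1 a2) ?g) \<le> exp (- c * R powr a) / (R - l) * R"
      using contour_integral_bound_linepath[OF ci(1) B0] gb seg unfolding nrm by auto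
    have n2: "norm (contour_integral (linepath a2 a3) ?g) \<le> exp (- c * R powr a) / (R - l) * (2 * R)"
      using contour_integral_bound_linepath[OF ci(2) B0] gb seg unfolding nrm by auto
    have n3: "norm (contour_integral (linepath a3 a4) ?g) \<le> exp (- c * R powr a) / (R - l) * R"
      using contour_integral_bound_linepath[OF ci(3) B0] gb seg unfolding nrm by auto
    have "integral {-R..R} ?h - 2 * pi * f (of_real l) = \<i> * (contour_integral (linepath a1 a2) ?g
       + contour_integral (linepath a2 a3) ?g + contour_integral (linepath a3 a4) ?g)"
    proof -
      have "\<i> * (2*pi * \<i> * f (of_real l)) = \<i> * (contour_integral (linepath a1 a2) ?g
       + contour_integral (linepath a2 a3) ?g + contour_integral (linepath a3 a4) ?g) + \<i> * (\<i> * integral {-R..R} ?h)"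
        unfolding sum left by (simp add: algebra_simps)
      then show ?thesis by (simp add: algebra_simps)
    qed
    then have "norm (integral {-R..R} ?h - 2 * pi * f (of_real l)) = norm (contour_integral (linepath a1 a2) ?g
       + contour_integral (linepath a2 a3) ?g + contour_integral (linepath a3 a4) ?g)" by (simp add: norm_mult)
    also have "\<dots> \<le> norm (contour_integral (linepath a1 a2) ?g)
       + norm (contour_integral (linepath a2 a3) ?g) + norm (contour_integral (linepath a3 a4) ?g)"
      by (intro norm_triangle_le add_right_mono norm_triangle_ineq)
    also have "\<dots> \<le> exp (- c * R powr a) / (R - l) * R + exp (- c * R powr a) / (R - l) * (2 * R) + exp (- c * R powr a) / (R - l) * R"
      by (intro add_mono n1 n2 n3)
    also have "\<dots> = exp (- c * R powr a) / (R - l) * (4 * R)" by algebra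
    finally show ?thesis .
  qed
  have "((\<lambda>n. integral {-real n..real n} ?h - 2 * pi * f (of_real l)) \<longlongrightarrow> 0) sequentially"
  proof (rule Lim_null_comparison)
    show "\<forall>\<^sub>F n in sequentially. norm (integral {-real n..real n} ?h - 2 * pi * f (of_real l)) \<le> exp (- c * real n powr a) / (real n - l) * (4 * real n)"
      using eventually_gt_at_top[of "nat \<lceil>l\<rceil>"] by eventually_elim (rule est, linarith)
    show "(\<lambda>n. exp (- c * real n powr a) / (real n - l) * (4 * real n)) \<longlonglongrightarrow> 0"
      using a c l by real_asymp
  qed
  then have lim1: "(\<lambda>n. integral {-real n..real n} ?h) \<longlonglongrightarrow> 2 * pi * f (of_real l)"
    by (simp add: LIM_zero_iff)
  have "(\<lambda>n. LBINT y. indicator {-real n..real n} y *\<^sub>R ?h y) \<longlonglongrightarrow> (LBINT y. ?h y)"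
  proof (rule integral_dominated_convergence[where w = "\<lambda>y. norm (?h y)"])
    show "AE y in lborel. (\<lambda>n. indicator {-real n..real n} y *\<^sub>R ?h y) \<longlonglongrightarrow> ?h y"
    proof (rule AE_I2)
      fix y :: real
      have "\<forall>\<^sub>F n in sequentially. indicator {-real n..real n} y *\<^sub>R ?h y = ?h y"
        using eventually_gt_at_top[of "nat \<lceil>\<bar>y\<bar>\<rceil>"] by eventually_elim (simp add: indicator_def, linarith)
      then show "(\<lambda>n. indicator {-real n..real n} y *\<^sub>R ?h y) \<longlonglongrightarrow> ?h y"
        by (rule tendsto_eventually)
    qed
  qed (use int in \<open>auto simp: indicator_def\<close>)
  moreover have "(LBINT y. indicator {-real n..real n} y *\<^sub>R ?h y) = integral {-real n..real n} ?h" for n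
    using set_borel_integral_eq_integral(2)[of "{-real n..real n}" ?h] int
    by (simp add: set_lebesgue_integral_def set_integrable_def integrable_mult_indicator)
  ultimately have "(LBINT y. ?h y) = 2 * pi * f (of_real l)" using lim1 LIMSEQ_unique by auto
  with int show ?thesis by (simp add: has_bochner_integral_iff)
qed

subsection \<open>Laplace transforms of continuous densities\<close>

text \<open>Difference with the sign for which all iterates of a completely monotone function are
  nonnegative. On a Laplace transform it multiplies the density by 1 - exp(-s).\<close>

definition fdiff :: "(real \<Rightarrow> real) \<Rightarrow> real \<Rightarrow> real" where
  "fdiff f x = f x - f (x + 1)"

text \<open>S is a class of nonnegative functions closed under negated differentiation, so its
  members decrease and their differences are nonnegative. Differences commute with derivatives,
  hence the image of S under \<open>fdiff\<close> is again such a class, and the induction replaces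
  S by this image.\<close>

lemma completely_monotone_fdiff_nonneg:
  assumes S: "\<And>f. f \<in> S \<Longrightarrow> (\<forall>x>0. 0 \<le> f x) \<and> (\<exists>g\<in>S. \<forall>x>0. (f has_real_derivative - g x) (at x))"
    and f: "f \<in> S" and x: "0 < x"
  shows "0 \<le> (fdiff ^^ n) f x"
  using S f
proof (induction n arbitrary: S f)
  case 0 then show ?case using x by auto
next
  case (Suc n)
  have "0 \<le> (fdiff ^^ n) (fdiff f) x"
  proof (rule Suc.IH[where S = "fdiff ` S"])
    fix h assume "h \<in> fdiff ` S"
    then obtain f where h: "h = fdiff f" "f \<in> S" by auto
    then obtain g where g: "g \<in> S" and d: "\<And>x. 0 < x \<Longrightarrow> (f has_real_derivative - g x) (at x)"
      using Suc.prems(1) by blast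
    have gn: "0 \<le> g x" if "0 < x" for x using Suc.prems(1)[OF g] that by auto
    have "0 \<le> h x" if "0 < x" for x
    proof -
      have "f (x + 1) \<le> f x"
      proof (rule DERIV_nonpos_imp_nonincreasing[of x "x + 1"])
        fix y assume "x \<le> y" "y \<le> x + 1"
        then show "\<exists>z. (f has_real_derivative z) (at y) \<and> z \<le> 0"
          using d[of y] gn[of y] that by (intro exI[of _ "- g y"]) auto
      qed simp
      then show ?thesis by (simp add: h fdiff_def)
    qed
    moreover have "(h has_real_derivative - fdiff g x) (at x)" if "0 < x" for x
      using d[OF that] d[of "x + 1"] that
      by (auto simp: h fdiff_def[abs_def] intro!: derivative_eq_intros DERIV_shift[THEN iffD1])
    ultimately show "(\<forall>x>0. 0 \<le> h x) \<and> (\<exists>g\<in>fdiff ` S. \<forall>x>0. (h has_real_derivative - g x) (at x))"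
      using g by blast
  qed (use Suc.prems in auto)
  then show ?case by (simp add: funpow_swap1)
qed

text \<open>Negated differentiation sends a generator to a sum of two generators, with exponents a +
  1 and a + 1 - \<alpha>. Since \<alpha> < 1 these stay nonnegative, so the cone is closed under
  negated differentiation.\<close>

inductive_set stable_cone :: "real \<Rightarrow> (real \<Rightarrow> real) set" for \<alpha> where
  base: "0 \<le> c \<Longrightarrow> 0 \<le> a \<Longrightarrow> (\<lambda>l. c * l powr (- a) * exp (- (l powr \<alpha>))) \<in> stable_cone \<alpha>"
| add: "f \<in> stable_cone \<alpha> \<Longrightarrow> g \<in> stable_cone \<alpha> \<Longrightarrow> (\<lambda>l. f l + g l) \<in> stable_cone \<alpha>"

lemma fdiff_exp_minus_powr_nonneg:
  assumes \<alpha>: "0 < \<alpha>" "\<alpha> < 1" and x: "0 < x"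
  shows "0 \<le> (fdiff ^^ n) (\<lambda>l. exp (- (l powr \<alpha>))) x"
proof -
  have D: "(\<forall>x>0. 0 \<le> f x) \<and> (\<exists>g\<in>stable_cone \<alpha>. \<forall>x>0. (f has_real_derivative - g x) (at x))"
    if "f \<in> stable_cone \<alpha>" for f
    using that
  proof induction
    case (base c a)
    let ?g = "\<lambda>l. c * a * l powr (- (a + 1)) * exp (- (l powr \<alpha>)) + c * \<alpha> * l powr (- (a + 1 - \<alpha>)) * exp (- (l powr \<alpha>))"
    have "?g \<in> stable_cone \<alpha>"
      using base \<alpha> by (intro stable_cone.intros) auto
    moreover have "\<forall>x>0. ((\<lambda>l. c * l powr (- a) * exp (- (l powr \<alpha>))) has_real_derivative - ?g x) (at x)"
    proof (intro allI impI)
      fix x :: real assume x: "0 < x"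
      have "((\<lambda>l. c * l powr (- a) * exp (- (l powr \<alpha>))) has_real_derivative
         c * (- a * x powr (- a - 1)) * exp (- (x powr \<alpha>)) + exp (- (x powr \<alpha>)) * (- (\<alpha> * x powr (\<alpha> - 1))) * (c * x powr (- a))) (at x)"
        by (rule DERIV_mult DERIV_cmult DERIV_fun_exp DERIV_minus has_real_derivative_powr x)+
      moreover have "x powr (- (a + 1 - \<alpha>)) = x powr (\<alpha> - 1) * x powr (- a)"
        by (simp add: algebra_simps flip: powr_add)
      moreover have "x powr (- a - 1) = x powr (- 1 - a)"
        by (rule arg_cong) linarith
      ultimately show "((\<lambda>l. c * l powr (- a) * exp (- (l powr \<alpha>))) has_real_derivative - ?g x) (at x)"
        by (simp add: algebra_simps)
    qed
    moreover have "\<forall>x>0. 0 \<le> c * x powr (- a) * exp (- (x powr \<alpha>))" using base by simp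
    ultimately show ?case by (intro conjI bexI[of _ ?g])
  next
    case (add f g)
    then obtain f' g' where fg: "f' \<in> stable_cone \<alpha>" "g' \<in> stable_cone \<alpha>"
      "\<forall>x>0. (f has_real_derivative - f' x) (at x)" "\<forall>x>0. (g has_real_derivative - g' x) (at x)" by blast
    have "(\<lambda>x. f' x + g' x) \<in> stable_cone \<alpha>" using fg(1,2) by (rule stable_cone.add)
    moreover have "\<forall>x>0. ((\<lambda>x. f x + g x) has_real_derivative - (f' x + g' x)) (at x)"
    proof (intro allI impI)
      fix x :: real assume "0 < x"
      then show "((\<lambda>x. f x + g x) has_real_derivative - (f' x + g' x)) (at x)"
        using DERIV_add[of f "- f' x" x UNIV g "- g' x"] fg by simp
    qed
    moreover have "\<forall>x>0. 0 \<le> f x + g x" using add.IH by (blast intro: add_nonneg_nonneg)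
    ultimately show ?case by (intro conjI bexI[of _ "\<lambda>x. f' x + g' x"])
  qed
  have "(\<lambda>l. 1 * l powr (- 0) * exp (- (l powr \<alpha>))) \<in> stable_cone \<alpha>"
    by (rule stable_cone.base) auto
  from completely_monotone_fdiff_nonneg[OF D this x]
  have "0 \<le> (fdiff ^^ n) (\<lambda>l. 1 * l powr (- 0) * exp (- (l powr \<alpha>))) x" .
  \<comment> \<open>The factor \<open>l powr (- 0)\<close> is 1 only for l \<noteq> 0, so the
    functions are compared at positive arguments, which differences never leave.\<close>
  also have "\<dots> = (fdiff ^^ n) (\<lambda>l. exp (- (l powr \<alpha>))) x"
    using x by (induction n arbitrary: x) (simp_all add: fdiff_def)
  finally show ?thesis .
qed

text \<open>Bernstein polynomials of a continuous \<open>g \<ge> 0\<close> in the variable \<open>exp (- s)\<close> are nonnegative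
  combinations of the functions \<open>exp (- j s) (1 - exp (- s))\<^sup>n\<close>, and integrating \<open>q\<close> against these gives
  the iterated differences of the Laplace transform of \<open>q\<close>.\<close>

lemma Laplace_nonneg:
  fixes q :: "real \<Rightarrow> real"
  assumes cont: "continuous_on {0<..} q"
    and int: "integrable lborel (\<lambda>s. indicator {0<..} s * (exp (- s) * q s))"
    and cm: "\<And>n x. 1 \<le> x \<Longrightarrow> 0 \<le> (fdiff ^^ n) (\<lambda>x. LBINT s. indicator {0<..} s * (exp (- x * s) * q s)) x"
    and s: "0 < s"
  shows "0 \<le> q s"
proof (rule ccontr)
  \<comment> \<open>The factor exp(-s) is absorbed because q itself need not be integrable; this is
    why the transform is evaluated at the points 1 + j.\<close>
  define Q where "Q s = indicator {0<..} s * (exp (- s) * q s)" for s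
  have Q: "integrable lborel Q" using int by (simp add: Q_def[abs_def])
  have Qm[measurable]: "Q \<in> borel_measurable borel" using borel_measurable_integrable[OF Q] by simp
  have bint: "integrable lborel (\<lambda>s. Q s * h s)"
    if "h \<in> borel_measurable borel" "\<And>s. 0 < s \<Longrightarrow> \<bar>h s\<bar> \<le> B" for h B
  proof (rule Bochner_Integration.integrable_bound)
    show "integrable lborel (\<lambda>s. \<bar>B\<bar> * \<bar>Q s\<bar>)" using Q by auto
    have "\<bar>Q s * h s\<bar> \<le> \<bar>B\<bar> * \<bar>Q s\<bar>" for s
    proof (cases "0 < s")
      case True
      have "\<bar>h s\<bar> \<le> \<bar>B\<bar>" using that(2)[OF True] by linarith
      then show ?thesis by (metis abs_mult abs_ge_zero mult.commute mult_right_mono)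
    qed (simp add: Q_def)
    then show "AE s in lborel. norm (Q s * h s) \<le> norm (\<bar>B\<bar> * \<bar>Q s\<bar>)" by (simp add: abs_mult)
  qed (use that in auto)
  have e1: "\<bar>exp (- (real j * s)) * (1 - exp (- s)) ^ n\<bar> \<le> 1" if "0 < s" for j n s
    using that by (auto simp: abs_mult power_abs intro!: mult_le_one power_le_one)
  have D: "(fdiff ^^ n) (\<lambda>x. LBINT s. indicator {0<..} s * (exp (- x * s) * q s)) (1 + real j) =
     (LBINT s. Q s * (exp (- (real j * s)) * (1 - exp (- s)) ^ n))" for n j
  proof (induction n arbitrary: j)
    case 0
    show ?case by (auto simp: Q_def algebra_simps simp flip: exp_add intro!: Bochner_Integration.integral_cong)
  next
    case (Suc n)
    have "(fdiff ^^ Suc n) (\<lambda>x. LBINT s. indicator {0<..} s * (exp (- x * s) * q s)) (1 + real j) =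
      (LBINT s. Q s * (exp (- (real j * s)) * (1 - exp (- s)) ^ n)) -
      (LBINT s. Q s * (exp (- (real (Suc j) * s)) * (1 - exp (- s)) ^ n))"
      using Suc[of "Suc j"] unfolding funpow.simps comp_def Suc[of j, symmetric] fdiff_def[of "(fdiff ^^ n) _"]
      by (simp add: add_ac)
    also have "\<dots> = (LBINT s. Q s * (exp (- (real j * s)) * (1 - exp (- s)) ^ n) -
      Q s * (exp (- (real (Suc j) * s)) * (1 - exp (- s)) ^ n))"
      by (intro Bochner_Integration.integral_diff[symmetric] bint[where B = 1] e1) auto
    also have "\<dots> = (LBINT s. Q s * (exp (- (real j * s)) * (1 - exp (- s)) ^ Suc n))"
    proof (rule Bochner_Integration.integral_cong[OF refl])
      fix s
      have "exp (- (real (Suc j) * s)) = exp (- (real j * s)) * exp (- s)"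
        by (simp add: algebra_simps flip: exp_add)
      then show "Q s * (exp (- (real j * s)) * (1 - exp (- s)) ^ n) - Q s * (exp (- (real (Suc j) * s)) * (1 - exp (- s)) ^ n)
        = Q s * (exp (- (real j * s)) * (1 - exp (- s)) ^ Suc n)"
        by (simp only: power_Suc) (simp add: algebra_simps)
    qed
    finally show ?case .
  qed
  \<comment> \<open>Uniform approximation by Bernstein polynomials on [0, 1] carries the sign from
    the iterated differences to all bounded nonnegative continuous functions of exp(-s). The
    tolerance is e divided by the L1 norm of Q, plus 1 to keep the divisor positive.\<close>
  have key: "0 \<le> (LBINT s. Q s * g (exp (- s)))"
    if g: "continuous_on UNIV g" "\<And>x. 0 \<le> g x" "\<And>x. g x \<le> B" for g :: "real \<Rightarrow> real" and B
  proof (rule field_le_epsilon)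
    fix e :: real assume e: "0 < e"
    define I where "I = (LBINT s. \<bar>Q s\<bar>) + 1"
    have I: "0 < I" unfolding I_def by (rule add_nonneg_pos) auto
    obtain N where N: "\<And>n x. N \<le> n \<Longrightarrow> x \<in> {0..1} \<Longrightarrow> \<bar>g x - (\<Sum>k\<le>n. g(k/n) * Bernstein n k x)\<bar> < e / I"
      using Bernstein_Weierstrass[OF continuous_on_subset[OF g(1)], of "e / I"] e I by auto
    let ?B = "\<lambda>x. (\<Sum>k\<le>N. g(k/N) * Bernstein N k x)"
    have gm[measurable]: "g \<in> borel_measurable borel" using g(1) by (rule borel_measurable_continuous_onI)
    have i1: "integrable lborel (\<lambda>s. Q s * g (exp (- s)))"
      by (rule bint[where B = B]) (use g in \<open>auto\<close>)
    have i3: "integrable lborel (\<lambda>s. Q s * (exp (- (real k * s)) * (1 - exp (- s)) ^ (N - k)))" for k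
      by (rule bint[where B = 1]) (use e1 in auto)
    have BB: "Q s * ?B (exp (- s)) = (\<Sum>k\<le>N. g (k/N) * (N choose k) * (Q s * (exp (- (real k * s)) * (1 - exp (- s)) ^ (N - k))))" for s
      by (simp add: Bernstein_def sum_distrib_left algebra_simps flip: exp_of_nat_mult)
    have i2: "integrable lborel (\<lambda>s. Q s * ?B (exp (- s)))"
      unfolding BB by (intro Bochner_Integration.integrable_sum integrable_mult_right i3)
    have "0 \<le> (LBINT s. Q s * ?B (exp (- s)))"
      unfolding BB using g(2) cm[of "1 + real k" for k]
      by (subst Bochner_Integration.integral_sum) (auto intro!: sum_nonneg mult_nonneg_nonneg simp: i3 D[symmetric])
    also have "\<dots> - (LBINT s. Q s * g (exp (- s))) \<le> e"
    proof -
      have "(LBINT s. Q s * ?B (exp (- s))) - (LBINT s. Q s * g (exp (- s))) = (LBINT s. Q s * ?B (exp (- s)) - Q s * g (exp (- s)))"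
        using i1 i2 by simp
      also have "\<dots> \<le> (LBINT s. e / I * \<bar>Q s\<bar>)"
      proof (rule integral_mono)
        fix s
        show "Q s * ?B (exp (- s)) - Q s * g (exp (- s)) \<le> e / I * \<bar>Q s\<bar>"
        proof (cases "0 < s")
          case True
          have "Q s * ?B (exp (- s)) - Q s * g (exp (- s)) = - (Q s * (g (exp (- s)) - ?B (exp (- s))))" by (simp add: algebra_simps)
          also have "\<dots> \<le> \<bar>Q s\<bar> * \<bar>g (exp (- s)) - ?B (exp (- s))\<bar>" by (simp add: abs_ge_minus_self flip: abs_mult)
          also have "\<dots> \<le> \<bar>Q s\<bar> * (e / I)"
            using N[of N "exp (- s)"] True by (intro mult_left_mono) auto
          finally show ?thesis by (simp add: mult.commute)
        qed (simp add: Q_def)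
      qed (use i1 i2 Q in auto)
      also have "\<dots> = e / I * (I - 1)" by (simp add: I_def)
      also have "\<dots> \<le> e" using I e by (simp add: field_simps)
      finally show ?thesis .
    qed
    finally show "0 \<le> (LBINT s. Q s * g (exp (- s))) + e" by simp
  qed
  assume "\<not> 0 \<le> q s"
  then have neg: "q s < 0" by simp
  have "open ({0<..} \<inter> q -` {..<0})"
    by (intro continuous_open_preimage cont) auto
  then obtain r where r: "0 < r" "\<And>x. \<bar>x - s\<bar> < r \<Longrightarrow> 0 < x \<and> q x < 0"
    using neg s unfolding open_dist by (auto simp: dist_real_def)
  \<comment> \<open>In the variable exp(-x) the interval around s where q < 0 contains all points
    within \<rho> of exp(-s), so a tent of that width tests q only where it is negative.\<close>
  define \<rho> where "\<rho> = min (exp (- s) - exp (- (s + r))) (exp (- (s - r)) - exp (- s))"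
  have \<rho>: "0 < \<rho>" using r(1) by (simp add: \<rho>_def)
  define g where "g x = max 0 (\<rho> - \<bar>x - exp (- s)\<bar>)" for x
  define W where "W x = Q x * g (exp (- x))" for x
  have gz: "0 < x \<and> q x < 0" if "0 < g (exp (- x))" for x
  proof (rule r(2))
    have "\<bar>exp (- x) - exp (- s)\<bar> < \<rho>" using that by (simp add: g_def split: if_splits)
    then have "exp (- (s + r)) < exp (- x)" "exp (- x) < exp (- (s - r))" unfolding \<rho>_def by linarith+
    then show "\<bar>x - s\<bar> < r" by simp
  qed
  have g0: "0 \<le> g x" "g x \<le> \<rho>" for x using \<rho> by (auto simp: g_def)
  have gc: "continuous_on UNIV g" unfolding g_def by (intro continuous_intros)
  then have [measurable]: "g \<in> borel_measurable borel" by (rule borel_measurable_continuous_onI)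
  have Wle: "W x \<le> 0" for x
  proof (cases "0 < g (exp (- x))")
    case True with gz[OF this] show ?thesis
      by (auto simp: W_def Q_def mult_le_0_iff intro!: mult_nonpos_nonneg)
  qed (use g0(1)[of "exp (- x)"] in \<open>simp add: W_def\<close>)
  have Wi: "integrable lborel W" unfolding W_def
    by (rule bint[where B = \<rho>]) (use g0 in auto)
  have "0 \<le> (LBINT x. W x)" unfolding W_def using key[OF gc g0] .
  moreover have "(LBINT x. - W x) \<ge> 0" by (rule Bochner_Integration.integral_nonneg) (use Wle in auto)
  ultimately have "(LBINT x. - W x) = 0" by simp
  then have "AE x in lborel. - W x = 0"
    using integral_nonneg_eq_0_iff_AE[of lborel "\<lambda>x. - W x"] Wi Wle by auto
  then have "AE x in lborel. x \<notin> {x. 0 < g (exp (- x))}"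
  proof eventually_elim
    case (elim x)
    then show ?case using gz[of x] by (auto simp: W_def Q_def)
  qed
  moreover have o: "open {x. 0 < g (exp (- x))}"
    by (intro open_Collect_less continuous_intros continuous_on_compose2[OF gc]) auto
  ultimately have "{x. 0 < g (exp (- x))} \<in> null_sets lborel"
    using AE_iff_null_sets[of "{x. 0 < g (exp (- x))}" lborel] by auto
  then have "negligible {x. 0 < g (exp (- x))}"
    using negligible_iff_null_sets null_sets_completionI by blast
  moreover have "s \<in> {x. 0 < g (exp (- x))}" using \<rho> by (simp add: g_def)
  ultimately show False using o open_not_negligible by blast
qed

text \<open>All iterated differences of the zero transform vanish, so \<open>Laplace_nonneg\<close>
  applies to q2 - q1 and, with the roles exchanged, to q1 - q2.\<close>

lemma Laplace_unique:
  fixes q1 q2 :: "real \<Rightarrow> real"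
  assumes "continuous_on {0<..} q1" "continuous_on {0<..} q2"
    and L: "\<And>x. 1 \<le> x \<Longrightarrow> has_bochner_integral lborel (\<lambda>s. indicator {0<..} s * (exp (- x * s) * q1 s)) (L x)"
      "\<And>x. 1 \<le> x \<Longrightarrow> has_bochner_integral lborel (\<lambda>s. indicator {0<..} s * (exp (- x * s) * q2 s)) (L x)"
    and s: "0 < s"
  shows "q1 s = q2 s"
proof -
  have *: "q1 s \<le> q2 s" if "continuous_on {0<..} q1" "continuous_on {0<..} q2"
    "\<And>x. 1 \<le> x \<Longrightarrow> has_bochner_integral lborel (\<lambda>s. indicator {0<..} s * (exp (- x * s) * q1 s)) (L x)"
    "\<And>x. 1 \<le> x \<Longrightarrow> has_bochner_integral lborel (\<lambda>s. indicator {0<..} s * (exp (- x * s) * q2 s)) (L x)" for q1 q2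
  proof -
    have d: "has_bochner_integral lborel (\<lambda>s. indicator {0<..} s * (exp (- x * s) * (q2 s - q1 s))) 0" if "1 \<le> x" for x
      using has_bochner_integral_diff[OF \<open>\<And>x. _ \<Longrightarrow> has_bochner_integral lborel (\<lambda>s. indicator {0<..} s * (exp (- x * s) * q2 s)) (L x)\<close>[OF that]
         \<open>\<And>x. _ \<Longrightarrow> has_bochner_integral lborel (\<lambda>s. indicator {0<..} s * (exp (- x * s) * q1 s)) (L x)\<close>[OF that]]
      by (simp add: algebra_simps)
    have z: "(fdiff ^^ n) (\<lambda>x. LBINT s. indicator {0<..} s * (exp (- x * s) * (q2 s - q1 s))) x = 0" if "1 \<le> x" for x n
      using that
    proof (induction n arbitrary: x)
      case 0 then show ?case using has_bochner_integral_integral_eq[OF d] by (simp only: funpow_0)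
    next
      case (Suc n) then show ?case unfolding funpow.simps comp_def fdiff_def[of "(fdiff ^^ n) _"] by simp
    qed
    have "integrable lborel (\<lambda>s. indicator {0<..} s * (exp (- s) * (q2 s - q1 s)))"
      using d[of 1] by (simp add: has_bochner_integral_iff)
    then have "0 \<le> q2 s - q1 s"
      by (rule Laplace_nonneg[OF _ _ _ s, rotated]) (simp only: z order_refl, intro continuous_intros that)
    then show ?thesis by simp
  qed
  show ?thesis by (rule antisym) (rule *; fact assms)+
qed

subsection \<open>The one-sided stable density\<close>

lemma tendsto_integral_dominated:
  fixes f :: "real \<Rightarrow> 'b \<Rightarrow> real"
  assumes meas: "\<And>s. f s \<in> borel_measurable M" and g: "g \<in> borel_measurable M" and w: "integrable M w"
    and bound: "\<forall>\<^sub>F s in at s0. AE x in M. \<bar>f s x\<bar> \<le> w x"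
    and lim: "AE x in M. ((\<lambda>s. f s x) \<longlongrightarrow> g x) (at s0)"
  shows "((\<lambda>s. LINT x|M. f s x) \<longlongrightarrow> (LINT x|M. g x)) (at s0)"
  unfolding tendsto_at_iff_sequentially comp_def
proof (intro allI impI)
  fix X :: "nat \<Rightarrow> real" assume X: "\<forall>i. X i \<in> UNIV - {s0}" "X \<longlonglongrightarrow> s0"
  then have fl: "filterlim X (at s0) sequentially" by (auto simp: filterlim_at)
  then have "\<forall>\<^sub>F n in sequentially. AE x in M. \<bar>f (X n) x\<bar> \<le> w x"
    using bound by (rule eventually_compose_filterlim[rotated])
  then obtain N where N: "\<And>n. N \<le> n \<Longrightarrow> AE x in M. \<bar>f (X n) x\<bar> \<le> w x"
    by (auto simp: eventually_sequentially)
  have "(\<lambda>n. LINT x|M. f (X (n + N)) x) \<longlonglongrightarrow> (LINT x|M. g x)"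
  proof (rule integral_dominated_convergence[OF g meas w])
    show "AE x in M. (\<lambda>n. f (X (n + N)) x) \<longlonglongrightarrow> g x"
      using lim
    proof eventually_elim
      case (elim x)
      then have "(\<lambda>n. f (X n) x) \<longlonglongrightarrow> g x" using fl by (rule filterlim_compose)
      then show ?case by (rule LIMSEQ_ignore_initial_segment)
    qed
  qed (use N in auto)
  then show "(\<lambda>n. LINT x|M. f (X n) x) \<longlonglongrightarrow> (LINT x|M. g x)" by (rule LIMSEQ_offset)
qed

lemma has_real_derivative_integral:
  fixes F :: "real \<Rightarrow> 'b \<Rightarrow> real"
  assumes e: "0 < e" and F: "\<And>x. \<bar>x - x0\<bar> < e \<Longrightarrow> integrable M (F x)"
    and Fm: "\<And>x. F x \<in> borel_measurable M" and F'm: "F' x0 \<in> borel_measurable M"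
    and d: "\<And>x \<omega>. \<bar>x - x0\<bar> < e \<Longrightarrow> ((\<lambda>x. F x \<omega>) has_real_derivative F' x \<omega>) (at x)"
    and b: "\<And>x \<omega>. \<bar>x - x0\<bar> < e \<Longrightarrow> \<bar>F' x \<omega>\<bar> \<le> w \<omega>" and w: "integrable M w"
  shows "((\<lambda>x. LINT \<omega>|M. F x \<omega>) has_real_derivative (LINT \<omega>|M. F' x0 \<omega>)) (at x0)"
proof -
  have ev: "\<forall>\<^sub>F x in at x0. \<bar>x - x0\<bar> < e"
    using e eventually_at[of "\<lambda>x. \<bar>x - x0\<bar> < e" x0 UNIV] by (auto simp: dist_real_def)
  have "((\<lambda>x. LINT \<omega>|M. (F x \<omega> - F x0 \<omega>) / (x - x0)) \<longlongrightarrow> (LINT \<omega>|M. F' x0 \<omega>)) (at x0)"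
  proof (rule tendsto_integral_dominated[OF _ F'm w])
    show "\<forall>\<^sub>F x in at x0. AE \<omega> in M. \<bar>(F x \<omega> - F x0 \<omega>) / (x - x0)\<bar> \<le> w \<omega>"
      using ev eventually_neq_at_within[of x0 x0 UNIV]
    proof eventually_elim
      case (elim x)
      have "norm (F x \<omega> - F x0 \<omega>) \<le> w \<omega> * norm (x - x0)" for \<omega>
      proof (rule field_differentiable_bound[where S = "ball x0 e" and f' = "\<lambda>x. F' x \<omega>"])
        fix z assume "z \<in> ball x0 e"
        then have z: "\<bar>z - x0\<bar> < e" by (simp add: dist_real_def abs_minus_commute)
        show "((\<lambda>x. F x \<omega>) has_field_derivative F' z \<omega>) (at z within ball x0 e)"
          using d[OF z] by (rule has_field_derivative_at_within)
        show "norm (F' z \<omega>) \<le> w \<omega>" using b[OF z] by simp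
      qed (use elim e in \<open>auto simp: dist_real_def abs_minus_commute\<close>)
      then show ?case using elim by (auto simp: abs_divide field_simps)
    qed
    show "AE \<omega> in M. ((\<lambda>x. (F x \<omega> - F x0 \<omega>) / (x - x0)) \<longlongrightarrow> F' x0 \<omega>) (at x0)"
      using d[of x0] e by (simp add: has_field_derivative_iff)
  qed (use Fm in auto)
  then show ?thesis unfolding has_field_derivative_iff
  proof (rule Lim_transform_eventually)
    show "\<forall>\<^sub>F x in at x0. (LINT \<omega>|M. (F x \<omega> - F x0 \<omega>) / (x - x0)) = ((LINT \<omega>|M. F x \<omega>) - (LINT \<omega>|M. F x0 \<omega>)) / (x - x0)"
      using ev by eventually_elim (use F e in \<open>simp\<close>)
  qed
qed

lemma integrable_exp_minus:
  fixes a :: real assumes a: "0 < a"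
  shows "integrable lborel (\<lambda>s. indicator {0<..} s * exp (- a * s))"
proof -
  have "integrable lborel (\<lambda>s. Re (indicator {0<..} s *\<^sub>R exp (- (complex_of_real a * complex_of_real s))))"
    using has_bochner_integral_exp_complex[of "complex_of_real a"] a
    by (intro integrable_Re) (auto simp: has_bochner_integral_iff)
  then show ?thesis by (simp add: Re_exp)
qed

text \<open>Continuation of exp(-l^\<alpha>) to the closed right half plane by the principal branch;
  up to reflection its restriction to the imaginary axis is the characteristic function of the
  stable law.\<close>

definition stable_cf :: "real \<Rightarrow> complex \<Rightarrow> complex" where
  "stable_cf \<alpha> z = exp (- (z powr complex_of_real \<alpha>))"

text \<open>The inversion integral of the Laplace transform \<open>exp (- (l powr \<alpha>))\<close> along the imaginary axis.\<close>

definition stable_pdf :: "real \<Rightarrow> real \<Rightarrow> real" where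
  "stable_pdf \<alpha> s = (if s \<le> 0 then 0 else
     (LBINT y. Re (exp (\<i> * of_real (s * y)) * stable_cf \<alpha> (\<i> * of_real y))) / (2 * pi))"

text \<open>On the right half plane the argument \<theta> of z is at most pi/2 in modulus, and the
  real part of z^\<alpha> is |z|^\<alpha> cos(\<alpha> \<theta>). As \<alpha> < 1 the lower bound is
  a positive multiple of |z|^\<alpha>, which gives the decay of \<open>stable_cf\<close>.\<close>

lemma Re_powr_ge:
  assumes \<alpha>: "0 < \<alpha>" "\<alpha> < 1" and z: "0 \<le> Re z"
  shows "cos (\<alpha> * pi / 2) * norm z powr \<alpha> \<le> Re (z powr complex_of_real \<alpha>)"
proof (cases "z = 0")
  case False
  have 1: "\<bar>Im (Ln z)\<bar> \<le> pi / 2" using Re_Ln_pos_le[OF False] z by simp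
  have "cos (\<alpha> * pi / 2) \<le> cos (\<alpha> * \<bar>Im (Ln z)\<bar>)"
    using \<alpha> 1 mult_left_mono[OF 1, of \<alpha>] mult_strict_right_mono[of \<alpha> 1 pi]
    by (intro cos_monotone_0_pi_le) (auto simp: mult.commute)
  also have "\<dots> = cos (\<alpha> * Im (Ln z))" by (simp add: abs_if)
  finally have "cos (\<alpha> * pi / 2) * norm z powr \<alpha> \<le> cos (\<alpha> * Im (Ln z)) * norm z powr \<alpha>"
    by (intro mult_right_mono) auto
  then show ?thesis using False by (simp add: powr_def Re_exp mult.commute)
qed simp

context
  fixes \<alpha> :: real
  assumes \<alpha>: "0 < \<alpha>" "\<alpha> < 1"
begin

lemma cos_half_angle_pos: "0 < cos (\<alpha> * pi / 2)"
  using \<alpha> by (intro cos_gt_zero_pi) (auto intro: less_le_trans[of _ 0])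

lemma norm_stable_cf_le:
  assumes "0 \<le> Re z"
  shows "norm (stable_cf \<alpha> z) \<le> exp (- cos (\<alpha> * pi / 2) * norm z powr \<alpha>)"
  using Re_powr_ge[OF \<alpha> assms] by (simp add: stable_cf_def)

lemma continuous_on_stable_cf: "continuous_on {z. 0 \<le> Re z} (stable_cf \<alpha>)"
  unfolding stable_cf_def using \<alpha> by (intro continuous_intros) auto

lemma holomorphic_on_stable_cf: "stable_cf \<alpha> holomorphic_on {z. 0 < Re z}"
  unfolding stable_cf_def by (intro holomorphic_intros) (auto simp: complex_nonpos_Reals_iff)

lemma continuous_on_stable_cf_imag: "continuous_on UNIV (\<lambda>y. stable_cf \<alpha> (\<i> * complex_of_real y))"
  by (intro continuous_on_compose2[OF continuous_on_stable_cf] continuous_intros) auto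

lemma borel_measurable_stable_cf_imag[measurable]:
  "(\<lambda>y. stable_cf \<alpha> (\<i> * complex_of_real y)) \<in> borel_measurable borel"
  using continuous_on_stable_cf_imag by (rule borel_measurable_continuous_onI)

lemma integrable_stable_cf_imag: "integrable lborel (\<lambda>y. stable_cf \<alpha> (\<i> * complex_of_real y))"
proof (rule Bochner_Integration.integrable_bound[OF integrable_exp_minus_powr[OF \<alpha>(1) cos_half_angle_pos]])
  show "AE y in lborel. norm (stable_cf \<alpha> (\<i> * complex_of_real y)) \<le> norm (exp (- cos (\<alpha> * pi / 2) * \<bar>y\<bar> powr \<alpha>))"
    using norm_stable_cf_le[of "\<i> * complex_of_real y" for y] by (simp add: norm_mult)
qed simp

lemma stable_pdf_bounded: "\<exists>B>0. \<forall>s. \<bar>stable_pdf \<alpha> s\<bar> \<le> B"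
proof -
  let ?B = "(LBINT y. norm (stable_cf \<alpha> (\<i> * complex_of_real y))) / (2 * pi)"
  have "\<bar>stable_pdf \<alpha> s\<bar> \<le> \<bar>?B\<bar> + 1" for s
  proof -
    have "norm (LBINT y. Re (exp (\<i> * of_real (s * y)) * stable_cf \<alpha> (\<i> * of_real y))) \<le> (LBINT y. norm (stable_cf \<alpha> (\<i> * complex_of_real y)))"
        proof (rule Bochner_Integration.integral_norm_bound_integral)
      show "integrable lborel (\<lambda>y. Re (exp (\<i> * of_real (s * y)) * stable_cf \<alpha> (\<i> * of_real y)))"
        by (intro integrable_Re Bochner_Integration.integrable_bound[OF integrable_stable_cf_imag]) (auto simp: norm_mult)
      show "integrable lborel (\<lambda>y. norm (stable_cf \<alpha> (\<i> * complex_of_real y)))"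
        using integrable_stable_cf_imag by (rule integrable_norm)
      show "norm (Re (exp (\<i> * of_real (s * y)) * stable_cf \<alpha> (\<i> * of_real y))) \<le> norm (stable_cf \<alpha> (\<i> * complex_of_real y))" for y
        using abs_Re_le_cmod[of "exp (\<i> * of_real (s * y)) * stable_cf \<alpha> (\<i> * of_real y)"] by (simp add: norm_mult)
    qed
    then have "\<bar>LBINT y. Re (exp (\<i> * of_real (s * y)) * stable_cf \<alpha> (\<i> * of_real y))\<bar> / (2 * pi) \<le> ?B"
      unfolding real_norm_def by (intro divide_right_mono) auto
    then show ?thesis by (auto simp: stable_pdf_def abs_divide)
  qed
  moreover have "0 < \<bar>?B\<bar> + 1" by (rule add_nonneg_pos) auto
  ultimately show ?thesis by blast
qed

lemma continuous_on_stable_pdf: "continuous_on {0<..} (stable_pdf \<alpha>)"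
proof -
  have "((\<lambda>s. LBINT y. Re (exp (\<i> * of_real (s * y)) * stable_cf \<alpha> (\<i> * of_real y))) \<longlongrightarrow>
    (LBINT y. Re (exp (\<i> * of_real (s0 * y)) * stable_cf \<alpha> (\<i> * of_real y)))) (at s0)" for s0
  proof (rule tendsto_integral_dominated)
    show "integrable lborel (\<lambda>y. norm (stable_cf \<alpha> (\<i> * complex_of_real y)))"
      using integrable_stable_cf_imag by (rule integrable_norm)
    have "\<bar>Re (exp (\<i> * of_real (s * y)) * stable_cf \<alpha> (\<i> * of_real y))\<bar> \<le> norm (stable_cf \<alpha> (\<i> * complex_of_real y))" for y s
        using abs_Re_le_cmod[of "exp (\<i> * of_real (s * y)) * stable_cf \<alpha> (\<i> * of_real y)"] by (simp add: norm_mult)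
    then show "\<forall>\<^sub>F s in at s0. AE y in lborel. \<bar>Re (exp (\<i> * of_real (s * y)) * stable_cf \<alpha> (\<i> * of_real y))\<bar> \<le> norm (stable_cf \<alpha> (\<i> * complex_of_real y))"
      by simp
    show "AE y in lborel. ((\<lambda>s. Re (exp (\<i> * of_real (s * y)) * stable_cf \<alpha> (\<i> * of_real y))) \<longlongrightarrow> Re (exp (\<i> * of_real (s0 * y)) * stable_cf \<alpha> (\<i> * of_real y))) (at s0)"
      by (intro AE_I2 tendsto_intros)
  qed auto
  then have "continuous_on {0<..} (\<lambda>s. (LBINT y. Re (exp (\<i> * of_real (s * y)) * stable_cf \<alpha> (\<i> * of_real y))) / (2 * pi))"
    by (intro continuous_intros continuous_at_imp_continuous_on) (auto simp: isCont_def)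
  then show ?thesis by (rule continuous_on_eq) (auto simp: stable_pdf_def)
qed

lemma stable_pdf_nonpos: "s \<le> 0 \<Longrightarrow> stable_pdf \<alpha> s = 0"
  by (simp add: stable_pdf_def)

lemma borel_measurable_stable_pdf[measurable]: "stable_pdf \<alpha> \<in> borel_measurable borel"
proof -
  have "(\<lambda>s. if s \<in> {0<..} then stable_pdf \<alpha> s else 0) \<in> borel_measurable borel"
    using continuous_on_stable_pdf by (intro borel_measurable_continuous_on_if) auto
  also have "(\<lambda>s. if s \<in> {0<..} then stable_pdf \<alpha> s else 0) = stable_pdf \<alpha>"
    by (auto simp: stable_pdf_def)
  finally show ?thesis .
qed

text \<open>Insert the inversion integral and exchange the order of integration; exp(-l s) with l >
  0 makes the double integral absolutely convergent. The inner integral in s is 1 / (l - iy), and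
  Cauchy's formula on the half plane evaluates the outer one.\<close>

lemma Laplace_stable_pdf_pos:
  assumes l: "0 < l"
  shows "has_bochner_integral lborel (\<lambda>s. indicator {0<..} s * (exp (- l * s) * stable_pdf \<alpha> s)) (exp (- (l powr \<alpha>)))"
proof -
  define h where "h y = stable_cf \<alpha> (\<i> * complex_of_real y)" for y
  define F where "F s y = (indicator {0<..} s * exp (- l * s)) *\<^sub>R (exp (\<i> * complex_of_real (s * y)) * h y)" for s y :: real
  have hm[measurable]: "h \<in> borel_measurable borel" unfolding h_def by measurable
  have hi: "integrable lborel h" unfolding h_def by (rule integrable_stable_cf_imag)
  have nF: "norm (F s y) = indicator {0<..} s * exp (- l * s) * norm (h y)" for s y
    by (simp add: F_def norm_mult)
  have [measurable]: "(\<lambda>(s, y). F s y) \<in> borel_measurable (lborel \<Otimes>\<^sub>M lborel)" unfolding F_def by measurable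
  have FI: "integrable lborel (F s)" for s
    by (rule Bochner_Integration.integrable_bound[where f = "\<lambda>y. (indicator {0<..} s * exp (- l * s)) * norm (h y)"])
       (use hi in \<open>auto simp: nF\<close>)
  have int: "integrable (lborel \<Otimes>\<^sub>M lborel) (\<lambda>(s, y). F s y)"
  proof (rule lborel_pair.Fubini_integrable)
    show "integrable lborel (\<lambda>s. LBINT y. norm (case (s, y) of (s, y) \<Rightarrow> F s y))"
      unfolding split nF using integrable_exp_minus[OF l] by simp
  qed (use FI in auto)
  have fub: "(LBINT y. LBINT s. F s y) = (LBINT s. LBINT y. F s y)"
    by (rule lborel_pair.Fubini_integral[OF int])
  have inner: "(LBINT s. F s y) = h y / (complex_of_real l - \<i> * complex_of_real y)" for y
  proof -
    have "(\<lambda>s. F s y) = (\<lambda>s. (indicator {0<..} s *\<^sub>R exp (- ((complex_of_real l - \<i> * complex_of_real y) * complex_of_real s))) * h y)"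
      by (auto simp: F_def scaleR_conv_of_real algebra_simps indicator_def simp flip: exp_of_real exp_add)
    then have "(LBINT s. F s y) = (LBINT s. indicator {0<..} s *\<^sub>R exp (- ((complex_of_real l - \<i> * complex_of_real y) * complex_of_real s))) * h y"
      by (simp only: Bochner_Integration.integral_mult_left_zero)
    moreover have "(LBINT s. indicator {0<..} s *\<^sub>R exp (- ((complex_of_real l - \<i> * complex_of_real y) * complex_of_real s))) = 1 / (complex_of_real l - \<i> * complex_of_real y)"
      using l by (intro has_bochner_integral_integral_eq has_bochner_integral_exp_complex) simp
    ultimately show ?thesis by simp
  qed
  have "has_bochner_integral lborel (\<lambda>y. h y / (complex_of_real l - \<i> * complex_of_real y)) (2 * pi * stable_cf \<alpha> (complex_of_real l))"
    unfolding h_def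
    by (rule Cauchy_integral_formula_half_plane[OF continuous_on_stable_cf holomorphic_on_stable_cf norm_stable_cf_le \<alpha>(1) cos_half_angle_pos l])
  then have "(LBINT s. LBINT y. F s y) = 2 * pi * stable_cf \<alpha> (complex_of_real l)"
    unfolding fub[symmetric] inner by (rule has_bochner_integral_integral_eq)
  also have "stable_cf \<alpha> (complex_of_real l) = complex_of_real (exp (- (l powr \<alpha>)))"
    using l by (simp add: stable_cf_def powr_of_real exp_of_real[symmetric])
  finally have tot: "(LBINT s. LBINT y. F s y) = complex_of_real (2 * pi * exp (- (l powr \<alpha>)))" by simp
  have i2: "integrable lborel (\<lambda>s. LBINT y. F s y)"
    using lborel_pair.integrable_fst'[OF int] by simp
  have "has_bochner_integral lborel (\<lambda>s. LBINT y. F s y) (complex_of_real (2 * pi * exp (- (l powr \<alpha>))))"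
    using i2 tot by (simp add: has_bochner_integral_iff)
  then have "has_bochner_integral lborel (\<lambda>s. Re (LBINT y. F s y)) (2 * pi * exp (- (l powr \<alpha>)))"
    using has_bochner_integral_Re by fastforce
  then have "has_bochner_integral lborel (\<lambda>s. Re (LBINT y. F s y) / (2 * pi)) (2 * pi * exp (- (l powr \<alpha>)) / (2 * pi))"
    by (rule has_bochner_integral_divide_zero)
  moreover have "Re (LBINT y. F s y) / (2 * pi) = indicator {0<..} s * (exp (- l * s) * stable_pdf \<alpha> s)" for s
  proof -
    have "Re (LBINT y. F s y) = (LBINT y. Re (F s y))" using integral_Re[OF FI] by simp
    then show ?thesis by (simp add: F_def stable_pdf_def h_def indicator_def)
  qed
  ultimately show ?thesis by simp
qed

text \<open>The transform agrees with exp(-l^\<alpha>) on positive arguments, where the iterated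
  differences are nonnegative by complete monotonicity; \<open>Laplace_nonneg\<close> then gives the
  sign of the density.\<close>

lemma stable_pdf_nonneg: "0 \<le> stable_pdf \<alpha> s"
proof (cases "0 < s")
  case True
  have ext: "(fdiff ^^ n) f x = (fdiff ^^ n) g x" if "\<And>x. 0 < x \<Longrightarrow> f x = g x" "0 < x" for f g n x
    using that(2) by (induction n arbitrary: x) (auto simp: fdiff_def that(1))
  show ?thesis
  proof (rule Laplace_nonneg[OF continuous_on_stable_pdf _ _ True])
    show "integrable lborel (\<lambda>s. indicator {0<..} s * (exp (- s) * stable_pdf \<alpha> s))"
      using Laplace_stable_pdf_pos[of 1] by (simp add: has_bochner_integral_iff)
    fix n :: nat and x :: real assume x: "1 \<le> x"
    have "(fdiff ^^ n) (\<lambda>x. LBINT s. indicator {0<..} s * (exp (- x * s) * stable_pdf \<alpha> s)) x = (fdiff ^^ n) (\<lambda>l. exp (- (l powr \<alpha>))) x"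
      using x by (intro ext has_bochner_integral_integral_eq Laplace_stable_pdf_pos) auto
    also have "0 \<le> \<dots>" using x \<alpha> by (intro fdiff_exp_minus_powr_nonneg) auto
    finally show "0 \<le> (fdiff ^^ n) (\<lambda>x. LBINT s. indicator {0<..} s * (exp (- x * s) * stable_pdf \<alpha> s)) x" .
  qed
qed (simp add: stable_pdf_nonpos)

text \<open>Only l = 0, the statement that the mass is 1, is new. It follows by monotone convergence
  along l = 1/(n+1), which relies on the sign of the density.\<close>

lemma Laplace_stable_pdf:
  assumes l: "0 \<le> l"
  shows "has_bochner_integral lborel (\<lambda>s. indicator {0<..} s * (exp (- l * s) * stable_pdf \<alpha> s)) (exp (- (l powr \<alpha>)))"
proof (cases "l = 0")
  case True
  have "has_bochner_integral lborel (\<lambda>s. indicator {0<..} s * stable_pdf \<alpha> s) 1"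
  proof (rule has_bochner_integral_monotone_convergence[where f = "\<lambda>n s. indicator {0<..} s * (exp (- inverse (real (Suc n)) * s) * stable_pdf \<alpha> s)"])
    show "integrable lborel (\<lambda>s. indicator {0<..} s * (exp (- inverse (real (Suc n)) * s) * stable_pdf \<alpha> s))" for n
      using Laplace_stable_pdf_pos[of "inverse (real (Suc n))"] by (simp add: has_bochner_integral_iff)
    show "AE s in lborel. mono (\<lambda>n. indicator {0<..} s * (exp (- inverse (real (Suc n)) * s) * stable_pdf \<alpha> s))"
    proof (intro AE_I2 monoI)
      fix s :: real and m n :: nat assume mn: "m \<le> n"
      show "indicator {0<..} s * (exp (- inverse (real (Suc m)) * s) * stable_pdf \<alpha> s) \<le> indicator {0<..} s * (exp (- inverse (real (Suc n)) * s) * stable_pdf \<alpha> s)"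
      proof (cases "0 < s")
        case True
        have "inverse (real (Suc n)) * s \<le> inverse (real (Suc m)) * s"
          using mn True by (intro mult_right_mono le_imp_inverse_le) auto
        then show ?thesis by (intro mult_left_mono mult_right_mono stable_pdf_nonneg) auto
      qed simp
    qed
    show "AE s in lborel. (\<lambda>n. indicator {0<..} s * (exp (- inverse (real (Suc n)) * s) * stable_pdf \<alpha> s)) \<longlonglongrightarrow> indicator {0<..} s * stable_pdf \<alpha> s"
    proof (rule AE_I2)
      fix s :: real
      have "(\<lambda>n. indicator {0<..} s * (exp (- inverse (real (Suc n)) * s) * stable_pdf \<alpha> s)) \<longlonglongrightarrow> indicator {0<..} s * (exp (- 0 * s) * stable_pdf \<alpha> s)"
        by (intro tendsto_intros LIMSEQ_inverse_real_of_nat)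
      then show "(\<lambda>n. indicator {0<..} s * (exp (- inverse (real (Suc n)) * s) * stable_pdf \<alpha> s)) \<longlonglongrightarrow> indicator {0<..} s * stable_pdf \<alpha> s" by simp
    qed
    have "(LBINT s. indicator {0<..} s * (exp (- inverse (real (Suc n)) * s) * stable_pdf \<alpha> s)) = exp (- (inverse (real (Suc n)) powr \<alpha>))" for n
      by (rule has_bochner_integral_integral_eq[OF Laplace_stable_pdf_pos]) simp
    moreover have "(\<lambda>n. exp (- (inverse (real (Suc n)) powr \<alpha>))) \<longlonglongrightarrow> 1"
      using \<alpha> by real_asymp
    ultimately show "(\<lambda>n. LBINT s. indicator {0<..} s * (exp (- inverse (real (Suc n)) * s) * stable_pdf \<alpha> s)) \<longlonglongrightarrow> 1" by simp
  qed simp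
  then show ?thesis using True \<alpha> by simp
qed (use l Laplace_stable_pdf_pos in simp)

text \<open>Resolves the definite description: the Laplace transform fixes the continuous version on
  the positive axis, and the description itself prescribes 0 elsewhere.\<close>

lemma stable_density_eq: "stable_density \<alpha> 1 = stable_pdf \<alpha>"
  unfolding stable_density_def
proof (rule the_equality)
  fix p assume p: "continuous_on {0<..} p \<and> (\<forall>s>0. 0 \<le> p s) \<and> (\<forall>s\<le>0. p s = 0) \<and>
     (\<forall>l\<ge>0. has_bochner_integral lborel (\<lambda>s. indicator {0<..} s * (exp (- l * s) * p s)) (exp (- 1 * l powr \<alpha>)))"
  show "p = stable_pdf \<alpha>"
  proof
    fix s show "p s = stable_pdf \<alpha> s"
    proof (cases "0 < s")
      case True
      show ?thesis
      proof (rule Laplace_unique[where L = "\<lambda>l. exp (- (l powr \<alpha>))", OF _ continuous_on_stable_pdf _ _ True])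
        fix x :: real assume "1 \<le> x"
        then have x: "0 \<le> x" by simp
        show "has_bochner_integral lborel (\<lambda>s. indicator {0<..} s * (exp (- x * s) * p s)) (exp (- (x powr \<alpha>)))"
          using p x by simp
        show "has_bochner_integral lborel (\<lambda>s. indicator {0<..} s * (exp (- x * s) * stable_pdf \<alpha> s)) (exp (- (x powr \<alpha>)))"
          using x by (rule Laplace_stable_pdf)
      qed (use p in blast)
    qed (use p stable_pdf_nonpos in auto)
  qed
qed (use continuous_on_stable_pdf stable_pdf_nonneg stable_pdf_nonpos Laplace_stable_pdf in auto)

end

section \<open>The Riemann-Liouville kernel and the tail of the stable density\<close>

lemma rl_kernel_nonneg: "0 < \<rho> \<Longrightarrow> 0 \<le> rl_kernel \<rho> s"
  using Gamma_real_pos[of \<rho>] by (simp add: rl_kernel_def)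

lemma rl_kernel_measurable[measurable]: "rl_kernel \<rho> \<in> borel_measurable borel"
  unfolding rl_kernel_def[abs_def] by measurable

text \<open>Euler's integral for Gamma after the substitution t = l s; the two integrands can differ
  only at s = 0, a null set.\<close>

lemma nn_integral_Laplace_rl_kernel:
  assumes \<rho>: "0 < \<rho>" and l: "0 < l"
  shows "(\<integral>\<^sup>+s. ennreal (indicator {0<..} s * (exp (- l * s) * rl_kernel \<rho> s)) \<partial>lborel) = ennreal (l powr (- \<rho>))"
proof -
  have G: "0 < Gamma \<rho>" using \<rho> by (rule Gamma_real_pos)
  have "ennreal (Gamma \<rho>) = (\<integral>\<^sup>+t. ennreal (indicator {0..} t * t powr (\<rho> - 1) / exp t) \<partial>lborel)"
    using Gamma_conv_nn_integral_real[OF \<rho>] by simp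
  also have "\<dots> = ennreal \<bar>l\<bar> * (\<integral>\<^sup>+s. ennreal (indicator {0..} (0 + l * s) * (0 + l * s) powr (\<rho> - 1) / exp (0 + l * s)) \<partial>lborel)"
    using l by (intro nn_integral_real_affine) auto
  also have "\<dots> = (\<integral>\<^sup>+s. ennreal (l powr \<rho> * Gamma \<rho>) * ennreal (indicator {0<..} s * (exp (- l * s) * rl_kernel \<rho> s)) \<partial>lborel)"
  proof (subst nn_integral_cmult[symmetric], simp, rule nn_integral_cong_AE)
    have "AE s in lborel. s \<noteq> (0::real)" by (rule AE_lborel_singleton)
    then show "AE s in lborel. ennreal \<bar>l\<bar> * ennreal (indicator {0..} (0 + l * s) * (0 + l * s) powr (\<rho> - 1) / exp (0 + l * s)) =
       ennreal (l powr \<rho> * Gamma \<rho>) * ennreal (indicator {0<..} s * (exp (- l * s) * rl_kernel \<rho> s))"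
    proof eventually_elim
      case (elim s)
      show ?case
      proof (cases "0 < s")
        case True
        then have "l * ((l * s) powr (\<rho> - 1) / exp (l * s)) = l powr \<rho> * Gamma \<rho> * (exp (- l * s) * rl_kernel \<rho> s)"
          using l G by (simp add: rl_kernel_def powr_mult exp_minus divide_simps powr_diff)
        then show ?thesis using True l G by (simp add: ennreal_mult[symmetric] rl_kernel_def)
      next
        case False
        then have "\<not> 0 \<le> l * s" using elim l by (simp add: zero_le_mult_iff)
        then show ?thesis using False by simp
      qed
    qed
  qed
  also have "\<dots> = ennreal (l powr \<rho> * Gamma \<rho>) * (\<integral>\<^sup>+s. ennreal (indicator {0<..} s * (exp (- l * s) * rl_kernel \<rho> s)) \<partial>lborel)"
    unfolding rl_kernel_def by (rule nn_integral_cmult) simp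
  finally have *: "ennreal (Gamma \<rho>) = ennreal (l powr \<rho> * Gamma \<rho>) * (\<integral>\<^sup>+s. ennreal (indicator {0<..} s * (exp (- l * s) * rl_kernel \<rho> s)) \<partial>lborel)" .
  have "ennreal (l powr (- \<rho>)) = ennreal (l powr (- \<rho>) / Gamma \<rho>) * ennreal (Gamma \<rho>)"
    using G by (simp add: ennreal_mult[symmetric])
  also have "\<dots> = (\<integral>\<^sup>+s. ennreal (indicator {0<..} s * (exp (- l * s) * rl_kernel \<rho> s)) \<partial>lborel)"
    unfolding * mult.assoc[symmetric] using G l by (simp add: ennreal_mult[symmetric] flip: powr_add)
  finally show ?thesis ..
qed

context
  fixes \<alpha> :: real
  assumes \<alpha>: "0 < \<alpha>" "\<alpha> < 1"
begin

lemmas pdf_nonneg = stable_pdf_nonneg[OF \<alpha>]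
lemmas pdf_nonpos = stable_pdf_nonpos[OF \<alpha>]
lemmas pdf_measurable[measurable] = borel_measurable_stable_pdf[OF \<alpha>]

text \<open>Differentiation of the Laplace transform of p under the integral sign.\<close>

lemma Laplace_id_mult_stable_pdf:
  assumes l: "0 < l"
  shows "has_bochner_integral lborel (\<lambda>s. indicator {0<..} s * (exp (- l * s) * (s * stable_pdf \<alpha> s)))
    (\<alpha> * l powr (\<alpha> - 1) * exp (- (l powr \<alpha>)))"
proof -
  obtain B where B: "0 < B" "\<And>s. \<bar>stable_pdf \<alpha> s\<bar> \<le> B" using stable_pdf_bounded[OF \<alpha>] by auto
  define F where "F x s = indicator {0<..} s * (exp (- x * s) * stable_pdf \<alpha> s)" for x s :: real
  define F' where "F' x s = indicator {0<..} s * (- s * exp (- x * s) * stable_pdf \<alpha> s)" for x s :: real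
  \<comment> \<open>For |x - l| < l/2 one has x \<ge> l/2. Half of the decay exp(-l s / 2) absorbs
    the factor s through s \<le> (4/l) exp(l s / 4), the other half keeps the majorant
    integrable.\<close>
  define w where "w s = 4 / l * B * (indicator {0<..} s * exp (- (l / 4) * s))" for s :: real
  have w: "integrable lborel w" unfolding w_def using integrable_exp_minus[of "l / 4"] l by simp
  have b: "\<bar>F' x s\<bar> \<le> w s" if "\<bar>x - l\<bar> < l / 2" for x s
  proof (cases "0 < s")
    case True
    have "l / 2 \<le> x" using that by linarith
    then have "l / 2 * s \<le> x * s" using True by (intro mult_right_mono) auto
    then have 1: "exp (- x * s) \<le> exp (- (l / 4) * s) * exp (- (l / 4 * s))" by (simp flip: exp_add)
    have 2: "s \<le> 4 / l * exp (l / 4 * s)" using exp_ge_add_one_self[of "l / 4 * s"] l by (simp add: field_simps)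
    have "s * exp (- x * s) \<le> 4 / l * exp (l / 4 * s) * (exp (- (l / 4) * s) * exp (- (l / 4 * s)))"
      using 1 2 True l by (intro mult_mono) auto
    also have "\<dots> = 4 / l * exp (- (l / 4) * s)" by (simp add: exp_minus)
    finally have 3: "s * exp (- x * s) \<le> 4 / l * exp (- (l / 4) * s)" .
    have "s * exp (- x * s) * \<bar>stable_pdf \<alpha> s\<bar> \<le> 4 / l * exp (- (l / 4) * s) * B"
      by (rule mult_mono[OF 3 B(2)]) (use l in auto)
    then show ?thesis using True by (simp add: F'_def w_def abs_mult mult_ac)
  qed (simp add: F'_def w_def)
  have Fm[measurable]: "F x \<in> borel_measurable borel" "F' x \<in> borel_measurable borel" for x
    unfolding F_def F'_def by measurable
  have L: "has_bochner_integral lborel (F x) (exp (- (x powr \<alpha>)))" if "0 \<le> x" for x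
    unfolding F_def by (rule Laplace_stable_pdf[OF \<alpha> that])
  have "((\<lambda>x. LBINT s. F x s) has_real_derivative (LBINT s. F' l s)) (at l)"
  proof (rule has_real_derivative_integral[where e = "l / 2" and w = w])
    show "((\<lambda>x. F x s) has_real_derivative F' x s) (at x)" for x s
      unfolding F_def F'_def by (auto intro!: derivative_eq_intros)
    show "integrable lborel (F x)" if "\<bar>x - l\<bar> < l / 2" for x
    proof -
      have "0 \<le> x" using that by linarith
      then show ?thesis using L by (simp add: has_bochner_integral_iff)
    qed
  qed (use b w l in auto)
  moreover have "((\<lambda>x. LBINT s. F x s) has_real_derivative - (\<alpha> * l powr (\<alpha> - 1)) * exp (- (l powr \<alpha>))) (at l)"
  proof (rule has_field_derivative_transform_within_open[where S = "{0<..}"])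
    show "((\<lambda>x. exp (- (x powr \<alpha>))) has_real_derivative - (\<alpha> * l powr (\<alpha> - 1)) * exp (- (l powr \<alpha>))) (at l)"
      using l by (auto intro!: derivative_eq_intros)
    show "exp (- (x powr \<alpha>)) = (LBINT s. F x s)" if "x \<in> {0<..}" for x
      using has_bochner_integral_integral_eq[OF L[of x]] that by simp
  qed (use l in auto)
  ultimately have "(LBINT s. F' l s) = - (\<alpha> * l powr (\<alpha> - 1)) * exp (- (l powr \<alpha>))"
    by (rule DERIV_unique)
  moreover have "integrable lborel (F' l)"
    using w by (rule Bochner_Integration.integrable_bound) (use b[of l] l in \<open>auto intro: order_trans[OF _ abs_ge_self]\<close>)
  ultimately have "has_bochner_integral lborel (\<lambda>s. - F' l s) (\<alpha> * l powr (\<alpha> - 1) * exp (- (l powr \<alpha>)))"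
    by (simp add: has_bochner_integral_iff)
  then show ?thesis by (simp add: F'_def mult_ac)
qed

text \<open>The Riemann-Liouville integral of order 1 - \<alpha> of p. The upper limit s < r is
  implicit, because \<open>stable_pdf\<close> vanishes at nonpositive arguments.\<close>

definition rl_conv :: "real \<Rightarrow> real" where
  "rl_conv r = (LBINT s. indicator {0<..} s * rl_kernel (1 - \<alpha>) s * stable_pdf \<alpha> (r - s))"

lemma nn_integral_rl_kernel:
  assumes "0 \<le> r"
  shows "(\<integral>\<^sup>+s. ennreal (rl_kernel (1 - \<alpha>) s) * indicator {0..r} s \<partial>lborel) = ennreal (r powr (1 - \<alpha>) / (1 - \<alpha>) / Gamma (1 - \<alpha>))"
proof -
  have G: "0 < Gamma (1 - \<alpha>)" using \<alpha> by (intro Gamma_real_pos) simp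
  have "(\<integral>\<^sup>+s. ennreal (rl_kernel (1 - \<alpha>) s) * indicator {0..r} s \<partial>lborel) =
    (\<integral>\<^sup>+s. ennreal (1 / Gamma (1 - \<alpha>)) * (ennreal (s powr (- \<alpha>)) * indicator {0..r} s) \<partial>lborel)"
    using G by (intro nn_integral_cong) (simp add: rl_kernel_def mult.assoc[symmetric] ennreal_mult[symmetric])
  also have "\<dots> = ennreal (1 / Gamma (1 - \<alpha>)) * ennreal (r powr (1 - \<alpha>) / (1 - \<alpha>))"
    using nn_integral_powr_from_0[of "- \<alpha>" r] \<alpha> assms by (subst nn_integral_cmult) auto
  also have "\<dots> = ennreal (r powr (1 - \<alpha>) / (1 - \<alpha>) / Gamma (1 - \<alpha>))"
    using G \<alpha> by (simp add: ennreal_mult[symmetric])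
  finally show ?thesis .
qed

lemma integrable_rl_conv:
  "integrable lborel (\<lambda>s. indicator {0<..} s * rl_kernel (1 - \<alpha>) s * stable_pdf \<alpha> (r - s))"
  and rl_conv_tendsto: "(rl_conv \<longlongrightarrow> rl_conv r) (at r)"
proof -
  obtain B where B: "0 < B" "\<And>s. \<bar>stable_pdf \<alpha> s\<bar> \<le> B" using stable_pdf_bounded[OF \<alpha>] by auto
  define w where "w s = B * (indicator {0..\<bar>r\<bar> + 1} s * rl_kernel (1 - \<alpha>) s)" for s
  have "(\<integral>\<^sup>+s. ennreal (indicator {0..\<bar>r\<bar> + 1} s * rl_kernel (1 - \<alpha>) s) \<partial>lborel) =
      (\<integral>\<^sup>+s. ennreal (rl_kernel (1 - \<alpha>) s) * indicator {0..\<bar>r\<bar> + 1} s \<partial>lborel)"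
    by (intro nn_integral_cong) (simp add: indicator_def)
  also have "\<dots> < \<infinity>" using nn_integral_rl_kernel[of "\<bar>r\<bar> + 1"] by simp
  finally have "(\<integral>\<^sup>+s. ennreal (indicator {0..\<bar>r\<bar> + 1} s * rl_kernel (1 - \<alpha>) s) \<partial>lborel) < \<infinity>" .
  then have "integrable lborel (\<lambda>s. indicator {0..\<bar>r\<bar> + 1} s * rl_kernel (1 - \<alpha>) s)"
    using rl_kernel_nonneg[of "1 - \<alpha>"] \<alpha> by (intro integrableI_nonneg) auto
  then have w: "integrable lborel w" unfolding w_def by simp
  have b: "\<bar>indicator {0<..} s * rl_kernel (1 - \<alpha>) s * stable_pdf \<alpha> (r' - s)\<bar> \<le> w s" if "\<bar>r' - r\<bar> < 1" for r' s
  proof (cases "0 < s \<and> s < r'")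
    case True
    then have "s \<le> \<bar>r\<bar> + 1" using that by linarith
    then show ?thesis using True B(2)[of "r' - s"] rl_kernel_nonneg[of "1 - \<alpha>" s] \<alpha>
      by (simp add: w_def abs_mult mult.commute[of B] mult_left_mono)
  next
    case False
    then have z: "indicator {0<..} s * rl_kernel (1 - \<alpha>) s * stable_pdf \<alpha> (r' - s) = 0" by (auto simp: pdf_nonpos indicator_def)
    have "0 \<le> w s" unfolding w_def using B(1) rl_kernel_nonneg[of "1 - \<alpha>" s] \<alpha> by simp
    then show ?thesis unfolding z by simp
  qed
  show "integrable lborel (\<lambda>s. indicator {0<..} s * rl_kernel (1 - \<alpha>) s * stable_pdf \<alpha> (r - s))"
    using w by (rule Bochner_Integration.integrable_bound) (use b[of r] in \<open>auto intro: order_trans[OF _ abs_ge_self]\<close>)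
  show "(rl_conv \<longlongrightarrow> rl_conv r) (at r)"
    unfolding rl_conv_def[abs_def]
  proof (rule tendsto_integral_dominated[OF _ _ w])
    show "\<forall>\<^sub>F r' in at r. AE s in lborel. \<bar>indicator {0<..} s * rl_kernel (1 - \<alpha>) s * stable_pdf \<alpha> (r' - s)\<bar> \<le> w s"
      using b unfolding eventually_at by (intro exI[of _ 1]) (auto simp: dist_real_def)
    have cont: "isCont (stable_pdf \<alpha>) s" if "s \<noteq> 0" for s
    proof (cases "0 < s")
      case True then show ?thesis using continuous_on_stable_pdf[OF \<alpha>] by (simp add: continuous_on_eq_continuous_at)
    next
      case False
      have "continuous_on {..<0} (stable_pdf \<alpha>)" by (rule continuous_on_eq[of _ "\<lambda>_. 0"]) (auto simp: pdf_nonpos)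
      then show ?thesis using continuous_on_eq_continuous_at[of "{..<0}" "stable_pdf \<alpha>"] False that by auto
    qed
    \<comment> \<open>Continuity of p is available off 0 only, so the point s = r, where its
      argument is 0, is discarded.\<close>
    have "AE s in lborel. s \<noteq> r" by (rule AE_lborel_singleton)
    then show "AE s in lborel. ((\<lambda>r'. indicator {0<..} s * rl_kernel (1 - \<alpha>) s * stable_pdf \<alpha> (r' - s)) \<longlongrightarrow> indicator {0<..} s * rl_kernel (1 - \<alpha>) s * stable_pdf \<alpha> (r - s)) (at r)"
    proof eventually_elim
      case (elim s)
      have "isCont (\<lambda>r'. stable_pdf \<alpha> (r' - s)) r"
        using elim by (intro isCont_o2[OF _ cont]) auto
      then show ?case unfolding isCont_def by (intro tendsto_intros)
    qed
  qed auto
qed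

lemma rl_conv_nonneg: "0 \<le> rl_conv r"
  unfolding rl_conv_def using rl_kernel_nonneg[of "1 - \<alpha>"] \<alpha> pdf_nonneg
  by (intro Bochner_Integration.integral_nonneg mult_nonneg_nonneg) auto

lemma ennreal_rl_conv:
  "ennreal (rl_conv r) = (\<integral>\<^sup>+s. ennreal (indicator {0<..} s * rl_kernel (1 - \<alpha>) s * stable_pdf \<alpha> (r - s)) \<partial>lborel)"
  unfolding rl_conv_def using rl_kernel_nonneg[of "1 - \<alpha>"] \<alpha> pdf_nonneg
  by (intro nn_integral_eq_integral[symmetric] integrable_rl_conv AE_I2 mult_nonneg_nonneg) auto

lemma continuous_on_rl_conv: "continuous_on UNIV rl_conv"
  using rl_conv_tendsto by (simp add: continuous_on_def)

text \<open>The transform of a convolution is the product of the transforms l^(\<alpha>-1) and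
  exp(-l^\<alpha>); Tonelli's theorem applies because both factors are nonnegative.\<close>

lemma Laplace_rl_conv:
  assumes l: "0 < l"
  shows "has_bochner_integral lborel (\<lambda>r. indicator {0<..} r * (exp (- l * r) * rl_conv r)) (l powr (\<alpha> - 1) * exp (- (l powr \<alpha>)))"
proof (rule has_bochner_integral_nn_integral)
  have [measurable]: "rl_conv \<in> borel_measurable borel" using continuous_on_rl_conv by (rule borel_measurable_continuous_onI)
  show "(\<lambda>r. indicator {0<..} r * (exp (- l * r) * rl_conv r)) \<in> borel_measurable lborel" by measurable
  show "AE r in lborel. 0 \<le> indicator {0<..} r * (exp (- l * r) * rl_conv r)" using rl_conv_nonneg by auto
  have "(\<integral>\<^sup>+r. ennreal (indicator {0<..} r * (exp (- l * r) * rl_conv r)) \<partial>lborel) =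
    (\<integral>\<^sup>+r. \<integral>\<^sup>+s. ennreal (indicator {0<..} r * exp (- l * r)) * ennreal (indicator {0<..} s * rl_kernel (1 - \<alpha>) s * stable_pdf \<alpha> (r - s)) \<partial>lborel \<partial>lborel)"
  proof (rule nn_integral_cong)
    fix r :: real
    have "ennreal (indicator {0<..} r * (exp (- l * r) * rl_conv r)) = ennreal (indicator {0<..} r * exp (- l * r)) * ennreal (rl_conv r)"
      by (simp add: ennreal_mult[symmetric] rl_conv_nonneg mult.assoc)
    also have "\<dots> = (\<integral>\<^sup>+s. ennreal (indicator {0<..} r * exp (- l * r)) * ennreal (indicator {0<..} s * rl_kernel (1 - \<alpha>) s * stable_pdf \<alpha> (r - s)) \<partial>lborel)"
      unfolding ennreal_rl_conv by (rule nn_integral_cmult[symmetric]) measurable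
    finally show "ennreal (indicator {0<..} r * (exp (- l * r) * rl_conv r)) = (\<integral>\<^sup>+s. ennreal (indicator {0<..} r * exp (- l * r)) * ennreal (indicator {0<..} s * rl_kernel (1 - \<alpha>) s * stable_pdf \<alpha> (r - s)) \<partial>lborel)" .
  qed
  also have "\<dots> = (\<integral>\<^sup>+s. \<integral>\<^sup>+r. ennreal (indicator {0<..} r * exp (- l * r)) * ennreal (indicator {0<..} s * rl_kernel (1 - \<alpha>) s * stable_pdf \<alpha> (r - s)) \<partial>lborel \<partial>lborel)"
    by (rule lborel_pair.Fubini') measurable
  also have "\<dots> = (\<integral>\<^sup>+s. ennreal (indicator {0<..} s * (exp (- l * s) * rl_kernel (1 - \<alpha>) s)) * ennreal (exp (- (l powr \<alpha>))) \<partial>lborel)"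
  proof (rule nn_integral_cong)
    fix s :: real
    have "(\<integral>\<^sup>+r. ennreal (indicator {0<..} r * exp (- l * r)) * ennreal (indicator {0<..} s * rl_kernel (1 - \<alpha>) s * stable_pdf \<alpha> (r - s)) \<partial>lborel)
      = (\<integral>\<^sup>+r. ennreal (indicator {0<..} s * (exp (- l * s) * rl_kernel (1 - \<alpha>) s)) * ennreal (indicator {0<..} (r - s) * (exp (- l * (r - s)) * stable_pdf \<alpha> (r - s))) \<partial>lborel)"
    proof (rule nn_integral_cong)
      fix r :: real
      show "ennreal (indicator {0<..} r * exp (- l * r)) * ennreal (indicator {0<..} s * rl_kernel (1 - \<alpha>) s * stable_pdf \<alpha> (r - s)) =
        ennreal (indicator {0<..} s * (exp (- l * s) * rl_kernel (1 - \<alpha>) s)) * ennreal (indicator {0<..} (r - s) * (exp (- l * (r - s)) * stable_pdf \<alpha> (r - s)))"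
      proof (cases "0 < s \<and> s < r")
        case True
        have "exp (- l * r) = exp (- l * s) * exp (- l * (r - s))" by (simp add: algebra_simps flip: exp_add)
        then show ?thesis using True rl_kernel_nonneg[of "1 - \<alpha>" s] \<alpha> pdf_nonneg[of "r - s"]
          by (simp add: ennreal_mult[symmetric] mult_ac)
      next
        case False
        then show ?thesis by (auto simp: indicator_def pdf_nonpos)
      qed
    qed
    also have "\<dots> = ennreal (indicator {0<..} s * (exp (- l * s) * rl_kernel (1 - \<alpha>) s)) *
       (\<integral>\<^sup>+r. ennreal (indicator {0<..} (r - s) * (exp (- l * (r - s)) * stable_pdf \<alpha> (r - s))) \<partial>lborel)"
      by (rule nn_integral_cmult) measurable
    also have "(\<integral>\<^sup>+r. ennreal (indicator {0<..} (r - s) * (exp (- l * (r - s)) * stable_pdf \<alpha> (r - s))) \<partial>lborel) =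
       (\<integral>\<^sup>+r. ennreal (indicator {0<..} r * (exp (- l * r) * stable_pdf \<alpha> r)) \<partial>lborel)"
      using nn_integral_real_affine[of "\<lambda>r. ennreal (indicator {0<..} r * (exp (- l * r) * stable_pdf \<alpha> r))" 1 "- s"] by simp
    also have "\<dots> = ennreal (exp (- (l powr \<alpha>)))"
      using Laplace_stable_pdf[OF \<alpha>, of l] l pdf_nonneg
      by (subst nn_integral_eq_integral) (auto simp: has_bochner_integral_iff)
    finally show "(\<integral>\<^sup>+r. ennreal (indicator {0<..} r * exp (- l * r)) * ennreal (indicator {0<..} s * rl_kernel (1 - \<alpha>) s * stable_pdf \<alpha> (r - s)) \<partial>lborel)
      = ennreal (indicator {0<..} s * (exp (- l * s) * rl_kernel (1 - \<alpha>) s)) * ennreal (exp (- (l powr \<alpha>)))" .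
  qed
  also have "\<dots> = ennreal (l powr (- (1 - \<alpha>))) * ennreal (exp (- (l powr \<alpha>)))"
    using nn_integral_Laplace_rl_kernel[of "1 - \<alpha>" l] \<alpha> l by (subst nn_integral_multc) auto
  also have "\<dots> = ennreal (l powr (\<alpha> - 1) * exp (- (l powr \<alpha>)))" by (simp add: ennreal_mult)
  finally show "(\<integral>\<^sup>+r. ennreal (indicator {0<..} r * (exp (- l * r) * rl_conv r)) \<partial>lborel) = ennreal (l powr (\<alpha> - 1) * exp (- (l powr \<alpha>)))" .
qed simp

lemma rl_conv_eq:
  assumes r: "0 < r"
  shows "rl_conv r = r / \<alpha> * stable_pdf \<alpha> r"
proof (rule Laplace_unique[where L = "\<lambda>l. l powr (\<alpha> - 1) * exp (- (l powr \<alpha>))", OF _ _ _ _ r])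
  show "continuous_on {0<..} rl_conv" using continuous_on_rl_conv by (rule continuous_on_subset) simp
  show "continuous_on {0<..} (\<lambda>r. r / \<alpha> * stable_pdf \<alpha> r)"
    using \<alpha> by (intro continuous_intros continuous_on_stable_pdf[OF \<alpha>]) auto
  fix x :: real assume x: "1 \<le> x"
  show "has_bochner_integral lborel (\<lambda>s. indicator {0<..} s * (exp (- x * s) * rl_conv s)) (x powr (\<alpha> - 1) * exp (- (x powr \<alpha>)))"
    using x by (intro Laplace_rl_conv) simp
  have "has_bochner_integral lborel (\<lambda>s. 1 / \<alpha> * (indicator {0<..} s * (exp (- x * s) * (s * stable_pdf \<alpha> s)))) (1 / \<alpha> * (\<alpha> * x powr (\<alpha> - 1) * exp (- (x powr \<alpha>))))"
    using x by (intro has_bochner_integral_mult_right Laplace_id_mult_stable_pdf) auto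
  then show "has_bochner_integral lborel (\<lambda>s. indicator {0<..} s * (exp (- x * s) * (s / \<alpha> * stable_pdf \<alpha> s))) (x powr (\<alpha> - 1) * exp (- (x powr \<alpha>)))"
    using \<alpha> by (simp add: mult_ac)
qed

lemma nn_integral_rl_kernel_stable_pdf:
  assumes r: "0 < r"
  shows "(\<integral>\<^sup>+s. ennreal (rl_kernel (1 - \<alpha>) (r - s) * stable_pdf \<alpha> s) * indicator {0<..<r} s \<partial>lborel) = ennreal (r / \<alpha> * stable_pdf \<alpha> r)"
proof -
  have "ennreal (r / \<alpha> * stable_pdf \<alpha> r) = (\<integral>\<^sup>+s. ennreal (indicator {0<..} s * rl_kernel (1 - \<alpha>) s * stable_pdf \<alpha> (r - s)) \<partial>lborel)"
    unfolding rl_conv_eq[OF r, symmetric] by (rule ennreal_rl_conv)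
  also have "\<dots> = (\<integral>\<^sup>+s. ennreal (indicator {0<..} (r - s) * rl_kernel (1 - \<alpha>) (r - s) * stable_pdf \<alpha> s) \<partial>lborel)"
    using nn_integral_real_affine[of "\<lambda>s. ennreal (indicator {0<..} s * rl_kernel (1 - \<alpha>) s * stable_pdf \<alpha> (r - s))" "-1" r] by simp
  also have "\<dots> = (\<integral>\<^sup>+s. ennreal (rl_kernel (1 - \<alpha>) (r - s) * stable_pdf \<alpha> s) * indicator {0<..<r} s \<partial>lborel)"
    by (intro nn_integral_cong) (auto simp: indicator_def pdf_nonpos)
  finally show ?thesis ..
qed

text \<open>In \<open>r p(r) = \<alpha> (g\<^bsub>1-\<alpha>\<^esub> * p)(r)\<close> the part of the convolution over \<open>s \<le> r/2\<close> decays like \<open>r powr (- \<alpha>)\<close>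
  because \<open>p\<close> has mass \<open>1\<close>; a decay rate of \<open>p\<close> controls the other part and improves itself.\<close>

lemma stable_pdf_decay_step:
  assumes a: "0 \<le> a" "a \<le> 1" and C: "0 < C" "\<And>s. 0 < s \<Longrightarrow> stable_pdf \<alpha> s \<le> C * s powr (- a)"
  shows "\<exists>C>0. \<forall>s>0. stable_pdf \<alpha> s \<le> C * s powr (- (a + \<alpha>))"
proof -
  obtain B where B: "0 < B" "\<And>s. \<bar>stable_pdf \<alpha> s\<bar> \<le> B" using stable_pdf_bounded[OF \<alpha>] by auto
  have G: "0 < Gamma (1 - \<alpha>)" using \<alpha> by (intro Gamma_real_pos) simp
  \<comment> \<open>\<open>K1\<close> and \<open>K2\<close> are the coefficients of r^(-\<alpha>)
    and r^(1-\<alpha>-a) in the bounds over s \<le> r/2 and s > r/2. In the first range the kernel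
    is at most its value at r/2 and p has mass 1; in the second p is at most C (r/2)^(-a) and the
    kernel is integrated over [0, r/2].\<close>
  define K1 where "K1 = (1/2) powr (- \<alpha>) / Gamma (1 - \<alpha>)"
  define K2 where "K2 = C * (1/2) powr (- a) * ((1/2) powr (1 - \<alpha>) / (1 - \<alpha>) / Gamma (1 - \<alpha>))"
  have K: "0 < K1" "0 < K2" unfolding K1_def K2_def using G C \<alpha> by auto
  have large: "stable_pdf \<alpha> r \<le> \<alpha> * (K1 + K2) * r powr (- (a + \<alpha>))" if r: "1 \<le> r" for r
  proof -
    have "ennreal (r / \<alpha> * stable_pdf \<alpha> r) \<le> (\<integral>\<^sup>+s. ennreal ((r/2) powr (- \<alpha>) / Gamma (1 - \<alpha>)) * ennreal (indicator {0<..} s * stable_pdf \<alpha> s)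
       + ennreal (C * (r/2) powr (- a)) * (ennreal (rl_kernel (1 - \<alpha>) (r - s)) * indicator {0..r/2} (r - s)) \<partial>lborel)"
      unfolding nn_integral_rl_kernel_stable_pdf[OF less_le_trans[OF zero_less_one r], symmetric]
    proof (rule nn_integral_mono)
      fix s
      show "ennreal (rl_kernel (1 - \<alpha>) (r - s) * stable_pdf \<alpha> s) * indicator {0<..<r} s \<le>
        ennreal ((r/2) powr (- \<alpha>) / Gamma (1 - \<alpha>)) * ennreal (indicator {0<..} s * stable_pdf \<alpha> s)
       + ennreal (C * (r/2) powr (- a)) * (ennreal (rl_kernel (1 - \<alpha>) (r - s)) * indicator {0..r/2} (r - s))"
      proof (cases "0 < s \<and> s < r")
        case True
        show ?thesis
        proof (cases "s \<le> r / 2")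
          case s: True
          have "(r - s) powr (- \<alpha>) \<le> (r/2) powr (- \<alpha>)" using s r \<alpha> by (intro powr_mono2') auto
          then have "rl_kernel (1 - \<alpha>) (r - s) * stable_pdf \<alpha> s \<le> (r/2) powr (- \<alpha>) / Gamma (1 - \<alpha>) * stable_pdf \<alpha> s"
            using G by (intro mult_right_mono pdf_nonneg) (simp add: rl_kernel_def divide_right_mono)
          then show ?thesis using True G by (intro add_increasing2) (auto simp: ennreal_mult'[symmetric] intro!: ennreal_leI)
        next
          case s: False
          have "stable_pdf \<alpha> s \<le> C * s powr (- a)" using C True by simp
          also have "\<dots> \<le> C * (r/2) powr (- a)" using s r a C by (intro mult_left_mono powr_mono2') auto
          finally have "stable_pdf \<alpha> s * rl_kernel (1 - \<alpha>) (r - s) \<le> C * (r/2) powr (- a) * rl_kernel (1 - \<alpha>) (r - s)"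
            using rl_kernel_nonneg[of "1 - \<alpha>" "r - s"] \<alpha> by (intro mult_right_mono) auto
          then have "rl_kernel (1 - \<alpha>) (r - s) * stable_pdf \<alpha> s \<le> C * (r/2) powr (- a) * rl_kernel (1 - \<alpha>) (r - s)"
            by (subst mult.commute)
          then show ?thesis using True s C by (intro add_increasing) (auto simp: ennreal_mult'[symmetric] intro!: ennreal_leI)
        qed
      qed simp
    qed
    also have "\<dots> = ennreal ((r/2) powr (- \<alpha>) / Gamma (1 - \<alpha>)) * (\<integral>\<^sup>+s. ennreal (indicator {0<..} s * stable_pdf \<alpha> s) \<partial>lborel)
       + ennreal (C * (r/2) powr (- a)) * (\<integral>\<^sup>+s. ennreal (rl_kernel (1 - \<alpha>) (r - s)) * indicator {0..r/2} (r - s) \<partial>lborel)"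
      by (subst nn_integral_add) (auto simp: nn_integral_cmult)
    also have "(\<integral>\<^sup>+s. ennreal (rl_kernel (1 - \<alpha>) (r - s)) * indicator {0..r/2} (r - s) \<partial>lborel) = (\<integral>\<^sup>+s. ennreal (rl_kernel (1 - \<alpha>) s) * indicator {0..r/2} s \<partial>lborel)"
      using nn_integral_real_affine[of "\<lambda>s. ennreal (rl_kernel (1 - \<alpha>) s) * indicator {0..r/2} s" "-1" r] by simp
    also have "\<dots> = ennreal ((r/2) powr (1 - \<alpha>) / (1 - \<alpha>) / Gamma (1 - \<alpha>))" using r by (intro nn_integral_rl_kernel) simp
    also have "(\<integral>\<^sup>+s. ennreal (indicator {0<..} s * stable_pdf \<alpha> s) \<partial>lborel) = 1"
      using Laplace_stable_pdf[OF \<alpha>, of 0] \<alpha> pdf_nonneg by (subst nn_integral_eq_integral) (auto simp: has_bochner_integral_iff)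
    finally have "r / \<alpha> * stable_pdf \<alpha> r \<le> (r/2) powr (- \<alpha>) / Gamma (1 - \<alpha>) + C * (r/2) powr (- a) * ((r/2) powr (1 - \<alpha>) / (1 - \<alpha>) / Gamma (1 - \<alpha>))"
      using G C \<alpha> r by (simp add: ennreal_mult'[symmetric] ennreal_plus[symmetric] del: ennreal_plus)
    also have "\<dots> = K1 * r powr (- \<alpha>) + K2 * r powr (1 - \<alpha> - a)"
    proof -
      have h: "(r/2) powr x = r powr x * (1/2) powr x" for x using r powr_mult[of r "1/2" x] by simp
      have "r powr (1 - \<alpha> - a) = r powr (- a) * r powr (1 - \<alpha>)" by (simp add: powr_add[symmetric] algebra_simps)
      then show ?thesis unfolding K1_def K2_def h by (simp add: field_simps)
    qed
    \<comment> \<open>For a \<le> 1 and r \<ge> 1 the first term is dominated by the power of the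
      second; past a = 1 it would limit the rate.\<close>
    also have "\<dots> \<le> K1 * r powr (1 - \<alpha> - a) + K2 * r powr (1 - \<alpha> - a)"
      using K a r by (intro add_right_mono mult_left_mono powr_mono) auto
    also have "\<dots> = r * ((K1 + K2) * r powr (- (a + \<alpha>)))"
    proof -
      have "r powr (1 - \<alpha> - a) = r * r powr (- (a + \<alpha>))" using r by (simp add: powr_mult_base algebra_simps)
      then show ?thesis by (simp add: algebra_simps)
    qed
    finally have "r * (stable_pdf \<alpha> r / \<alpha>) \<le> r * ((K1 + K2) * r powr (- (a + \<alpha>)))" by simp
    then have "stable_pdf \<alpha> r / \<alpha> \<le> (K1 + K2) * r powr (- (a + \<alpha>))"
      by (rule mult_left_le_imp_le) (use r in simp)
    then show ?thesis using \<alpha> by (simp add: field_simps)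
  qed
  show ?thesis
  proof (intro exI[of _ "\<alpha> * (K1 + K2) + B"] conjI allI impI)
    fix s :: real assume s: "0 < s"
    show "stable_pdf \<alpha> s \<le> (\<alpha> * (K1 + K2) + B) * s powr (- (a + \<alpha>))"
    proof (cases "1 \<le> s")
      case True
      have "\<alpha> * (K1 + K2) * s powr (- (a + \<alpha>)) \<le> (\<alpha> * (K1 + K2) + B) * s powr (- (a + \<alpha>))"
        using B by (intro mult_right_mono) auto
      then show ?thesis using large[OF True] by linarith
    next
      case False
      have "1 \<le> s powr (- (a + \<alpha>))" using False s a \<alpha> powr_mono2'[of "- (a + \<alpha>)" s 1] by simp
      then have "B * 1 \<le> (\<alpha> * (K1 + K2) + B) * s powr (- (a + \<alpha>))"
        using B K \<alpha> by (intro mult_mono) auto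
      then show ?thesis using B(2)[of s] by simp
    qed
  qed (use K B \<alpha> in \<open>auto intro: add_pos_pos\<close>)
qed

text \<open>Boundedness is exponent 0, and each decay step gains \<alpha>. As a step may start from
  exponents up to 1 only, the iteration is capped at 1, reached after finitely many steps, and one
  last step from 1 gives 1 + \<alpha>.\<close>

lemma stable_pdf_decay:
  "\<exists>C>0. \<forall>s>0. stable_pdf \<alpha> s \<le> C \<and> stable_pdf \<alpha> s \<le> C * s powr (- (1 + \<alpha>))"
proof -
  obtain B where B: "0 < B" "\<And>s. \<bar>stable_pdf \<alpha> s\<bar> \<le> B" using stable_pdf_bounded[OF \<alpha>] by auto
  have less: "\<exists>C>0. \<forall>s>0. stable_pdf \<alpha> s \<le> C * s powr (- b)"
    if ex: "\<exists>C>0. \<forall>s>0. stable_pdf \<alpha> s \<le> C * s powr (- a)" and "0 \<le> b" "b \<le> a" for a b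
  proof -
    obtain C where C: "0 < C" "\<And>s. 0 < s \<Longrightarrow> stable_pdf \<alpha> s \<le> C * s powr (- a)" using ex by auto
    have "stable_pdf \<alpha> s \<le> (B + C) * s powr (- b)" if s: "0 < s" for s
    proof (cases "1 \<le> s")
      case True
      have "C * s powr (- a) \<le> (B + C) * s powr (- b)"
        using True B C \<open>b \<le> a\<close> by (intro mult_mono powr_mono) auto
      then show ?thesis using C(2)[OF s] by simp
    next
      case False
      have "1 \<le> s powr (- b)" using False s \<open>0 \<le> b\<close> powr_mono2'[of "- b" s 1] by simp
      then have "B * 1 \<le> (B + C) * s powr (- b)" using B C by (intro mult_mono) auto
      then show ?thesis using B(2)[of s] by simp
    qed
    then show ?thesis using add_pos_pos[OF B(1) C(1)] by blast
  qed
  have it: "\<exists>C>0. \<forall>s>0. stable_pdf \<alpha> s \<le> C * s powr (- min 1 (real n * \<alpha>))" for n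
  proof (induction n)
    case 0
    show ?case using B(1) by (intro exI[of _ B]) (use B(2) in \<open>auto intro: order_trans[OF abs_ge_self]\<close>)
  next
    case (Suc n)
    then have "\<exists>C>0. \<forall>s>0. stable_pdf \<alpha> s \<le> C * s powr (- (min 1 (real n * \<alpha>) + \<alpha>))"
      using stable_pdf_decay_step[of "min 1 (real n * \<alpha>)"] \<alpha> by (auto simp: min_def)
    then show ?case by (rule less) (use \<alpha> in \<open>auto simp: algebra_simps min_def\<close>)
  qed
  obtain n :: nat where "1 / \<alpha> < real n" using reals_Archimedean2 by blast
  then have "min 1 (real n * \<alpha>) = 1" using \<alpha> by (simp add: field_simps)
  with it[of n] have "\<exists>C>0. \<forall>s>0. stable_pdf \<alpha> s \<le> C * s powr (- 1)" by simp
  then have "\<exists>C>0. \<forall>s>0. stable_pdf \<alpha> s \<le> C * s powr (- (1 + \<alpha>))"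
    using stable_pdf_decay_step[of 1] by auto
  then obtain C where C: "0 < C" "\<And>s. 0 < s \<Longrightarrow> stable_pdf \<alpha> s \<le> C * s powr (- (1 + \<alpha>))" by auto
  have "stable_pdf \<alpha> s \<le> B + C \<and> stable_pdf \<alpha> s \<le> (B + C) * s powr (- (1 + \<alpha>))" if s: "0 < s" for s
  proof
    show "stable_pdf \<alpha> s \<le> B + C" using B(2)[of s] C(1) by linarith
    have "C * s powr (- (1 + \<alpha>)) \<le> (B + C) * s powr (- (1 + \<alpha>))" using B by (intro mult_right_mono) auto
    then show "stable_pdf \<alpha> s \<le> (B + C) * s powr (- (1 + \<alpha>))" using C(2)[OF s] by linarith
  qed
  then show ?thesis using add_pos_pos[OF B(1) C(1)] by blast
qed

end

subsection \<open>Uniqueness for Abel's equation\<close>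

text \<open>The semigroup property: the kernels of orders \<alpha> and 1 - \<alpha> convolve to the
  kernel of order 1, the constant 1. An affine substitution turns the integral into Beta(1-\<alpha>,
  \<alpha>), which cancels the Gamma factors because Gamma(1) = 1.\<close>

lemma nn_integral_rl_kernel_Beta:
  assumes \<alpha>: "0 < \<alpha>" "\<alpha> < 1" and sT: "s < T"
  shows "(\<integral>\<^sup>+t. ennreal (rl_kernel \<alpha> (T - t) * rl_kernel (1 - \<alpha>) (t - s)) * indicator {s..T} t \<partial>lborel) = 1"
proof -
  have G: "0 < Gamma \<alpha>" "0 < Gamma (1 - \<alpha>)" using \<alpha> by (auto intro: Gamma_real_pos)
  have B: "(\<integral>\<^sup>+u. ennreal (u powr (1 - \<alpha> - 1) * (1 - u) powr (\<alpha> - 1)) * indicator {0..1} u \<partial>lborel) = ennreal (Beta (1 - \<alpha>) \<alpha>)"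
    by (rule nn_integral_has_integral_lebesgue'[OF _ has_integral_Beta_real]) (use \<alpha> in auto)
  have Beta: "Beta (1 - \<alpha>) \<alpha> = Gamma (1 - \<alpha>) * Gamma \<alpha>" by (simp add: Beta_def)
  have "(\<integral>\<^sup>+t. ennreal (rl_kernel \<alpha> (T - t) * rl_kernel (1 - \<alpha>) (t - s)) * indicator {s..T} t \<partial>lborel) =
    ennreal \<bar>T - s\<bar> * (\<integral>\<^sup>+u. ennreal (rl_kernel \<alpha> (T - (s + (T - s) * u)) * rl_kernel (1 - \<alpha>) (s + (T - s) * u - s)) * indicator {s..T} (s + (T - s) * u) \<partial>lborel)"
    using sT by (intro nn_integral_real_affine) (auto simp: rl_kernel_def)
  also have "\<dots> = (\<integral>\<^sup>+u. ennreal (1 / (Gamma (1 - \<alpha>) * Gamma \<alpha>)) * (ennreal (u powr (1 - \<alpha> - 1) * (1 - u) powr (\<alpha> - 1)) * indicator {0..1} u) \<partial>lborel)"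
  proof (subst nn_integral_cmult[symmetric], simp add: rl_kernel_def, rule nn_integral_cong)
    fix u :: real
    show "ennreal \<bar>T - s\<bar> * (ennreal (rl_kernel \<alpha> (T - (s + (T - s) * u)) * rl_kernel (1 - \<alpha>) (s + (T - s) * u - s)) * indicator {s..T} (s + (T - s) * u)) =
      ennreal (1 / (Gamma (1 - \<alpha>) * Gamma \<alpha>)) * (ennreal (u powr (1 - \<alpha> - 1) * (1 - u) powr (\<alpha> - 1)) * indicator {0..1} u)"
    proof (cases "0 \<le> u \<and> u \<le> 1")
      case True
      have m: "s + (T - s) * u \<le> T" using True sT mult_left_mono[of u 1 "T - s"] by (simp add: algebra_simps)
      have m': "s \<le> s + (T - s) * u" using True sT by simp
      have e: "T - (s + (T - s) * u) = (T - s) * (1 - u)" by (simp add: algebra_simps)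
      have p: "(T - s) * ((T - s) powr (\<alpha> - 1) * (T - s) powr (- \<alpha>)) = 1"
        using sT by (simp add: powr_mult_base flip: powr_add)
      have "(T - s) * (rl_kernel \<alpha> (T - (s + (T - s) * u)) * rl_kernel (1 - \<alpha>) (s + (T - s) * u - s)) =
        (T - s) * ((T - s) powr (\<alpha> - 1) * (T - s) powr (- \<alpha>)) * (1 / (Gamma (1 - \<alpha>) * Gamma \<alpha>) * (u powr (1 - \<alpha> - 1) * (1 - u) powr (\<alpha> - 1)))"
        unfolding e rl_kernel_def using True sT by (simp add: powr_mult mult_ac)
      then have "(T - s) * (rl_kernel \<alpha> (T - (s + (T - s) * u)) * rl_kernel (1 - \<alpha>) (s + (T - s) * u - s)) =
         1 / (Gamma (1 - \<alpha>) * Gamma \<alpha>) * (u powr (1 - \<alpha> - 1) * (1 - u) powr (\<alpha> - 1))" unfolding p by simp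
      then show ?thesis using True m m' sT G by (simp add: ennreal_mult'[symmetric])
    next
      case False
      have n: "\<not> (s \<le> s + (T - s) * u \<and> s + (T - s) * u \<le> T)"
      proof
        assume h: "s \<le> s + (T - s) * u \<and> s + (T - s) * u \<le> T"
        then have "0 \<le> (T - s) * u" "(T - s) * u \<le> (T - s) * 1" by auto
        then show False using sT False by (simp add: zero_le_mult_iff)
      qed
      have "indicator {s..T} (s + (T - s) * u) = (0::ennreal)" using n by (simp only: indicator_eq_0_iff atLeastAtMost_iff not_False_eq_True)
      moreover have "indicator {0..1} u = (0::ennreal)" using False by (simp only: indicator_eq_0_iff atLeastAtMost_iff not_False_eq_True)
      ultimately show ?thesis by simp
    qed
  qed
  also have "\<dots> = ennreal (1 / (Gamma (1 - \<alpha>) * Gamma \<alpha>)) * ennreal (Beta (1 - \<alpha>) \<alpha>)"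
    unfolding B[symmetric] by (rule nn_integral_cmult) simp
  also have "\<dots> = 1" using G by (simp add: ennreal_mult'[symmetric] Beta)
  finally show ?thesis .
qed

text \<open>If y t were positive, y would exceed y t / 2 on a window around t, but the integral over
  the window is a difference of two vanishing integrals.\<close>

lemma zero_of_zero_integrals:
  fixes y :: "real \<Rightarrow> real"
  assumes cont: "continuous_on {0<..} y"
    and int: "\<And>T. 0 < T \<Longrightarrow> has_bochner_integral lborel (\<lambda>s. indicator {0<..<T} s * y s) 0"
    and t: "0 < t"
  shows "y t = 0"
proof -
  have le: "y t \<le> 0" if cont: "continuous_on {0<..} y"
    and int: "\<And>T. 0 < T \<Longrightarrow> has_bochner_integral lborel (\<lambda>s. indicator {0<..<T} s * y s) 0" for y :: "real \<Rightarrow> real"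
  proof (rule ccontr)
    assume "\<not> y t \<le> 0"
    then have pos: "0 < y t" by simp
    have o: "open ({0<..} \<inter> y -` {y t / 2<..})"
      by (intro continuous_open_preimage cont) auto
    have "t \<in> {0<..} \<inter> y -` {y t / 2<..}" using pos t by simp
    with o obtain r where r0: "0 < r" "ball t r \<subseteq> {0<..} \<inter> y -` {y t / 2<..}" by (rule openE)
    have r: "0 < x \<and> y t / 2 < y x" if "\<bar>x - t\<bar> < r" for x
      using r0(2) that by (auto simp: dist_real_def abs_minus_commute)
    define d where "d = r / 2"
    have d: "0 < d" "\<And>x. \<bar>x - t\<bar> \<le> d \<Longrightarrow> 0 < x \<and> y t / 2 < y x" using r r0(1) by (auto simp: d_def)
    have td: "0 < t - d" using d(2)[of "t - d"] d(1) by auto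
    have "has_bochner_integral lborel (\<lambda>s. indicator {0<..<t + d} s * y s - indicator {0<..<t - d} s * y s) (0 - 0)"
      using d td t by (intro has_bochner_integral_diff int) auto
    also have "(\<lambda>s. indicator {0<..<t + d} s * y s - indicator {0<..<t - d} s * y s) = (\<lambda>s. indicator {t - d..<t + d} s * y s)"
      using td d by (auto simp: indicator_def fun_eq_iff)
    finally have i: "has_bochner_integral lborel (\<lambda>s. indicator {t - d..<t + d} s * y s) 0" by simp
    have "(LBINT s. indicator {t - d..<t + d} s * (y t / 2)) \<le> (LBINT s. indicator {t - d..<t + d} s * y s)"
    proof (rule integral_mono)
      show "indicator {t - d..<t + d} s * (y t / 2) \<le> indicator {t - d..<t + d} s * y s" for s
      proof (cases "s \<in> {t - d..<t + d}")
        case True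
        then have "\<bar>s - t\<bar> \<le> d" by auto
        then show ?thesis using d(2)[of s] True by simp
      qed simp
    qed (use i d in \<open>auto simp: has_bochner_integral_iff\<close>)
    then have "2 * d * (y t / 2) \<le> 0" using i d by (simp add: has_bochner_integral_iff)
    then show False using d pos by (simp add: mult_le_0_iff)
  qed
  have "has_bochner_integral lborel (\<lambda>s. indicator {0<..<T} s * - y s) 0" if "0 < T" for T
    using has_bochner_integral_minus[OF int[OF that]] by simp
  then have "- y t \<le> 0" using cont by (intro le[of "\<lambda>s. - y s"] continuous_intros)
  then show ?thesis using le[OF cont int] by simp
qed

text \<open>Convolving the equation with the kernel of order \<alpha> replaces its kernel by the
  constant 1, so all integrals of y over (0, T) vanish.\<close>

lemma Abel_unique:
  fixes y :: "real \<Rightarrow> real"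
  assumes \<alpha>: "0 < \<alpha>" "\<alpha> < 1" and cont: "continuous_on {0<..} y"
    and eq: "\<And>\<tau>. 0 < \<tau> \<Longrightarrow> has_bochner_integral lborel (\<lambda>s. indicator {0<..<\<tau>} s * (rl_kernel (1 - \<alpha>) (\<tau> - s) * y s)) 0"
    and t: "0 < t"
  shows "y t = 0"
proof (rule zero_of_zero_integrals[OF cont _ t])
  fix T :: real assume T: "0 < T"
  have G: "0 < Gamma \<alpha>" "0 < Gamma (1 - \<alpha>)" using \<alpha> by (auto intro: Gamma_real_pos)
  have rl: "0 \<le> rl_kernel \<alpha> x" "0 \<le> rl_kernel (1 - \<alpha>) x" for x using G by (auto simp: rl_kernel_def)
  \<comment> \<open>Nothing is assumed about y outside the positive axis, so measurability is
    obtained for this truncation.\<close>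
  define y0 where "y0 s = (if s \<in> {0<..} then y s else 0)" for s
  have [measurable]: "y0 \<in> borel_measurable borel" unfolding y0_def[abs_def]
    using cont by (intro borel_measurable_continuous_on_if) auto
  have y0i: "indicator {0<..<T} s * y0 s = indicator {0<..<T} s * y s" for s by (simp add: y0_def indicator_def)
  \<comment> \<open>The equation at time T already contains the integrability of y: for 0 < s < T
    its kernel is at least T^(-\<alpha>) / Gamma(1-\<alpha>). This is what makes Fubini's theorem
    applicable below.\<close>
  have yint: "integrable lborel (\<lambda>s. indicator {0<..<T} s * y0 s)"
  proof (rule Bochner_Integration.integrable_bound)
    show "integrable lborel (\<lambda>s. T powr \<alpha> * Gamma (1 - \<alpha>) * (indicator {0<..<T} s * (rl_kernel (1 - \<alpha>) (T - s) * y s)))"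
      using eq[OF T] by (intro integrable_mult_right) (simp add: has_bochner_integral_iff)
    have "\<bar>y s\<bar> \<le> T powr \<alpha> * Gamma (1 - \<alpha>) * (rl_kernel (1 - \<alpha>) (T - s) * \<bar>y s\<bar>)" if "0 < s" "s < T" for s
    proof -
      have "(T - s) powr \<alpha> \<le> T powr \<alpha>" using that \<alpha> by (intro powr_mono2) auto
      then have "1 \<le> T powr \<alpha> * (T - s) powr (- \<alpha>)" using that by (simp add: powr_minus field_simps)
      then have "1 * \<bar>y s\<bar> \<le> T powr \<alpha> * (T - s) powr (- \<alpha>) * \<bar>y s\<bar>" by (intro mult_right_mono) auto
      then show ?thesis using G by (simp add: rl_kernel_def)
    qed
    then show "AE s in lborel. norm (indicator {0<..<T} s * y0 s) \<le> norm (T powr \<alpha> * Gamma (1 - \<alpha>) * (indicator {0<..<T} s * (rl_kernel (1 - \<alpha>) (T - s) * y s)))"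
      using G rl by (auto simp: y0_def abs_mult indicator_def)
  qed simp
  define H where "H s \<tau> = (if 0 < s \<and> s \<le> \<tau> \<and> \<tau> \<le> T then rl_kernel \<alpha> (T - \<tau>) * rl_kernel (1 - \<alpha>) (\<tau> - s) * y0 s else 0)" for s \<tau>
  have Hm[measurable]: "case_prod H \<in> borel_measurable (borel \<Otimes>\<^sub>M borel)" unfolding H_def by measurable
  have I0: "H s \<tau> = indicator {0<..} s * y0 s * (rl_kernel \<alpha> (T - \<tau>) * rl_kernel (1 - \<alpha>) (\<tau> - s) * indicator {s..T} \<tau>)" for s \<tau>
    by (auto simp: H_def indicator_def)
  have kint: "has_bochner_integral lborel (\<lambda>\<tau>. rl_kernel \<alpha> (T - \<tau>) * rl_kernel (1 - \<alpha>) (\<tau> - s) * indicator {s..T} \<tau>) 1" if "s < T" for s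
  proof (rule has_bochner_integral_nn_integral)
    show "(\<integral>\<^sup>+\<tau>. ennreal (rl_kernel \<alpha> (T - \<tau>) * rl_kernel (1 - \<alpha>) (\<tau> - s) * indicator {s..T} \<tau>) \<partial>lborel) = ennreal 1"
      using nn_integral_rl_kernel_Beta[OF \<alpha> that] rl by (simp add: ennreal_mult' ennreal_indicator)
  qed (use rl in auto)
  have sH: "has_bochner_integral lborel (H s) (indicator {0<..<T} s * y0 s)" if "s \<noteq> T" for s
  proof (cases "s < T")
    case True
    have "has_bochner_integral lborel (H s) (indicator {0<..} s * y0 s * 1)"
      unfolding I0[abs_def] using kint[OF True] by (intro has_bochner_integral_mult_right)
    then show ?thesis using True by (simp add: indicator_def)
  next
    case False
    then have "H s = (\<lambda>_. 0)" using that by (auto simp: H_def fun_eq_iff)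
    then show ?thesis using False by (simp add: has_bochner_integral_zero)
  qed
  have nH: "(LBINT \<tau>. norm (H s \<tau>)) = \<bar>indicator {0<..<T} s * y0 s\<bar>" if "s \<noteq> T" for s
  proof (cases "s < T")
    case True
    have "(\<lambda>\<tau>. norm (H s \<tau>)) = (\<lambda>\<tau>. \<bar>indicator {0<..} s * y0 s\<bar> * (rl_kernel \<alpha> (T - \<tau>) * rl_kernel (1 - \<alpha>) (\<tau> - s) * indicator {s..T} \<tau>))"
      using rl by (simp add: I0 abs_mult)
    then show ?thesis using kint[OF True] True by (simp add: has_bochner_integral_iff indicator_def)
  next
    case False
    then have "H s = (\<lambda>_. 0)" using that by (auto simp: H_def fun_eq_iff)
    then show ?thesis using False by simp
  qed
  have ne: "AE s in lborel. s \<noteq> T" by (rule AE_lborel_singleton)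
  have int: "integrable (lborel \<Otimes>\<^sub>M lborel) (case_prod H)"
  proof (rule lborel_pair.Fubini_integrable)
    have "integrable lborel (\<lambda>s. LBINT \<tau>. norm (H s \<tau>)) \<longleftrightarrow> integrable lborel (\<lambda>s. \<bar>indicator {0<..<T} s * y0 s\<bar>)"
      by (rule integrable_cong_AE) (use ne nH in \<open>auto\<close>)
    then show "integrable lborel (\<lambda>s. LBINT \<tau>. norm (case (s, \<tau>) of (x, y) \<Rightarrow> H x y))" using yint by (simp add: integrable_abs)
    show "AE s in lborel. integrable lborel (\<lambda>\<tau>. case (s, \<tau>) of (x, y) \<Rightarrow> H x y)"
      using ne by eventually_elim (use sH in \<open>auto simp: has_bochner_integral_iff\<close>)
  qed simp
  have "(LBINT \<tau>. LBINT s. H s \<tau>) = (LBINT s. LBINT \<tau>. H s \<tau>)"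
    by (rule lborel_pair.Fubini_integral[OF int])
  also have "(LBINT s. LBINT \<tau>. H s \<tau>) = (LBINT s. indicator {0<..<T} s * y0 s)"
    by (rule integral_cong_AE) (use ne sH in \<open>auto simp: has_bochner_integral_iff\<close>)
  also have "(LBINT \<tau>. LBINT s. H s \<tau>) = (LBINT \<tau>::real. 0)"
  proof (rule Bochner_Integration.integral_cong[OF refl])
    fix \<tau> :: real
    show "(LBINT s. H s \<tau>) = 0"
    proof (cases "0 < \<tau> \<and> \<tau> \<le> T")
      case True
      have "(LBINT s. H s \<tau>) = (LBINT s. rl_kernel \<alpha> (T - \<tau>) * (indicator {0<..<\<tau>} s * (rl_kernel (1 - \<alpha>) (\<tau> - s) * y0 s)))"
      proof (rule integral_cong_AE)
        have "AE s in lborel. s \<noteq> \<tau>" by (rule AE_lborel_singleton)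
        then show "AE s in lborel. H s \<tau> = rl_kernel \<alpha> (T - \<tau>) * (indicator {0<..<\<tau>} s * (rl_kernel (1 - \<alpha>) (\<tau> - s) * y0 s))"
          by eventually_elim (use True in \<open>auto simp: H_def indicator_def\<close>)
      qed auto
      also have "\<dots> = (LBINT s. rl_kernel \<alpha> (T - \<tau>) * (indicator {0<..<\<tau>} s * (rl_kernel (1 - \<alpha>) (\<tau> - s) * y s)))"
        by (intro Bochner_Integration.integral_cong) (auto simp: y0_def indicator_def)
      also have "\<dots> = 0" using has_bochner_integral_integral_eq[OF eq, of \<tau>] True by simp
      finally show ?thesis .
    next
      case False
      then have "(\<lambda>s. H s \<tau>) = (\<lambda>_. 0)" by (auto simp: H_def fun_eq_iff)
      then show ?thesis by simp
    qed
  qed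
  finally show "has_bochner_integral lborel (\<lambda>s. indicator {0<..<T} s * y s) 0"
    using yint unfolding y0i by (simp add: has_bochner_integral_iff)
qed

subsection \<open>Positive definite functions\<close>

lemma lborel_product_integral:
  fixes f :: "'a::euclidean_space \<Rightarrow> real \<Rightarrow> 'c::{real_normed_field, banach, second_countable_topology}"
  assumes int: "\<And>b. b \<in> Basis \<Longrightarrow> integrable lborel (f b)"
  shows "integrable lborel (\<lambda>x::'a. \<Prod>b\<in>Basis. f b (x \<bullet> b))"
    and "(LINT x|lborel. (\<Prod>b\<in>Basis. f b (x \<bullet> b))) = (\<Prod>b\<in>Basis. LINT y|lborel. f b y)"
proof -
  interpret product_sigma_finite "\<lambda>_::'a. lborel :: real measure" by standard
  have [measurable]: "f b \<in> borel_measurable borel" if "b \<in> Basis" for b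
    using borel_measurable_integrable[OF int[OF that]] by simp
  have T[measurable]: "(\<lambda>g. \<Sum>b\<in>Basis. g b *\<^sub>R b) \<in> measurable (Pi\<^sub>M Basis (\<lambda>_::'a. lborel)) borel" by measurable
  have m: "(\<lambda>x::'a. \<Prod>b\<in>Basis. f b (x \<bullet> b)) \<in> borel_measurable borel" by measurable
  have e: "(\<Prod>b\<in>Basis. f b ((\<Sum>b\<in>Basis. g b *\<^sub>R b) \<bullet> b)) = (\<Prod>b\<in>Basis. f b (g b))" for g :: "'a \<Rightarrow> real"
    by (intro prod.cong) (auto simp: inner_sum_left inner_Basis if_distrib cong: if_cong)
  show "integrable lborel (\<lambda>x::'a. \<Prod>b\<in>Basis. f b (x \<bullet> b))"
    by (subst lborel_eq, subst integrable_distr_eq[OF T m], unfold e, rule product_integrable_prod) (auto intro: int)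
  show "(LINT x|lborel. (\<Prod>b\<in>Basis. f b (x \<bullet> b))) = (\<Prod>b\<in>Basis. LINT y|lborel. f b y)"
    by (subst lborel_eq, subst integral_distr[OF T m], unfold e, rule product_integral_prod) (auto intro: int)
qed

text \<open>The l1 norm is used in the exponent because the function then factors over the
  coordinates and has an explicit, nonnegative Fourier transform.\<close>

definition exp_l1 :: "real \<Rightarrow> 'a::euclidean_space \<Rightarrow> real" where
  "exp_l1 \<delta> x = (\<Prod>b\<in>Basis. exp (- \<delta> * \<bar>x \<bullet> b\<bar>))"

text \<open>The Fourier transform of \<open>exp_l1 \<delta>\<close>: a product of one-dimensional
  Poisson kernels without the normalising factor 1/(2 pi).\<close>

definition poisson_kernel :: "real \<Rightarrow> 'a::euclidean_space \<Rightarrow> real" where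
  "poisson_kernel \<delta> x = (\<Prod>b\<in>Basis. 2 * \<delta> / (\<delta>\<^sup>2 + (x \<bullet> b)\<^sup>2))"

lemma exp_l1_bounds: "0 < exp_l1 \<delta> x" "0 \<le> \<delta> \<Longrightarrow> exp_l1 \<delta> x \<le> 1"
  unfolding exp_l1_def by (auto intro!: prod_pos prod_le_1)

lemma exp_l1_measurable[measurable]: "exp_l1 \<delta> \<in> borel_measurable borel"
  unfolding exp_l1_def[abs_def] by measurable

lemma poisson_kernel_measurable[measurable]: "poisson_kernel \<delta> \<in> borel_measurable borel"
  unfolding poisson_kernel_def[abs_def] by measurable

lemma poisson_kernel_nonneg: "0 < \<delta> \<Longrightarrow> 0 \<le> poisson_kernel \<delta> x"
  unfolding poisson_kernel_def by (intro prod_nonneg) auto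

lemma exp_l1_tendsto: "(\<lambda>n. exp_l1 (inverse (real (Suc n))) x) \<longlonglongrightarrow> 1"
proof -
  have "(\<lambda>n. exp_l1 (inverse (real (Suc n))) x) \<longlonglongrightarrow> (\<Prod>b\<in>Basis. exp (- 0 * \<bar>x \<bullet> b\<bar>))"
    unfolding exp_l1_def by (intro tendsto_intros LIMSEQ_inverse_real_of_nat)
  then show ?thesis by simp
qed

lemma fourier_exp_abs:
  fixes x \<delta> :: real assumes d: "0 < \<delta>"
  shows "has_bochner_integral lborel (\<lambda>y. exp (\<i> * of_real (x * y)) * of_real (exp (- \<delta> * \<bar>y\<bar>))) (complex_of_real (2 * \<delta> / (\<delta>\<^sup>2 + x\<^sup>2)))"
proof -
  define w where "w = complex_of_real \<delta> - \<i> * complex_of_real x"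
  define w' where "w' = complex_of_real \<delta> + \<i> * complex_of_real x"
  have w: "0 < Re w" "0 < Re w'" using d by (auto simp: w_def w'_def)
  have "has_bochner_integral lborel (\<lambda>s::real. indicator {0<..} (0 + - 1 * s) *\<^sub>R exp (- (w' * of_real (0 + - 1 * s)))) (1 / w' /\<^sub>R \<bar>-1\<bar>)"
    by (rule lborel_has_bochner_integral_real_affine_iff[THEN iffD1, rotated, OF has_bochner_integral_exp_complex[OF w(2)]]) simp
  then have "has_bochner_integral lborel (\<lambda>s::real. indicator {..<0} s *\<^sub>R exp (w' * of_real s)) (1 / w')"
    by (simp add: indicator_def)
  from has_bochner_integral_add[OF has_bochner_integral_exp_complex[OF w(1)] this]
  have *: "has_bochner_integral lborel (\<lambda>s::real. indicator {0<..} s *\<^sub>R exp (- (w * of_real s)) + indicator {..<0} s *\<^sub>R exp (w' * of_real s)) (1 / w + 1 / w')" .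
  have "w * w' = complex_of_real (\<delta>\<^sup>2 + x\<^sup>2)" by (simp add: w_def w'_def algebra_simps power2_eq_square)
  moreover have "w + w' = complex_of_real (2 * \<delta>)" by (simp add: w_def w'_def)
  moreover have "w \<noteq> 0" "w' \<noteq> 0" using w by auto
  ultimately have v: "1 / w + 1 / w' = complex_of_real (2 * \<delta> / (\<delta>\<^sup>2 + x\<^sup>2))"
    by (simp add: add_frac_eq add.commute mult.commute[of w' w])
  have ae: "AE y in lborel. exp (\<i> * of_real (x * y)) * of_real (exp (- \<delta> * \<bar>y\<bar>)) = indicator {0<..} y *\<^sub>R exp (- (w * of_real y)) + indicator {..<0} y *\<^sub>R exp (w' * of_real y)"
    using AE_lborel_singleton[of "0::real"]
  proof eventually_elim
    case (elim y)
    then show ?case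
      by (cases "0 < y") (auto simp: w_def w'_def algebra_simps simp flip: exp_of_real exp_add)
  qed
  show ?thesis
    using * unfolding v by (subst has_bochner_integral_cong_AE[OF _ _ ae]) auto
qed

lemma exp_i_inner_prod:
  fixes x \<xi> :: "'a::euclidean_space"
  shows "exp (\<i> * complex_of_real (x \<bullet> \<xi>)) * complex_of_real (exp_l1 \<delta> \<xi>) =
    (\<Prod>b\<in>Basis. exp (\<i> * of_real ((x \<bullet> b) * (\<xi> \<bullet> b))) * of_real (exp (- \<delta> * \<bar>\<xi> \<bullet> b\<bar>)))"
proof -
  have "exp (\<i> * complex_of_real (x \<bullet> \<xi>)) = (\<Prod>b\<in>Basis. exp (\<i> * of_real ((x \<bullet> b) * (\<xi> \<bullet> b))))"
    by (subst euclidean_inner) (simp add: sum_distrib_left exp_sum)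
  then show ?thesis by (simp add: exp_l1_def prod.distrib)
qed

lemma fourier_exp_l1:
  fixes x :: "'a::euclidean_space" assumes d: "0 < \<delta>"
  shows "has_bochner_integral lborel (\<lambda>\<xi>. cos (x \<bullet> \<xi>) * exp_l1 \<delta> \<xi>) (poisson_kernel \<delta> x)"
proof -
  let ?f = "\<lambda>b y. exp (\<i> * of_real ((x \<bullet> b) * y)) * complex_of_real (exp (- \<delta> * \<bar>y\<bar>))"
  have "has_bochner_integral lborel (\<lambda>\<xi>::'a. \<Prod>b\<in>Basis. ?f b (\<xi> \<bullet> b)) (\<Prod>b\<in>Basis. complex_of_real (2 * \<delta> / (\<delta>\<^sup>2 + (x \<bullet> b)\<^sup>2)))"
    using lborel_product_integral[where f = ?f and 'a = 'a] fourier_exp_abs[OF d, of "x \<bullet> b" for b]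
    by (simp add: has_bochner_integral_iff)
  then have "has_bochner_integral lborel (\<lambda>\<xi>. exp (\<i> * complex_of_real (x \<bullet> \<xi>)) * complex_of_real (exp_l1 \<delta> \<xi>)) (complex_of_real (poisson_kernel \<delta> x))"
    unfolding exp_i_inner_prod poisson_kernel_def by simp
  from has_bochner_integral_Re[OF this]
  show ?thesis by (simp add: Re_exp)
qed

lemma integrable_exp_l1: "0 < \<delta> \<Longrightarrow> integrable lborel (exp_l1 \<delta> :: 'a::euclidean_space \<Rightarrow> real)"
  using fourier_exp_l1[of \<delta> "0::'a"] by (simp add: has_bochner_integral_iff)

text \<open>Each coordinate contributes 2 pi through the arctangent. The mass does not depend on
  \<delta>, so bounds by it survive the limit \<delta> to 0.\<close>

lemma nn_integral_poisson_kernel: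
  assumes d: "0 < \<delta>"
  shows "(\<integral>\<^sup>+x. ennreal (poisson_kernel \<delta> (x::'a::euclidean_space)) \<partial>lborel) = ennreal ((2 * pi) ^ DIM('a))"
proof -
  let ?f = "\<lambda>y::real. 2 * \<delta> / (\<delta>\<^sup>2 + y\<^sup>2)"
  have half: "(\<integral>\<^sup>+y. ennreal (?f y) * indicator {0..} y \<partial>lborel) = ennreal pi"
  proof -
    have "(\<integral>\<^sup>+y. ennreal (?f y) * indicator {0..} y \<partial>lborel) = ennreal (pi - 2 * arctan (0 / \<delta>))"
    proof (rule nn_integral_FTC_atLeast)
      show "((\<lambda>y. 2 * arctan (y / \<delta>)) has_real_derivative ?f y) (at y)" for y
        using d by (auto intro!: derivative_eq_intros simp: field_simps power2_eq_square)
      have "((\<lambda>y. 2 * arctan (y / \<delta>)) \<longlongrightarrow> 2 * (pi / 2)) at_top"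
        by (intro tendsto_intros filterlim_compose[OF tendsto_arctan_at_top]) (use d in real_asymp)
      then show "((\<lambda>y. 2 * arctan (y / \<delta>)) \<longlongrightarrow> pi) at_top" by simp
    qed (use d in auto)
    then show ?thesis by simp
  qed
  have "(\<integral>\<^sup>+y. ennreal (?f y) * indicator {..0} y \<partial>lborel) = (\<integral>\<^sup>+y. ennreal (?f y) * indicator {0..} y \<partial>lborel)"
    using nn_integral_real_affine[of "\<lambda>y. ennreal (?f y) * indicator {..0} y" "-1" 0] by (simp add: indicator_def)
  then have other: "(\<integral>\<^sup>+y. ennreal (?f y) * indicator {..0} y \<partial>lborel) = ennreal pi" using half by simp
  have "(\<integral>\<^sup>+y. ennreal (?f y) \<partial>lborel) = (\<integral>\<^sup>+y. ennreal (?f y) * indicator {0..} y + ennreal (?f y) * indicator {..0} y \<partial>lborel)"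
  proof (rule nn_integral_cong_AE)
    show "AE y in lborel. ennreal (?f y) = ennreal (?f y) * indicator {0..} y + ennreal (?f y) * indicator {..0} y"
      using AE_lborel_singleton[of "0::real"] by eventually_elim (auto simp: indicator_def)
  qed
  also have "\<dots> = ennreal (2 * pi)"
    by (subst nn_integral_add) (auto simp: half other simp flip: ennreal_plus)
  finally have one: "(\<integral>\<^sup>+y. ennreal (?f y) \<partial>lborel) = ennreal (2 * pi)" .
  have "(\<integral>\<^sup>+x. ennreal (poisson_kernel \<delta> (x::'a)) \<partial>lborel) = (\<integral>\<^sup>+x. (\<Prod>b\<in>(Basis::'a set). ennreal (?f (x \<bullet> b))) \<partial>lborel)"
    using d unfolding poisson_kernel_def by (subst prod_ennreal) auto
  also have "\<dots> = (\<Prod>b\<in>(Basis::'a set). (\<integral>\<^sup>+y. ennreal (?f y) \<partial>lborel))"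
    by (rule nn_integral_lborel_prod) auto
  also have "\<dots> = ennreal ((2 * pi) ^ DIM('a))"
    unfolding one by (simp add: ennreal_power)
  finally show ?thesis .
qed

text \<open>Positive definiteness is expressed by the sign of the Fourier transform, which is regularised by
  the factor \<open>exp_l1 \<delta>\<close> because \<open>\<phi>\<close> need not be integrable.\<close>

definition pos_def :: "('a::euclidean_space \<Rightarrow> real) \<Rightarrow> bool" where
  "pos_def \<phi> \<longleftrightarrow> \<phi> \<in> borel_measurable borel \<and> (\<exists>B. \<forall>\<xi>. \<bar>\<phi> \<xi>\<bar> \<le> B) \<and>
     (\<forall>\<delta>>0. \<forall>x. 0 \<le> (LINT \<xi>|lborel. cos (x \<bullet> \<xi>) * \<phi> \<xi> * exp_l1 \<delta> \<xi>))"

lemma pos_def_integrable: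
  assumes "\<phi> \<in> borel_measurable borel" "\<And>\<xi>. \<bar>\<phi> \<xi>\<bar> \<le> B" "0 < \<delta>"
  shows "integrable lborel (\<lambda>\<xi>. \<phi> \<xi> * exp_l1 \<delta> (\<xi>::'a::euclidean_space))"
proof (rule Bochner_Integration.integrable_bound[of _ "\<lambda>\<xi>. \<bar>B\<bar> * exp_l1 \<delta> \<xi>"])
  show "integrable lborel (\<lambda>\<xi>::'a. \<bar>B\<bar> * exp_l1 \<delta> \<xi>)" using integrable_exp_l1 assms by auto
  have "\<bar>\<phi> \<xi>\<bar> \<le> \<bar>B\<bar>" for \<xi> using assms(2)[of \<xi>] by linarith
  then show "AE \<xi> in lborel. norm (\<phi> \<xi> * exp_l1 \<delta> \<xi>) \<le> norm (\<bar>B\<bar> * exp_l1 \<delta> \<xi>)"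
    by (auto simp: abs_mult intro!: mult_right_mono)
qed (use assms in auto)

lemma abs_cos_mult_le: "\<bar>a\<bar> \<le> B \<Longrightarrow> \<bar>cos t * a\<bar> \<le> (B::real)"
  using mult_mono[of "\<bar>cos t\<bar>" 1 "\<bar>a\<bar>" B] by (simp add: abs_mult)

lemma pos_def_integrable_cos:
  assumes "\<phi> \<in> borel_measurable borel" "\<And>\<xi>. \<bar>\<phi> \<xi>\<bar> \<le> B" "0 < \<delta>"
  shows "integrable lborel (\<lambda>\<xi>. cos (x \<bullet> \<xi>) * \<phi> \<xi> * exp_l1 \<delta> (\<xi>::'a::euclidean_space))"
  using assms by (intro pos_def_integrable[where B = B] abs_cos_mult_le) auto

lemma pos_def_1: "pos_def (\<lambda>_::'a::euclidean_space. 1)"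
  unfolding pos_def_def
  by (auto simp: has_bochner_integral_integral_eq[OF fourier_exp_l1] poisson_kernel_nonneg intro: exI[of _ 1])

lemma pos_def_cmult: "pos_def \<phi> \<Longrightarrow> 0 \<le> c \<Longrightarrow> pos_def (\<lambda>\<xi>. c * \<phi> \<xi>)"
  unfolding pos_def_def
proof (elim conjE exE, intro conjI allI impI)
  fix B assume "\<forall>\<xi>. \<bar>\<phi> \<xi>\<bar> \<le> B" "0 \<le> c"
  then show "\<exists>B. \<forall>\<xi>. \<bar>c * \<phi> \<xi>\<bar> \<le> B"
    by (intro exI[of _ "c * B"]) (auto simp: abs_mult intro!: mult_left_mono)
next
  fix \<delta> :: real and x :: 'a assume "0 \<le> c" "0 < \<delta>" "\<forall>\<delta>>0. \<forall>x. 0 \<le> (LINT \<xi>|lborel. cos (x \<bullet> \<xi>) * \<phi> \<xi> * exp_l1 \<delta> \<xi>)"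
  moreover have "(LINT \<xi>|lborel. cos (x \<bullet> \<xi>) * (c * \<phi> \<xi>) * exp_l1 \<delta> \<xi>) = c * (LINT \<xi>|lborel. cos (x \<bullet> \<xi>) * \<phi> \<xi> * exp_l1 \<delta> \<xi>)"
    by (subst integral_mult_right_zero[symmetric]) (simp add: mult_ac)
  ultimately show "0 \<le> (LINT \<xi>|lborel. cos (x \<bullet> \<xi>) * (c * \<phi> \<xi>) * exp_l1 \<delta> \<xi>)" by simp
qed auto

lemma pos_def_add:
  assumes "pos_def \<phi>" "pos_def \<psi>"
  shows "pos_def (\<lambda>\<xi>. \<phi> \<xi> + \<psi> \<xi>)"
proof -
  obtain B C where B: "\<And>\<xi>. \<bar>\<phi> \<xi>\<bar> \<le> B" "\<And>\<xi>. \<bar>\<psi> \<xi>\<bar> \<le> C" using assms unfolding pos_def_def by auto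
  have m: "\<phi> \<in> borel_measurable borel" "\<psi> \<in> borel_measurable borel" using assms unfolding pos_def_def by auto
  show ?thesis unfolding pos_def_def
  proof (intro conjI allI impI)
    show "\<exists>B. \<forall>\<xi>. \<bar>\<phi> \<xi> + \<psi> \<xi>\<bar> \<le> B"
      by (intro exI[of _ "B + C"] allI order_trans[OF abs_triangle_ineq] add_mono B)
    fix \<delta> :: real and x assume d: "0 < \<delta>"
    have "(LINT \<xi>|lborel. cos (x \<bullet> \<xi>) * (\<phi> \<xi> + \<psi> \<xi>) * exp_l1 \<delta> \<xi>) =
      (LINT \<xi>|lborel. cos (x \<bullet> \<xi>) * \<phi> \<xi> * exp_l1 \<delta> \<xi>) + (LINT \<xi>|lborel. cos (x \<bullet> \<xi>) * \<psi> \<xi> * exp_l1 \<delta> \<xi>)"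
      using pos_def_integrable_cos[OF m(1) B(1) d] pos_def_integrable_cos[OF m(2) B(2) d]
      by (subst Bochner_Integration.integral_add[symmetric]) (auto simp: algebra_simps)
    then show "0 \<le> (LINT \<xi>|lborel. cos (x \<bullet> \<xi>) * (\<phi> \<xi> + \<psi> \<xi>) * exp_l1 \<delta> \<xi>)"
      using assms d unfolding pos_def_def by auto
  qed (use m in auto)
qed

text \<open>The regularising factor pays off here: B times \<open>exp_l1 \<delta>\<close> dominates
  all the integrands, so a uniform bound and pointwise convergence suffice.\<close>

lemma pos_def_limit:
  assumes pd: "\<And>n. pos_def (\<phi> n)" and B: "\<And>n \<xi>. \<bar>\<phi> n \<xi>\<bar> \<le> B" and lim: "\<And>\<xi>. (\<lambda>n. \<phi> n \<xi>) \<longlonglongrightarrow> \<psi> \<xi>"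
  shows "pos_def \<psi>"
  unfolding pos_def_def
proof (intro conjI allI impI)
  have m: "\<phi> n \<in> borel_measurable borel" for n using pd unfolding pos_def_def by auto
  show mp: "\<psi> \<in> borel_measurable borel" by (rule borel_measurable_LIMSEQ_real[OF lim m])
  have "\<bar>\<psi> \<xi>\<bar> \<le> B" for \<xi>
    by (rule LIMSEQ_le_const2[OF tendsto_rabs[OF lim]]) (use B in auto)
  then show "\<exists>B. \<forall>\<xi>. \<bar>\<psi> \<xi>\<bar> \<le> B" by auto
  fix \<delta> :: real and x assume d: "0 < \<delta>"
  have "(\<lambda>n. LINT \<xi>|lborel. cos (x \<bullet> \<xi>) * \<phi> n \<xi> * exp_l1 \<delta> \<xi>) \<longlonglongrightarrow> (LINT \<xi>|lborel. cos (x \<bullet> \<xi>) * \<psi> \<xi> * exp_l1 \<delta> \<xi>)"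
  proof (rule integral_dominated_convergence[where w = "\<lambda>\<xi>. B * exp_l1 \<delta> \<xi>"])
    show "AE \<xi> in lborel. norm (cos (x \<bullet> \<xi>) * \<phi> n \<xi> * exp_l1 \<delta> \<xi>) \<le> B * exp_l1 \<delta> \<xi>" for n
    proof (rule AE_I2)
      fix \<xi>
      have "\<bar>cos (x \<bullet> \<xi>) * \<phi> n \<xi>\<bar> * exp_l1 \<delta> \<xi> \<le> B * exp_l1 \<delta> \<xi>"
        using exp_l1_bounds(1)[of \<delta> \<xi>] by (intro mult_right_mono abs_cos_mult_le B) auto
      then show "norm (cos (x \<bullet> \<xi>) * \<phi> n \<xi> * exp_l1 \<delta> \<xi>) \<le> B * exp_l1 \<delta> \<xi>"
        using exp_l1_bounds(1)[of \<delta> \<xi>] by (simp add: abs_mult)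
    qed
    show "AE \<xi> in lborel. (\<lambda>n. cos (x \<bullet> \<xi>) * \<phi> n \<xi> * exp_l1 \<delta> \<xi>) \<longlonglongrightarrow> cos (x \<bullet> \<xi>) * \<psi> \<xi> * exp_l1 \<delta> \<xi>"
      by (intro AE_I2 tendsto_intros lim)
  qed (use d m mp integrable_exp_l1 in auto)
  then show "0 \<le> (LINT \<xi>|lborel. cos (x \<bullet> \<xi>) * \<psi> \<xi> * exp_l1 \<delta> \<xi>)"
    by (rule LIMSEQ_le_const) (use pd d in \<open>auto simp: pos_def_def\<close>)
qed

section \<open>Exponentials of cosine transforms of finite measures\<close>

definition cos_transform :: "'b measure \<Rightarrow> ('b \<Rightarrow> 'a::euclidean_space) \<Rightarrow> 'a \<Rightarrow> real" where
  "cos_transform M Y \<xi> = (LINT \<omega>|M. cos (\<xi> \<bullet> Y \<omega>))"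

lemma cos_transform_measurable:
  assumes "finite_measure M" and [measurable]: "Y \<in> borel_measurable M"
  shows "cos_transform M Y \<in> borel_measurable borel"
proof -
  interpret finite_measure M by fact
  show ?thesis unfolding cos_transform_def[abs_def] by measurable
qed

lemma cos_transform_bound:
  assumes "finite_measure M" and [measurable]: "Y \<in> borel_measurable M"
  shows "\<bar>cos_transform M Y \<xi>\<bar> \<le> measure M (space M)"
proof -
  interpret finite_measure M by fact
  have "norm (LINT \<omega>|M. cos (\<xi> \<bullet> Y \<omega>)) \<le> (LINT \<omega>|M. 1)"
    by (intro order_trans[OF integral_norm_bound] integral_mono) (auto intro: integrable_const_bound[where B = 1])
  then show ?thesis by (simp add: cos_transform_def)
qed

text \<open>The product formula for cosines turns multiplication by \<open>cos (\<xi> \<bullet> y)\<close> into the average of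
  two translations of the Fourier transform.\<close>

lemma pos_def_mult_cos_transform:
  fixes Y :: "'b \<Rightarrow> 'a::euclidean_space"
  assumes pd: "pos_def \<phi>" and M: "finite_measure M" and Y[measurable]: "Y \<in> borel_measurable M"
  shows "pos_def (\<lambda>\<xi>. \<phi> \<xi> * cos_transform M Y \<xi>)"
proof -
  interpret M: finite_measure M by fact
  interpret pair_sigma_finite M "lborel :: 'a measure" by standard
  obtain B where B: "\<And>\<xi>. \<bar>\<phi> \<xi>\<bar> \<le> B" using pd unfolding pos_def_def by auto
  have B0: "0 \<le> B" using B[of 0] by linarith
  have m[measurable]: "\<phi> \<in> borel_measurable borel" using pd unfolding pos_def_def by auto
  have [measurable]: "cos_transform M Y \<in> borel_measurable borel" using M Y by (rule cos_transform_measurable)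
  show ?thesis unfolding pos_def_def
  proof (intro conjI allI impI)
    have "\<bar>\<phi> \<xi> * cos_transform M Y \<xi>\<bar> \<le> B * measure M (space M)" for \<xi>
      unfolding abs_mult by (intro mult_mono B cos_transform_bound M Y B0) auto
    then show "\<exists>B. \<forall>\<xi>. \<bar>\<phi> \<xi> * cos_transform M Y \<xi>\<bar> \<le> B" by auto
    fix \<delta> :: real and x :: 'a assume d: "0 < \<delta>"
    define F where "F \<omega> \<xi> = cos (x \<bullet> \<xi>) * (\<phi> \<xi> * cos (\<xi> \<bullet> Y \<omega>)) * exp_l1 \<delta> \<xi>" for \<omega> \<xi>
    have [measurable]: "case_prod F \<in> borel_measurable (M \<Otimes>\<^sub>M lborel)" unfolding F_def by measurable
    have Fb: "norm (F \<omega> \<xi>) \<le> B * exp_l1 \<delta> \<xi>" for \<omega> \<xi>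
    proof -
      have "\<bar>cos (x \<bullet> \<xi>) * (cos (\<xi> \<bullet> Y \<omega>) * \<phi> \<xi>)\<bar> \<le> B" by (intro abs_cos_mult_le B)
      then show ?thesis using exp_l1_bounds(1)[of \<delta> \<xi>] by (simp add: F_def abs_mult mult_right_mono mult.commute[of "\<bar>\<phi> \<xi>\<bar>"])
    qed
    have Fi: "integrable lborel (F \<omega>)" if "\<omega> \<in> space M" for \<omega>
    proof (rule Bochner_Integration.integrable_bound[of _ "\<lambda>\<xi>. B * exp_l1 \<delta> \<xi>"])
      show "integrable lborel (\<lambda>\<xi>::'a. B * exp_l1 \<delta> \<xi>)" by (simp add: integrable_exp_l1 d)
      show "F \<omega> \<in> borel_measurable lborel" unfolding F_def by measurable
      show "AE \<xi> in lborel. norm (F \<omega> \<xi>) \<le> norm (B * exp_l1 \<delta> \<xi>)"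
        by (intro AE_I2 order_trans[OF Fb]) simp
    qed
    have int: "integrable (M \<Otimes>\<^sub>M lborel) (case_prod F)"
    proof (rule Fubini_integrable)
      show "integrable M (\<lambda>\<omega>. LINT \<xi>|lborel. norm (case (\<omega>, \<xi>) of (x, y) \<Rightarrow> F x y))"
      proof (rule M.integrable_const_bound[where B = "LINT \<xi>|lborel. B * exp_l1 \<delta> (\<xi>::'a)"])
        show "AE \<omega> in M. norm (LINT \<xi>|lborel. norm (case (\<omega>, \<xi>) of (x, y) \<Rightarrow> F x y)) \<le> (LINT \<xi>|lborel. B * exp_l1 \<delta> (\<xi>::'a))"
        proof (rule AE_I2)
          fix \<omega> assume w: "\<omega> \<in> space M"
          have "(LINT \<xi>|lborel. norm (F \<omega> \<xi>)) \<le> (LINT \<xi>|lborel. B * exp_l1 \<delta> (\<xi>::'a))"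
          proof (rule Bochner_Integration.integral_mono)
            show "integrable lborel (\<lambda>\<xi>. norm (F \<omega> \<xi>))" using Fi[OF w] by (rule integrable_norm)
            show "integrable lborel (\<lambda>\<xi>::'a. B * exp_l1 \<delta> \<xi>)" by (simp add: integrable_exp_l1 d)
          qed (rule Fb)
          moreover have "0 \<le> (LINT \<xi>|lborel. norm (F \<omega> \<xi>))" by simp
          ultimately show "norm (LINT \<xi>|lborel. norm (case (\<omega>, \<xi>) of (x, y) \<Rightarrow> F x y)) \<le> (LINT \<xi>|lborel. B * exp_l1 \<delta> (\<xi>::'a))" by simp
        qed
      qed measurable
    qed (use Fi in auto)
    have inner: "0 \<le> (LINT \<xi>|lborel. F \<omega> \<xi>)" for \<omega>
    proof -
      have "(LINT \<xi>|lborel. F \<omega> \<xi>) = (LINT \<xi>|lborel. cos ((x + Y \<omega>) \<bullet> \<xi>) * \<phi> \<xi> * exp_l1 \<delta> \<xi> / 2 + cos ((x - Y \<omega>) \<bullet> \<xi>) * \<phi> \<xi> * exp_l1 \<delta> \<xi> / 2)"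
        by (intro Bochner_Integration.integral_cong)
           (auto simp: F_def inner_add_left inner_diff_left cos_add cos_diff inner_commute[of "Y \<omega>"] field_simps)
      also have "\<dots> = (LINT \<xi>|lborel. cos ((x + Y \<omega>) \<bullet> \<xi>) * \<phi> \<xi> * exp_l1 \<delta> \<xi> / 2) + (LINT \<xi>|lborel. cos ((x - Y \<omega>) \<bullet> \<xi>) * \<phi> \<xi> * exp_l1 \<delta> \<xi> / 2)"
        by (intro Bochner_Integration.integral_add Bochner_Integration.integrable_divide pos_def_integrable_cos[OF m B d])
      also have "0 \<le> \<dots>" using pd d unfolding pos_def_def by auto
      finally show ?thesis .
    qed
    have "(LINT \<xi>|lborel. cos (x \<bullet> \<xi>) * (\<phi> \<xi> * cos_transform M Y \<xi>) * exp_l1 \<delta> \<xi>) = (LINT \<xi>|lborel. LINT \<omega>|M. F \<omega> \<xi>)"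
      unfolding F_def cos_transform_def by (simp add: mult_ac)
    also have "\<dots> = (LINT \<omega>|M. LINT \<xi>|lborel. F \<omega> \<xi>)" by (rule Fubini_integral[OF int])
    also have "0 \<le> \<dots>" by (intro Bochner_Integration.integral_nonneg inner)
    finally show "0 \<le> (LINT \<xi>|lborel. cos (x \<bullet> \<xi>) * (\<phi> \<xi> * cos_transform M Y \<xi>) * exp_l1 \<delta> \<xi>)" .
  qed measurable
qed

text \<open>The exponential series has nonnegative coefficients for t \<ge> 0, and powers of a
  cosine transform are positive definite by \<open>pos_def_mult_cos_transform\<close>. The partial
  sums are bounded by exp(t m), with m the total mass of M.\<close>

lemma pos_def_exp_cos_transform:
  fixes Y :: "'b \<Rightarrow> 'a::euclidean_space"
  assumes M: "finite_measure M" and Y: "Y \<in> borel_measurable M" and t: "0 \<le> t"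
  shows "pos_def (\<lambda>\<xi>. exp (t * cos_transform M Y \<xi>))"
proof -
  have pw: "pos_def (\<lambda>\<xi>. cos_transform M Y \<xi> ^ n)" for n
    by (induction n) (use pos_def_mult_cos_transform[OF _ M Y] in \<open>auto simp: pos_def_1 power_Suc2 simp del: power_Suc\<close>)
  have ps: "pos_def (\<lambda>\<xi>. \<Sum>i<n. (t * cos_transform M Y \<xi>) ^ i /\<^sub>R fact i)" for n
  proof (induction n)
    case 0
    show ?case using pos_def_cmult[OF pos_def_1, of 0] by simp
  next
    case (Suc n)
    have "pos_def (\<lambda>\<xi>. t ^ n / fact n * cos_transform M Y \<xi> ^ n)"
      using t by (intro pos_def_cmult pw) simp
    from pos_def_add[OF Suc this] show ?case by (simp add: power_mult_distrib divide_inverse mult_ac)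
  qed
  show ?thesis
  proof (rule pos_def_limit[OF ps])
    fix \<xi> :: 'a
    show "(\<lambda>n. \<Sum>i<n. (t * cos_transform M Y \<xi>) ^ i /\<^sub>R fact i) \<longlonglongrightarrow> exp (t * cos_transform M Y \<xi>)"
      using exp_converges[of "t * cos_transform M Y \<xi>"] by (simp add: sums_def)
    fix n
    have "\<bar>\<Sum>i<n. (t * cos_transform M Y \<xi>) ^ i /\<^sub>R fact i\<bar> \<le> (\<Sum>i<n. (t * measure M (space M)) ^ i /\<^sub>R fact i)"
    proof (intro order_trans[OF sum_abs] sum_mono)
      fix i
      have "\<bar>t * cos_transform M Y \<xi>\<bar> ^ i \<le> (t * measure M (space M)) ^ i"
        using t cos_transform_bound[OF M Y] by (intro power_mono) (auto simp: abs_mult intro: mult_left_mono)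
      then show "\<bar>(t * cos_transform M Y \<xi>) ^ i /\<^sub>R fact i\<bar> \<le> (t * measure M (space M)) ^ i /\<^sub>R fact i"
        by (simp add: abs_mult power_abs power_mult_distrib mult_left_mono)
    qed
    also have "\<dots> \<le> exp (t * measure M (space M))"
      unfolding exp_def using t by (intro sum_le_suminf summable_exp_generic) auto
    finally show "\<bar>\<Sum>i<n. (t * cos_transform M Y \<xi>) ^ i /\<^sub>R fact i\<bar> \<le> exp (t * measure M (space M))" .
  qed
qed

text \<open>The characteristic function of a symmetrised compound Poisson law with jump intensity M:
  it differs from the previous exponential by the constant factor exp(-t m), m being the mass of
  M.\<close>

lemma pos_def_exp_minus:
  fixes Y :: "'b \<Rightarrow> 'a::euclidean_space"
  assumes M: "finite_measure M" and Y: "Y \<in> borel_measurable M" and t: "0 \<le> t"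
  shows "pos_def (\<lambda>\<xi>. exp (- t * (LINT \<omega>|M. 1 - cos (\<xi> \<bullet> Y \<omega>))))"
proof -
  interpret finite_measure M by fact
  have "(LINT \<omega>|M. 1 - cos (\<xi> \<bullet> Y \<omega>)) = measure M (space M) - cos_transform M Y \<xi>" for \<xi>
    unfolding cos_transform_def using Y
    by (subst Bochner_Integration.integral_diff) (auto intro: integrable_const_bound[where B = 1])
  moreover have "exp (- t * (c - d)) = exp (- t * c) * exp (t * d)" for c d
    by (simp add: algebra_simps flip: exp_add)
  ultimately show ?thesis using pos_def_cmult[OF pos_def_exp_cos_transform[OF M Y t]] by simp
qed

section \<open>Sign and total mass of the Fourier transform\<close>

lemma pos_def_fourier_nonneg:
  assumes pd: "pos_def \<phi>" and int: "integrable lborel \<phi>"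
  shows "0 \<le> (LINT \<xi>|lborel. cos (x \<bullet> \<xi>) * \<phi> \<xi>)"
proof -
  have [measurable]: "\<phi> \<in> borel_measurable borel" using pd unfolding pos_def_def by auto
  have "(\<lambda>n. LINT \<xi>|lborel. cos (x \<bullet> \<xi>) * \<phi> \<xi> * exp_l1 (inverse (real (Suc n))) \<xi>) \<longlonglongrightarrow> (LINT \<xi>|lborel. cos (x \<bullet> \<xi>) * \<phi> \<xi>)"
  proof (rule integral_dominated_convergence[where w = "\<lambda>\<xi>. \<bar>\<phi> \<xi>\<bar>"])
    show "AE \<xi> in lborel. norm (cos (x \<bullet> \<xi>) * \<phi> \<xi> * exp_l1 (inverse (real (Suc n))) \<xi>) \<le> \<bar>\<phi> \<xi>\<bar>" for n
    proof (rule AE_I2)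
      fix \<xi>
      have "\<bar>cos (x \<bullet> \<xi>) * \<phi> \<xi>\<bar> * exp_l1 (inverse (real (Suc n))) \<xi> \<le> \<bar>\<phi> \<xi>\<bar> * 1"
        using exp_l1_bounds[of "inverse (real (Suc n))" \<xi>] by (intro mult_mono abs_cos_mult_le) auto
      then show "norm (cos (x \<bullet> \<xi>) * \<phi> \<xi> * exp_l1 (inverse (real (Suc n))) \<xi>) \<le> \<bar>\<phi> \<xi>\<bar>"
        using exp_l1_bounds(1)[of "inverse (real (Suc n))" \<xi>] by (simp add: abs_mult)
    qed
    show "AE \<xi> in lborel. (\<lambda>n. cos (x \<bullet> \<xi>) * \<phi> \<xi> * exp_l1 (inverse (real (Suc n))) \<xi>) \<longlonglongrightarrow> cos (x \<bullet> \<xi>) * \<phi> \<xi>"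
      using exp_l1_tendsto by (intro AE_I2) (auto intro!: tendsto_eq_intros)
  qed (use int in auto)
  then show ?thesis
    by (rule LIMSEQ_le_const) (use pd in \<open>auto simp: pos_def_def\<close>)
qed

text \<open>Replaces Fourier inversion at 0 by an inequality. Testing the transform g of \<phi>
  against \<open>exp_l1 \<delta>\<close> and exchanging integrals gives the integral of \<phi>
  against the Poisson kernel, which is at most its mass because \<phi> \<le> 1. Since g \<ge> 0,
  Fatou's lemma removes the factor.\<close>

lemma pos_def_fourier_mass:
  fixes \<phi> :: "'a::euclidean_space \<Rightarrow> real"
  assumes pd: "pos_def \<phi>" and int: "integrable lborel \<phi>" and b: "\<And>\<xi>. 0 \<le> \<phi> \<xi>" "\<And>\<xi>. \<phi> \<xi> \<le> 1"
  shows "(\<integral>\<^sup>+x. ennreal (LINT \<xi>|lborel. cos (x \<bullet> \<xi>) * \<phi> \<xi>) \<partial>lborel) \<le> ennreal ((2 * pi) ^ DIM('a))"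
proof -
  have [measurable]: "\<phi> \<in> borel_measurable borel" using pd unfolding pos_def_def by auto
  define g where "g x = (LINT \<xi>|lborel. cos (x \<bullet> \<xi>) * \<phi> \<xi>)" for x
  have [measurable]: "g \<in> borel_measurable borel" unfolding g_def[abs_def] by measurable
  have g0: "0 \<le> g x" for x unfolding g_def by (rule pos_def_fourier_nonneg[OF pd int])
  have approx: "(\<integral>\<^sup>+x. ennreal (g x * exp_l1 \<delta> x) \<partial>lborel) \<le> ennreal ((2 * pi) ^ DIM('a))" if d: "0 < \<delta>" for \<delta>
  proof -
    define F where "F x \<xi> = exp_l1 \<delta> x * (cos (x \<bullet> \<xi>) * \<phi> \<xi>)" for x \<xi> :: 'a
    have [measurable]: "case_prod F \<in> borel_measurable (borel \<Otimes>\<^sub>M borel)" unfolding F_def by measurable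
    have nF: "norm (F x \<xi>) \<le> exp_l1 \<delta> x * \<phi> \<xi>" for x \<xi>
      using b(1)[of \<xi>] exp_l1_bounds(1)[of \<delta> x] unfolding F_def
      using abs_cos_mult_le[of "\<phi> \<xi>" "\<phi> \<xi>" "x \<bullet> \<xi>"] by (simp add: abs_mult mult_left_mono)
    have Fi: "integrable lborel (F x)" for x
      by (rule Bochner_Integration.integrable_bound[of _ "\<lambda>\<xi>. exp_l1 \<delta> x * \<phi> \<xi>"])
         (use int nF in \<open>auto simp: F_def intro: order_trans[OF _ abs_ge_self]\<close>)
    have i: "integrable (lborel \<Otimes>\<^sub>M lborel) (case_prod F)"
    proof (rule lborel_pair.Fubini_integrable)
      show "integrable lborel (\<lambda>x. LINT \<xi>|lborel. norm (case (x, \<xi>) of (x, y) \<Rightarrow> F x y))"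
      proof (rule Bochner_Integration.integrable_bound)
        show "integrable lborel (\<lambda>x::'a. exp_l1 \<delta> x * (LINT \<xi>|lborel. \<phi> \<xi>))" by (simp add: integrable_exp_l1 d)
        have "(LINT \<xi>|lborel. norm (F x \<xi>)) \<le> (LINT \<xi>|lborel. exp_l1 \<delta> x * \<phi> \<xi>)" for x
          using Fi int by (intro Bochner_Integration.integral_mono nF) auto
        then show "AE x in lborel. norm (LINT \<xi>|lborel. norm (case (x, \<xi>) of (x, y) \<Rightarrow> F x y)) \<le> norm (exp_l1 \<delta> x * (LINT \<xi>|lborel. \<phi> \<xi>))"
          by (auto intro: order_trans[OF _ abs_ge_self])
      qed measurable
    qed (use Fi in auto)
    have gF: "g x * exp_l1 \<delta> x = (LINT \<xi>|lborel. F x \<xi>)" for x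
      unfolding F_def g_def by simp
    have gi: "integrable lborel (\<lambda>x. g x * exp_l1 \<delta> x)"
      unfolding gF using lborel_pair.integrable_fst'[OF i] by simp
    have "(\<integral>\<^sup>+x. ennreal (g x * exp_l1 \<delta> x) \<partial>lborel) = ennreal (LINT x|lborel. g x * exp_l1 \<delta> x)"
      using g0 exp_l1_bounds(1) by (intro nn_integral_eq_integral gi AE_I2 mult_nonneg_nonneg) (auto intro: less_imp_le)
    also have "(LINT x|lborel. g x * exp_l1 \<delta> x) = (LINT \<xi>|lborel. LINT x|lborel. F x \<xi>)"
      unfolding gF by (rule lborel_pair.Fubini_integral[OF i, symmetric])
    also have "\<dots> = (LINT \<xi>|lborel. \<phi> \<xi> * poisson_kernel \<delta> \<xi>)"
    proof (rule Bochner_Integration.integral_cong[OF refl])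
      fix \<xi> :: 'a
      have "F x \<xi> = \<phi> \<xi> * (cos (\<xi> \<bullet> x) * exp_l1 \<delta> x)" for x by (simp add: F_def inner_commute)
      then show "(LINT x|lborel. F x \<xi>) = \<phi> \<xi> * poisson_kernel \<delta> \<xi>"
        using has_bochner_integral_integral_eq[OF fourier_exp_l1[OF d, of \<xi>]] by simp
    qed
    also have "ennreal \<dots> \<le> (\<integral>\<^sup>+\<xi>. ennreal (poisson_kernel \<delta> (\<xi>::'a)) \<partial>lborel)"
    proof -
      have pki: "integrable lborel (poisson_kernel \<delta> :: 'a \<Rightarrow> real)"
        using nn_integral_poisson_kernel[OF d, where 'a = 'a] poisson_kernel_nonneg[OF d] by (intro integrableI_nonneg) auto
      have le: "\<phi> \<xi> * poisson_kernel \<delta> \<xi> \<le> poisson_kernel \<delta> \<xi>" for \<xi>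
        using b poisson_kernel_nonneg[OF d, of \<xi>] by (simp add: mult_left_le_one_le)
      have "(LINT \<xi>|lborel. \<phi> \<xi> * poisson_kernel \<delta> \<xi>) \<le> (LINT \<xi>|lborel. poisson_kernel \<delta> (\<xi>::'a))"
      proof (rule integral_mono[OF _ pki le])
        show "integrable lborel (\<lambda>\<xi>. \<phi> \<xi> * poisson_kernel \<delta> \<xi>)"
          using pki by (rule Bochner_Integration.integrable_bound) (use le b poisson_kernel_nonneg[OF d] in \<open>auto simp: abs_mult intro!: mult_left_le_one_le\<close>)
      qed
      then show ?thesis
        using pki poisson_kernel_nonneg[OF d] by (subst nn_integral_eq_integral) (auto intro: ennreal_leI)
    qed
    also have "\<dots> = ennreal ((2 * pi) ^ DIM('a))" by (rule nn_integral_poisson_kernel[OF d])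
    finally show ?thesis .
  qed
  have lim: "(\<lambda>n. ennreal (g x * exp_l1 (inverse (real (Suc n))) x)) \<longlonglongrightarrow> ennreal (g x)" for x
    using exp_l1_tendsto[of x] by (intro tendsto_ennrealI) (auto intro!: tendsto_eq_intros)
  have "(\<integral>\<^sup>+x. ennreal (g x) \<partial>lborel) = (\<integral>\<^sup>+x. liminf (\<lambda>n. ennreal (g x * exp_l1 (inverse (real (Suc n))) x)) \<partial>lborel)"
    by (intro nn_integral_cong lim_imp_Liminf[symmetric] lim) simp
  also have "\<dots> \<le> liminf (\<lambda>n. \<integral>\<^sup>+x. ennreal (g x * exp_l1 (inverse (real (Suc n))) x) \<partial>lborel)"
    by (rule nn_integral_liminf) measurable
  also have "\<dots> \<le> liminf (\<lambda>n. ennreal ((2 * pi) ^ DIM('a)))"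
    by (intro Liminf_mono always_eventually allI approx) simp
  finally show ?thesis by (simp add: g_def Liminf_const)
qed

subsection \<open>The Green function in space\<close>

text \<open>The substitution r to r / |a| extracts |a|^\<beta> and leaves the constant at a = 1. It
  is finite because 1 - cos r \<le> r^2 near 0 with \<beta> < 2 and because \<beta> > 0 at infinity;
  it is positive because 1 - cos r \<ge> 1 on [pi/2, pi].\<close>

lemma nn_integral_one_minus_cos:
  assumes \<beta>: "0 < \<beta>" "\<beta> < 2"
  shows "\<exists>\<kappa>>0. \<forall>a. (\<integral>\<^sup>+r. ennreal (indicator {0<..} r * ((1 - cos (a * r)) * r powr (- 1 - \<beta>))) \<partial>lborel) = ennreal (\<kappa> * \<bar>a\<bar> powr \<beta>)"
proof -
  define J where "J a = (\<integral>\<^sup>+r. ennreal (indicator {0<..} r * ((1 - cos (a * r)) * r powr (- 1 - \<beta>))) \<partial>lborel)" for a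
  have "J 1 \<le> (\<integral>\<^sup>+r. ennreal (r powr (1 - \<beta>)) * indicator {0..1} r + 2 * (ennreal (r powr (- 1 - \<beta>)) * indicator {1..} r) \<partial>lborel)"
    unfolding J_def
  proof (rule nn_integral_mono)
    fix r :: real
    show "ennreal (indicator {0<..} r * ((1 - cos (1 * r)) * r powr (- 1 - \<beta>))) \<le> ennreal (r powr (1 - \<beta>)) * indicator {0..1} r + 2 * (ennreal (r powr (- 1 - \<beta>)) * indicator {1..} r)"
    proof (cases "0 < r \<and> r \<le> 1")
      case True
      have "(sin (r / 2))\<^sup>2 \<le> (r / 2)\<^sup>2"
        using abs_sin_x_le_abs_x[of "r / 2"] by (simp only: abs_le_square_iff)
      then have "1 - cos r \<le> r\<^sup>2 / 2"
        using cos_double_sin[of "r / 2"] by (simp add: power_divide)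
      then have "1 - cos r \<le> r\<^sup>2" by (smt (verit) zero_le_power2 field_sum_of_halves)
      then have "(1 - cos r) * r powr (- 1 - \<beta>) \<le> r\<^sup>2 * r powr (- 1 - \<beta>)"
        by (intro mult_right_mono) auto
      also have "r\<^sup>2 * r powr (- 1 - \<beta>) = r powr (1 - \<beta>)"
        using True by (simp add: powr_add[symmetric] flip: powr_numeral)
      finally show ?thesis using True by (intro add_increasing2) (auto intro: ennreal_leI)
    next
      case False
      show ?thesis
      proof (cases "1 < r")
        case True
        have "(1 - cos r) * r powr (- 1 - \<beta>) \<le> 2 * r powr (- 1 - \<beta>)"
          using cos_ge_minus_one[of r] by (intro mult_right_mono) auto
        then show ?thesis using True by (simp add: ennreal_mult'[symmetric] ennreal_leI flip: ennreal_numeral)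
      qed (use False in auto)
    qed
  qed
  also have "\<dots> = ennreal (1 powr (1 - \<beta> + 1) / (1 - \<beta> + 1)) + 2 * ennreal (- (1 powr (- 1 - \<beta> + 1) / (- 1 - \<beta> + 1)))"
    using nn_integral_powr_from_0[of "1 - \<beta>" 1] nn_integral_powr_to_inf[of "- 1 - \<beta>" 1] \<beta>
    by (subst nn_integral_add) (auto simp: nn_integral_cmult)
  also have "\<dots> < \<infinity>" by (simp add: ennreal_mult_less_top)
  finally have fin: "J 1 < \<infinity>" .
  have "0 < ennreal (pi / 2 * pi powr (- 1 - \<beta>))" by simp
  also have "\<dots> = (\<integral>\<^sup>+r. ennreal (pi powr (- 1 - \<beta>)) * indicator {pi/2..pi} r \<partial>lborel)"
    by (subst nn_integral_cmult_indicator) (auto simp: ennreal_mult[symmetric] mult.commute)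
  also have "\<dots> \<le> J 1" unfolding J_def
  proof (rule nn_integral_mono)
    fix r :: real
    show "ennreal (pi powr (- 1 - \<beta>)) * indicator {pi/2..pi} r \<le> ennreal (indicator {0<..} r * ((1 - cos (1 * r)) * r powr (- 1 - \<beta>)))"
    proof (cases "pi / 2 \<le> r \<and> r \<le> pi")
      case True
      then have r: "0 < r" using pi_half_gt_zero by linarith
      have "cos r \<le> 0" using cos_monotone_0_pi_le[of "pi / 2" r] True pi_half_ge_zero by simp
      moreover have "pi powr (- 1 - \<beta>) \<le> r powr (- 1 - \<beta>)" using True r \<beta> by (intro powr_mono2') auto
      ultimately have "1 * pi powr (- 1 - \<beta>) \<le> (1 - cos r) * r powr (- 1 - \<beta>)" by (intro mult_mono) auto
      then show ?thesis using True r by (simp add: ennreal_leI)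
    qed simp
  qed
  finally have pos: "0 < J 1" .
  obtain \<kappa> where \<kappa>: "0 \<le> \<kappa>" "J 1 = ennreal \<kappa>" using fin by (cases "J 1") auto
  have "0 < \<kappa>" using pos \<kappa> by simp
  moreover have "J a = ennreal (\<kappa> * \<bar>a\<bar> powr \<beta>)" for a
  proof (cases "a = 0")
    case False
    have "J a = ennreal \<bar>1 / \<bar>a\<bar>\<bar> * (\<integral>\<^sup>+r. ennreal (indicator {0<..} (0 + 1 / \<bar>a\<bar> * r) * ((1 - cos (a * (0 + 1 / \<bar>a\<bar> * r))) * (0 + 1 / \<bar>a\<bar> * r) powr (- 1 - \<beta>))) \<partial>lborel)"
      unfolding J_def using False by (intro nn_integral_real_affine) auto
    also have "\<dots> = (\<integral>\<^sup>+r. ennreal (\<bar>a\<bar> powr \<beta>) * ennreal (indicator {0<..} r * ((1 - cos (1 * r)) * r powr (- 1 - \<beta>))) \<partial>lborel)"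
    proof (subst nn_integral_cmult[symmetric], simp, rule nn_integral_cong)
      fix r :: real
      have c: "cos (a * (1 / \<bar>a\<bar> * r)) = cos r" using False by (cases "0 < a") auto
      show "ennreal \<bar>1 / \<bar>a\<bar>\<bar> * ennreal (indicator {0<..} (0 + 1 / \<bar>a\<bar> * r) * ((1 - cos (a * (0 + 1 / \<bar>a\<bar> * r))) * (0 + 1 / \<bar>a\<bar> * r) powr (- 1 - \<beta>))) =
        ennreal (\<bar>a\<bar> powr \<beta>) * ennreal (indicator {0<..} r * ((1 - cos (1 * r)) * r powr (- 1 - \<beta>)))"
      proof (cases "0 < r")
        case True
        have "(1 / \<bar>a\<bar> * r) powr (- 1 - \<beta>) = \<bar>a\<bar> powr (1 + \<beta>) * r powr (- 1 - \<beta>)"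
          using True False by (simp add: powr_divide powr_minus divide_simps powr_add[symmetric])
        moreover have "\<bar>a\<bar> powr (1 + \<beta>) = \<bar>a\<bar> * \<bar>a\<bar> powr \<beta>" using False by (simp add: powr_add)
        ultimately show ?thesis unfolding add_0 c using True False
          by (simp add: ennreal_mult'[symmetric] mult_ac)
      next
        case r: False
        then have "\<not> 0 < 1 / \<bar>a\<bar> * r" using False by (simp add: zero_less_divide_iff)
        then show ?thesis using r by simp
      qed
    qed
    also have "\<dots> = ennreal (\<bar>a\<bar> powr \<beta>) * J 1" unfolding J_def by (rule nn_integral_cmult) simp
    finally show ?thesis using \<kappa> by (simp add: ennreal_mult'[symmetric] mult.commute)
  qed (simp add: J_def)
  ultimately show ?thesis unfolding J_def by blast
qed

lemma symbol_eq:
  assumes "0 < \<beta>"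
  shows "symbol \<beta> \<nu> \<xi> = (LINT \<eta>|\<nu>. \<bar>\<xi> \<bullet> \<eta>\<bar> powr \<beta>)"
proof (cases "\<xi> = 0")
  case False
  have "norm \<xi> powr \<beta> * \<bar>(\<xi> /\<^sub>R norm \<xi>) \<bullet> \<eta>\<bar> powr \<beta> = \<bar>\<xi> \<bullet> \<eta>\<bar> powr \<beta>" for \<eta>
    using False by (simp add: powr_mult[symmetric] abs_mult mult.assoc[symmetric])
  then show ?thesis unfolding symbol_def spectral_fun_def integral_mult_right_zero[symmetric] by simp
qed (simp add: symbol_def)

context
  fixes \<beta> :: real and \<nu> :: "'a::euclidean_space measure"
  assumes \<beta>: "0 < \<beta>" "\<beta> < 2" and adm: "admissible_spectral_measure \<beta> \<nu>"
begin

lemma finite_measure_spectral: "finite_measure \<nu>"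
  using adm by (simp add: admissible_spectral_measure_def)

lemma sets_spectral: "sets \<nu> = sets (restrict_space borel (sphere 0 1))"
  using adm by (auto simp: admissible_spectral_measure_def sphere_measure_def)

lemma space_spectral: "space \<nu> = sphere 0 1"
  using sets_eq_imp_space_eq[OF sets_spectral] by (simp add: space_restrict_space)

lemma ident_measurable_spectral: "(\<lambda>\<eta>. \<eta>) \<in> borel_measurable \<nu>"
  unfolding measurable_cong_sets[OF sets_spectral refl] by (rule measurable_restrict_space1) simp

lemma symbol_measurable[measurable]: "symbol \<beta> \<nu> \<in> borel_measurable borel"
proof -
  interpret finite_measure \<nu> by (rule finite_measure_spectral)
  note ident_measurable_spectral[measurable]
  have "(\<lambda>\<xi>. LINT \<eta>|\<nu>. \<bar>\<xi> \<bullet> \<eta>\<bar> powr \<beta>) \<in> borel_measurable borel" by measurable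
  also have "(\<lambda>\<xi>. LINT \<eta>|\<nu>. \<bar>\<xi> \<bullet> \<eta>\<bar> powr \<beta>) = symbol \<beta> \<nu>" by (rule ext) (rule symbol_eq[OF \<beta>(1), symmetric])
  finally show ?thesis .
qed

lemma ennreal_symbol: "ennreal (symbol \<beta> \<nu> \<xi>) = (\<integral>\<^sup>+\<eta>. ennreal (\<bar>\<xi> \<bullet> \<eta>\<bar> powr \<beta>) \<partial>\<nu>)"
proof -
  interpret finite_measure \<nu> by (rule finite_measure_spectral)
  note ident_measurable_spectral[measurable]
  have "integrable \<nu> (\<lambda>\<eta>. \<bar>\<xi> \<bullet> \<eta>\<bar> powr \<beta>)"
  proof (rule integrable_const_bound[where B = "norm \<xi> powr \<beta>"])
    show "AE \<eta> in \<nu>. norm (\<bar>\<xi> \<bullet> \<eta>\<bar> powr \<beta>) \<le> norm \<xi> powr \<beta>"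
    proof (rule AE_I2)
      fix \<eta> assume "\<eta> \<in> space \<nu>"
      then have "\<bar>\<xi> \<bullet> \<eta>\<bar> \<le> norm \<xi>" using Cauchy_Schwarz_ineq2[of \<xi> \<eta>] by (simp add: space_spectral)
      then show "norm (\<bar>\<xi> \<bullet> \<eta>\<bar> powr \<beta>) \<le> norm \<xi> powr \<beta>" using \<beta> by (simp add: powr_mono2)
    qed
  qed measurable
  then show ?thesis unfolding symbol_eq[OF \<beta>(1)] by (intro nn_integral_eq_integral[symmetric]) auto
qed

lemma symbol_nonneg: "0 \<le> symbol \<beta> \<nu> \<xi>"
  unfolding symbol_eq[OF \<beta>(1)] by simp

text \<open>The angular part is continuous and positive on the compact sphere, so it has a positive
  minimum, and the symbol is homogeneous of degree \<beta>.\<close>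

lemma symbol_lower_bound: "\<exists>c>0. \<forall>\<xi>. c * norm \<xi> powr \<beta> \<le> symbol \<beta> \<nu> \<xi>"
proof -
  have "Ck_on (Suc (DIM('a) + nat \<lfloor>\<beta>\<rfloor>)) (- {0}) (\<lambda>x. spectral_fun \<beta> \<nu> (x /\<^sub>R norm x))"
    using adm by (simp add: admissible_spectral_measure_def Ck_sphere_def)
  then have "continuous_on (- {0}) (\<lambda>x. spectral_fun \<beta> \<nu> (x /\<^sub>R norm x))"
    by (auto intro!: continuous_at_imp_continuous_on differentiable_imp_continuous_within)
  then have "continuous_on (sphere 0 1) (\<lambda>x. spectral_fun \<beta> \<nu> (x /\<^sub>R norm x))"
    by (rule continuous_on_subset) auto
  then have cont: "continuous_on (sphere 0 1) (spectral_fun \<beta> \<nu>)"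
    by (rule continuous_on_eq) auto
  have ne: "sphere (0::'a) 1 \<noteq> {}" by simp
  obtain \<theta> where \<theta>: "\<theta> \<in> sphere 0 1" "\<And>x. x \<in> sphere 0 1 \<Longrightarrow> spectral_fun \<beta> \<nu> \<theta> \<le> spectral_fun \<beta> \<nu> x"
    using continuous_attains_inf[OF compact_sphere ne cont] by blast
  have "0 < spectral_fun \<beta> \<nu> \<theta>" using adm \<theta>(1) by (simp add: admissible_spectral_measure_def)
  moreover have "spectral_fun \<beta> \<nu> \<theta> * norm \<xi> powr \<beta> \<le> symbol \<beta> \<nu> \<xi>" for \<xi>
  proof (cases "\<xi> = 0")
    case False
    then have "spectral_fun \<beta> \<nu> \<theta> \<le> spectral_fun \<beta> \<nu> (\<xi> /\<^sub>R norm \<xi>)" by (intro \<theta>) simp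
    then show ?thesis by (simp add: symbol_def mult.commute[of "norm \<xi> powr \<beta>"] mult_right_mono)
  qed (simp add: symbol_def)
  ultimately show ?thesis by blast
qed

lemma integrable_exp_symbol:
  assumes t: "0 < t"
  shows "integrable lborel (\<lambda>\<xi>. exp (- t * symbol \<beta> \<nu> \<xi>))"
proof -
  obtain c where c: "0 < c" "\<And>\<xi>. c * norm \<xi> powr \<beta> \<le> symbol \<beta> \<nu> \<xi>" using symbol_lower_bound by auto
  \<comment> \<open>Each |\<xi> \<bullet> b| is at most the norm of \<xi>, so giving every
    coordinate the share 1/d of t c bounds the exponential by a product of one-dimensional
    integrable functions.\<close>
  define c' where "c' = t * c / real DIM('a)"
  have c': "0 < c'" using t c by (simp add: c'_def)
  show ?thesis
  proof (rule Bochner_Integration.integrable_bound)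
    show "integrable lborel (\<lambda>\<xi>::'a. \<Prod>b\<in>Basis. exp (- c' * \<bar>\<xi> \<bullet> b\<bar> powr \<beta>))"
      by (rule lborel_product_integral(1)) (rule integrable_exp_minus_powr[OF \<beta>(1) c'])
    have "exp (- t * symbol \<beta> \<nu> \<xi>) \<le> (\<Prod>b\<in>Basis. exp (- c' * \<bar>\<xi> \<bullet> b\<bar> powr \<beta>))" for \<xi>
    proof -
      have "(\<Sum>b\<in>Basis. c' * \<bar>\<xi> \<bullet> b\<bar> powr \<beta>) \<le> (\<Sum>b\<in>(Basis::'a set). c' * norm \<xi> powr \<beta>)"
        using c' \<beta> Basis_le_norm[of _ \<xi>] by (intro sum_mono mult_left_mono powr_mono2) auto
      also have "\<dots> = t * (c * norm \<xi> powr \<beta>)" by (simp add: c'_def)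
      also have "\<dots> \<le> t * symbol \<beta> \<nu> \<xi>" using t c by simp
      finally show ?thesis by (simp add: sum_negf flip: exp_sum)
    qed
    moreover have "0 \<le> (\<Prod>b\<in>Basis. exp (- c' * \<bar>\<xi> \<bullet> b\<bar> powr \<beta>))" for \<xi> :: 'a by (intro prod_nonneg) auto
    ultimately show "AE \<xi> in lborel. norm (exp (- t * symbol \<beta> \<nu> \<xi>)) \<le> norm (\<Prod>b\<in>Basis. exp (- c' * \<bar>\<xi> \<bullet> b\<bar> powr \<beta>))"
      by (intro AE_I2) (simp only: real_norm_def abs_exp_cancel abs_of_nonneg)
  qed measurable
qed

text \<open>The symbol is the monotone limit of exponents of compound Poisson type, obtained by removing
  the small jumps from \<open>\<bar>a\<bar> powr \<beta> = (1 / \<kappa>) \<integral> (1 - cos (a r)) r powr (- 1 - \<beta>) dr\<close>.\<close>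

lemma pos_def_exp_symbol:
  assumes t: "0 \<le> t"
  shows "pos_def (\<lambda>\<xi>. exp (- t * symbol \<beta> \<nu> \<xi>))"
proof -
  interpret \<nu>: finite_measure \<nu> by (rule finite_measure_spectral)
  obtain \<kappa> where \<kappa>: "0 < \<kappa>"
    "\<And>a. (\<integral>\<^sup>+r. ennreal (indicator {0<..} r * ((1 - cos (a * r)) * r powr (- 1 - \<beta>))) \<partial>lborel) = ennreal (\<kappa> * \<bar>a\<bar> powr \<beta>)"
    using nn_integral_one_minus_cos[OF \<beta>] by auto
  \<comment> \<open>In polar coordinates (\<eta>, r), with jump r \<eta> given by \<open>Y\<close>,
    the weight \<open>V\<close> is the radial density of the Levy measure of the symbol and
    \<open>W n\<close> drops the jumps of length at most 1/(n+1). The measure \<open>N n\<close> is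
    finite because r^(-1-\<beta>) is integrable away from 0 and \<nu> is finite.\<close>
  define W where "W n r = indicator {inverse (real (Suc n))<..} r * r powr (- 1 - \<beta>) / \<kappa>" for n and r :: real
  define V where "V r = indicator {0<..} r * r powr (- 1 - \<beta>) / \<kappa>" for r :: real
  have W0: "0 \<le> W n r" "W n r \<le> V r" for n r
    using \<kappa>(1) by (auto simp: W_def V_def indicator_def intro: less_trans[rotated])
  have [measurable]: "W n \<in> borel_measurable borel" "V \<in> borel_measurable borel" for n
    unfolding W_def[abs_def] V_def[abs_def] by measurable
  define M where "M = \<nu> \<Otimes>\<^sub>M (lborel :: real measure)"
  define Y where "Y p = snd p *\<^sub>R (fst p :: 'a)" for p :: "'a \<times> real"
  have [measurable]: "Y \<in> borel_measurable M" using ident_measurable_spectral unfolding Y_def[abs_def] M_def by measurable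
  have [measurable]: "snd \<in> borel_measurable M" unfolding M_def by measurable
  define N where "N n = density M (\<lambda>p. ennreal (W n (snd p)))" for n
  have fst_int: "(\<integral>\<^sup>+p. f p \<partial>M) = (\<integral>\<^sup>+\<eta>. \<integral>\<^sup>+r. f (\<eta>, r) \<partial>lborel \<partial>\<nu>)" if "f \<in> borel_measurable M" for f
    using lborel.nn_integral_fst[of f \<nu>] that unfolding M_def by simp
  have fin: "finite_measure (N n)" for n
  proof
    let ?a = "inverse (real (Suc n))"
    have "emeasure (N n) (space (N n)) = (\<integral>\<^sup>+p. ennreal (W n (snd p)) \<partial>M)"
      unfolding N_def by (subst emeasure_density) (auto intro!: nn_integral_cong)
    also have "\<dots> = (\<integral>\<^sup>+\<eta>. \<integral>\<^sup>+r. ennreal (W n r) \<partial>lborel \<partial>\<nu>)"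
      by (subst fst_int) auto
    also have "(\<integral>\<^sup>+r. ennreal (W n r) \<partial>lborel) \<le> (\<integral>\<^sup>+r. ennreal (1 / \<kappa>) * (ennreal (r powr (- 1 - \<beta>)) * indicator {?a..} r) \<partial>lborel)"
      using \<kappa>(1) by (intro nn_integral_mono) (auto simp: W_def indicator_def ennreal_mult'[symmetric])
    also have "\<dots> = ennreal (1 / \<kappa>) * ennreal (- (?a powr (- 1 - \<beta> + 1) / (- 1 - \<beta> + 1)))"
      using nn_integral_powr_to_inf[of "- 1 - \<beta>" ?a] \<beta> by (subst nn_integral_cmult) auto
    finally have "emeasure (N n) (space (N n)) \<le> (\<integral>\<^sup>+\<eta>. ennreal (1 / \<kappa>) * ennreal (- (?a powr (- 1 - \<beta> + 1) / (- 1 - \<beta> + 1))) \<partial>\<nu>)"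
      by (simp add: mult_right_mono)
    also have "\<dots> < \<infinity>"
      using \<nu>.emeasure_finite[of "space \<nu>"] by (simp add: ennreal_mult_eq_top_iff less_top[symmetric])
    finally show "emeasure (N n) (space (N n)) \<noteq> \<infinity>" by simp
  qed
  have YN: "Y \<in> borel_measurable (N n)" for n unfolding N_def by simp
  have J: "ennreal (LINT p|N n. 1 - cos (\<xi> \<bullet> Y p)) = (\<integral>\<^sup>+p. ennreal (W n (snd p) * (1 - cos (\<xi> \<bullet> Y p))) \<partial>M)" for n \<xi>
  proof -
    interpret finite_measure "N n" by (rule fin)
    have m: "(\<lambda>p. 1 - cos (\<xi> \<bullet> Y p)) \<in> borel_measurable (N n)" using YN[of n] by measurable
    have "ennreal (LINT p|N n. 1 - cos (\<xi> \<bullet> Y p)) = (\<integral>\<^sup>+p. ennreal (1 - cos (\<xi> \<bullet> Y p)) \<partial>N n)"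
    proof (rule nn_integral_eq_integral[symmetric])
      show "integrable (N n) (\<lambda>p. 1 - cos (\<xi> \<bullet> Y p))"
      proof (rule integrable_const_bound[where B = 2])
        show "AE p in N n. norm (1 - cos (\<xi> \<bullet> Y p)) \<le> 2"
        proof (rule AE_I2)
          fix p
          show "norm (1 - cos (\<xi> \<bullet> Y p)) \<le> 2"
            using cos_ge_minus_one[of "\<xi> \<bullet> Y p"] cos_le_one[of "\<xi> \<bullet> Y p"] unfolding real_norm_def by linarith
        qed
      qed (rule m)
    qed simp
    also have "\<dots> = (\<integral>\<^sup>+p. ennreal (W n (snd p)) * ennreal (1 - cos (\<xi> \<bullet> Y p)) \<partial>M)"
      unfolding N_def by (rule nn_integral_density) measurable
    finally show ?thesis using W0 by (simp add: ennreal_mult)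
  qed
  have sym: "(\<integral>\<^sup>+p. ennreal (V (snd p) * (1 - cos (\<xi> \<bullet> Y p))) \<partial>M) = ennreal (symbol \<beta> \<nu> \<xi>)" for \<xi>
  proof -
    have m: "(\<lambda>p. ennreal (V (snd p) * (1 - cos (\<xi> \<bullet> Y p)))) \<in> borel_measurable M" by measurable
    have "(\<integral>\<^sup>+p. ennreal (V (snd p) * (1 - cos (\<xi> \<bullet> Y p))) \<partial>M) =
      (\<integral>\<^sup>+\<eta>. \<integral>\<^sup>+r. ennreal (1 / \<kappa>) * ennreal (indicator {0<..} r * ((1 - cos ((\<xi> \<bullet> \<eta>) * r)) * r powr (- 1 - \<beta>))) \<partial>lborel \<partial>\<nu>)"
      unfolding fst_int[OF m] using \<kappa>(1) by (auto simp: V_def Y_def ennreal_mult'[symmetric] mult_ac intro!: nn_integral_cong)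
    also have "\<dots> = (\<integral>\<^sup>+\<eta>. ennreal (\<bar>\<xi> \<bullet> \<eta>\<bar> powr \<beta>) \<partial>\<nu>)"
    proof (rule nn_integral_cong)
      fix \<eta>
      have "(\<integral>\<^sup>+r. ennreal (1 / \<kappa>) * ennreal (indicator {0<..} r * ((1 - cos ((\<xi> \<bullet> \<eta>) * r)) * r powr (- 1 - \<beta>))) \<partial>lborel) =
        ennreal (1 / \<kappa>) * (\<integral>\<^sup>+r. ennreal (indicator {0<..} r * ((1 - cos ((\<xi> \<bullet> \<eta>) * r)) * r powr (- 1 - \<beta>))) \<partial>lborel)"
        by (rule nn_integral_cmult) measurable
      then show "(\<integral>\<^sup>+r. ennreal (1 / \<kappa>) * ennreal (indicator {0<..} r * ((1 - cos ((\<xi> \<bullet> \<eta>) * r)) * r powr (- 1 - \<beta>))) \<partial>lborel) = ennreal (\<bar>\<xi> \<bullet> \<eta>\<bar> powr \<beta>)"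
        unfolding \<kappa>(2) using \<kappa>(1) by (simp add: ennreal_mult'[symmetric])
    qed
    finally show ?thesis by (simp add: ennreal_symbol)
  qed
  show ?thesis
  proof (rule pos_def_limit)
    show "pos_def (\<lambda>\<xi>. exp (- t * (LINT p|N n. 1 - cos (\<xi> \<bullet> Y p))))" for n
      by (rule pos_def_exp_minus[OF fin YN t])
    show "\<bar>exp (- t * (LINT p|N n. 1 - cos (\<xi> \<bullet> Y p)))\<bar> \<le> 1" for n \<xi>
      using t by (auto intro!: mult_nonneg_nonneg Bochner_Integration.integral_nonneg)
    fix \<xi>
    have "(\<lambda>n. ennreal (LINT p|N n. 1 - cos (\<xi> \<bullet> Y p))) \<longlonglongrightarrow> ennreal (symbol \<beta> \<nu> \<xi>)"
      unfolding J sym[symmetric]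
    proof (rule nn_integral_dominated_convergence[where w = "\<lambda>p. ennreal (V (snd p) * (1 - cos (\<xi> \<bullet> Y p)))"])
      show "(\<integral>\<^sup>+p. ennreal (V (snd p) * (1 - cos (\<xi> \<bullet> Y p))) \<partial>M) < \<infinity>" unfolding sym by simp
      show "AE p in M. ennreal (W n (snd p) * (1 - cos (\<xi> \<bullet> Y p))) \<le> ennreal (V (snd p) * (1 - cos (\<xi> \<bullet> Y p)))" for n
        using W0 by (intro AE_I2 ennreal_leI mult_right_mono) auto
      show "AE p in M. (\<lambda>n. ennreal (W n (snd p) * (1 - cos (\<xi> \<bullet> Y p)))) \<longlonglongrightarrow> ennreal (V (snd p) * (1 - cos (\<xi> \<bullet> Y p)))"
      proof (rule AE_I2)
        fix p :: "'a \<times> real"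
        have "\<forall>\<^sub>F n in sequentially. W n (snd p) = V (snd p)"
        proof (cases "0 < snd p")
          case True
          have "\<forall>\<^sub>F n in sequentially. inverse (real (Suc n)) < snd p"
            by (rule order_tendstoD(2)[OF LIMSEQ_inverse_real_of_nat True])
          then show ?thesis by eventually_elim (use True in \<open>simp add: W_def V_def\<close>)
        next
          case False
          have "W n (snd p) = V (snd p)" for n
            using False less_trans[of 0 "inverse (real (Suc n))" "snd p"] by (auto simp: W_def V_def indicator_def)
          then show ?thesis by simp
        qed
        then have "\<forall>\<^sub>F n in sequentially. ennreal (W n (snd p) * (1 - cos (\<xi> \<bullet> Y p))) = ennreal (V (snd p) * (1 - cos (\<xi> \<bullet> Y p)))"
          by eventually_elim simp
        then show "(\<lambda>n. ennreal (W n (snd p) * (1 - cos (\<xi> \<bullet> Y p)))) \<longlonglongrightarrow> ennreal (V (snd p) * (1 - cos (\<xi> \<bullet> Y p)))"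
          by (rule tendsto_eventually)
      qed
    qed measurable
    then have "(\<lambda>n. LINT p|N n. 1 - cos (\<xi> \<bullet> Y p)) \<longlonglongrightarrow> symbol \<beta> \<nu> \<xi>"
      by (rule tendsto_ennrealD) (auto simp: symbol_nonneg intro!: always_eventually Bochner_Integration.integral_nonneg)
    then show "(\<lambda>n. exp (- t * (LINT p|N n. 1 - cos (\<xi> \<bullet> Y p)))) \<longlonglongrightarrow> exp (- t * symbol \<beta> \<nu> \<xi>)"
      by (intro tendsto_intros)
  qed
qed

lemma space_green_eq:
  assumes t: "0 < t"
  shows "space_green \<beta> \<nu> t x = (2 * pi) powr (- real DIM('a)) * (LINT \<xi>|lborel. cos (x \<bullet> \<xi>) * exp (- t * symbol \<beta> \<nu> \<xi>))"
proof -
  have i: "integrable lborel (\<lambda>\<xi>. exp (\<i> * complex_of_real (x \<bullet> \<xi>)) * complex_of_real (exp (- t * symbol \<beta> \<nu> \<xi>)))"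
    by (rule Bochner_Integration.integrable_bound[OF integrable_exp_symbol[OF t]]) (auto simp: norm_mult)
  have "Re (LINT \<xi>|lborel. exp (\<i> * complex_of_real (x \<bullet> \<xi>)) * complex_of_real (exp (- t * symbol \<beta> \<nu> \<xi>))) =
    (LINT \<xi>|lborel. cos (x \<bullet> \<xi>) * exp (- t * symbol \<beta> \<nu> \<xi>))"
    by (subst integral_Re[OF i, symmetric]) (simp add: Re_exp)
  then show ?thesis by (simp add: space_green_def)
qed

lemma space_green_nonneg: "0 < t \<Longrightarrow> 0 \<le> space_green \<beta> \<nu> t x"
  unfolding space_green_eq
  by (intro mult_nonneg_nonneg pos_def_fourier_nonneg pos_def_exp_symbol integrable_exp_symbol) auto

lemma nn_integral_space_green_le:
  assumes t: "0 < t"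
  shows "(\<integral>\<^sup>+x. ennreal (space_green \<beta> \<nu> t x) \<partial>lborel) \<le> 1"
proof -
  have "(\<integral>\<^sup>+x. ennreal (space_green \<beta> \<nu> t x) \<partial>lborel) =
    (\<integral>\<^sup>+x. ennreal ((2 * pi) powr (- real DIM('a))) * ennreal (LINT \<xi>|lborel. cos (x \<bullet> \<xi>) * exp (- t * symbol \<beta> \<nu> \<xi>)) \<partial>(lborel :: 'a measure))"
    by (simp add: space_green_eq[OF t] ennreal_mult')
  also have "\<dots> = ennreal ((2 * pi) powr (- real DIM('a))) * (\<integral>\<^sup>+x. ennreal (LINT \<xi>|lborel. cos (x \<bullet> \<xi>) * exp (- t * symbol \<beta> \<nu> \<xi>)) \<partial>(lborel :: 'a measure))"
    by (rule nn_integral_cmult) measurable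
  also have "\<dots> \<le> ennreal ((2 * pi) powr (- real DIM('a))) * ennreal ((2 * pi) ^ DIM('a))"
    using t symbol_nonneg
    by (intro mult_left_mono pos_def_fourier_mass pos_def_exp_symbol integrable_exp_symbol) auto
  also have "\<dots> = ennreal ((2 * pi) powr (- real DIM('a)) * (2 * pi) powr real DIM('a))"
    by (subst ennreal_mult'[symmetric], simp, subst powr_realpow) auto
  also have "\<dots> = 1" by (simp only: powr_add[symmetric]) simp
  finally show ?thesis .
qed

lemma space_green_measurable[measurable]:
  "(\<lambda>p. space_green \<beta> \<nu> (fst p) (snd p)) \<in> borel_measurable (borel \<Otimes>\<^sub>M borel)"
  unfolding space_green_def by measurable

end

subsection \<open>The kernels as subordinated Green functions\<close>

context
  fixes \<alpha> \<beta> :: real and \<nu> :: "'a::euclidean_space measure"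
  assumes \<alpha>: "0 < \<alpha>" "\<alpha> < 1" and \<beta>: "0 < \<beta>" "\<beta> < 2" and adm: "admissible_spectral_measure \<beta> \<nu>"
begin

lemmas green_nonneg = space_green_nonneg[OF \<beta> adm]
lemmas green_mass = nn_integral_space_green_le[OF \<beta> adm]
lemma green_measurable[measurable (raw)]:
  assumes "f \<in> borel_measurable M" "g \<in> borel_measurable M"
  shows "(\<lambda>w. space_green \<beta> \<nu> (f w) (g w)) \<in> borel_measurable M"
  using measurable_compose[OF measurable_Pair[OF assms] space_green_measurable[OF \<beta> adm]] by simp

lemmas pdf_ge_0 = stable_pdf_nonneg[OF \<alpha>]
lemmas pdf_meas[measurable] = borel_measurable_stable_pdf[OF \<alpha>]

text \<open>This is G_\<alpha>(\<tau>, t), the density at t of the stable subordinator at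
  operational time \<tau>, written through its value at time 1 by self-similarity.\<close>

definition time_density :: "real \<Rightarrow> real \<Rightarrow> real" where
  "time_density t \<tau> = indicator {0<..} \<tau> * (\<tau> powr (- 1 / \<alpha>) * stable_pdf \<alpha> (t * \<tau> powr (- 1 / \<alpha>)))"

text \<open>The candidate for Y; the value 0 for t \<le> 0 is the one that \<open>Y_kernel\<close>
  prescribes.\<close>

definition sub_kernel :: "real \<Rightarrow> 'a \<Rightarrow> real" where
  "sub_kernel t x = (if t \<le> 0 then 0 else LINT \<tau>|lborel. time_density t \<tau> * space_green \<beta> \<nu> \<tau> x)"

text \<open>The same mixture in [0, \<infinity>]: it retains the value \<infinity> where the Bochner
  integral diverges and would default to 0, so Tonelli's theorem applies without exceptional
  points.\<close>

definition sub_kernel_nn :: "real \<Rightarrow> 'a \<Rightarrow> ennreal" where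
  "sub_kernel_nn t x = (\<integral>\<^sup>+\<tau>. ennreal (time_density t \<tau> * space_green \<beta> \<nu> \<tau> x) \<partial>lborel)"

lemma time_density_nonneg: "0 \<le> time_density t \<tau>"
  unfolding time_density_def by (intro mult_nonneg_nonneg pdf_ge_0) auto

lemma time_density_green_nonneg: "0 \<le> time_density t \<tau> * space_green \<beta> \<nu> \<tau> x"
  using time_density_nonneg[of t \<tau>] green_nonneg[of \<tau> x] by (cases "0 < \<tau>") (auto simp: time_density_def)

lemma time_density_measurable[measurable (raw)]:
  assumes [measurable]: "f \<in> borel_measurable M" "g \<in> borel_measurable M"
  shows "(\<lambda>w. time_density (f w) (g w)) \<in> borel_measurable M"
  unfolding time_density_def by measurable

text \<open>An envelope for \<open>time_density\<close>, monotone in the cutoff c. A single cutoff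
  therefore serves all sufficiently late times at once.\<close>

definition time_bound :: "real \<Rightarrow> real \<Rightarrow> real" where
  "time_bound c \<tau> = indicator {0<..} \<tau> * min (\<tau> powr (- 1 / \<alpha>)) c"

lemma time_bound_measurable[measurable]: "time_bound c \<in> borel_measurable borel"
  unfolding time_bound_def[abs_def] by measurable

text \<open>The decay of p gives both p(s) \<le> C and p(s) \<le> C/s. At s = t \<tau>^(-1/\<alpha>)
  these are the two entries of the minimum.\<close>

lemma time_density_le: "\<exists>C>0. \<forall>t>0. \<forall>\<tau>. time_density t \<tau> \<le> C * time_bound (1 / t) \<tau>"
proof -
  obtain C where C: "0 < C" "\<And>s. 0 < s \<Longrightarrow> stable_pdf \<alpha> s \<le> C" "\<And>s. 0 < s \<Longrightarrow> stable_pdf \<alpha> s \<le> C * s powr (- (1 + \<alpha>))"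
    using stable_pdf_decay[OF \<alpha>] by auto
  have inv: "stable_pdf \<alpha> s \<le> C / s" if s: "0 < s" for s
  proof (cases "1 \<le> s")
    case True
    have "s powr (- (1 + \<alpha>)) \<le> s powr (- 1)" using True \<alpha> by (intro powr_mono) auto
    then have "C * s powr (- (1 + \<alpha>)) \<le> C * s powr (- 1)" using C(1) by (intro mult_left_mono) auto
    then show ?thesis using C(3)[OF s] s by (simp add: powr_minus_divide)
  next
    case False
    have "C \<le> C / s" using False s C(1) by (simp add: field_simps)
    then show ?thesis using C(2)[OF s] by linarith
  qed
  have "time_density t \<tau> \<le> C * time_bound (1 / t) \<tau>" if t: "0 < t" for t \<tau>
  proof (cases "0 < \<tau>")
    case True
    define c where "c = \<tau> powr (- 1 / \<alpha>)"
    have c: "0 < c" using True by (simp add: c_def)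
    have "c * stable_pdf \<alpha> (t * c) \<le> c * C" using c t by (intro mult_left_mono C) auto
    moreover have "c * stable_pdf \<alpha> (t * c) \<le> c * (C / (t * c))" using c t by (intro mult_left_mono inv) auto
    moreover have "c * (C / (t * c)) = C * (1 / t)" using c t by (simp add: field_simps)
    ultimately have "c * stable_pdf \<alpha> (t * c) \<le> C * min c (1 / t)" using C(1) by (auto simp: min_def mult.commute)
    then show ?thesis using True by (simp add: time_density_def time_bound_def c_def)
  qed (simp add: time_density_def time_bound_def)
  then show ?thesis using C(1) by blast
qed

text \<open>The two entries of the minimum cross at \<tau> = t^\<alpha>. The tail beyond it is
  integrable since 1/\<alpha> > 1, and both pieces scale like t^(\<alpha>-1).\<close>

lemma nn_integral_time_bound:
  assumes t: "0 < t"
  shows "(\<integral>\<^sup>+\<tau>. ennreal (time_bound (1 / t) \<tau>) \<partial>lborel) \<le> ennreal ((1 + 1 / (1 / \<alpha> - 1)) * t powr (\<alpha> - 1))"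
proof -
  have "(\<integral>\<^sup>+\<tau>. ennreal (time_bound (1 / t) \<tau>) \<partial>lborel) \<le>
    (\<integral>\<^sup>+\<tau>. ennreal (1 / t) * indicator {0..t powr \<alpha>} \<tau> + ennreal (\<tau> powr (- 1 / \<alpha>)) * indicator {t powr \<alpha>..} \<tau> \<partial>lborel)"
  proof (rule nn_integral_mono)
    fix \<tau> :: real
    show "ennreal (time_bound (1 / t) \<tau>) \<le> ennreal (1 / t) * indicator {0..t powr \<alpha>} \<tau> + ennreal (\<tau> powr (- 1 / \<alpha>)) * indicator {t powr \<alpha>..} \<tau>"
      using t by (cases "0 < \<tau>"; cases "\<tau> \<le> t powr \<alpha>")
        (auto simp: time_bound_def indicator_def intro!: ennreal_leI add_increasing2)
  qed
  also have "\<dots> = ennreal (1 / t) * ennreal (t powr \<alpha>) + ennreal (- ((t powr \<alpha>) powr (- 1 / \<alpha> + 1) / (- 1 / \<alpha> + 1)))"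
    using nn_integral_powr_to_inf[of "- 1 / \<alpha>" "t powr \<alpha>"] \<alpha> t
    by (subst nn_integral_add) (auto simp: nn_integral_cmult_indicator field_simps)
  also have "\<dots> = ennreal (t powr (\<alpha> - 1) + t powr (\<alpha> - 1) / (1 / \<alpha> - 1))"
  proof -
    have 1: "1 / t * t powr \<alpha> = t powr (\<alpha> - 1)" using t by (simp add: powr_diff)
    have 2: "(t powr \<alpha>) powr (- 1 / \<alpha> + 1) = t powr (\<alpha> - 1)"
      using \<alpha> by (simp add: powr_powr algebra_simps)
    have 3: "- (t powr (\<alpha> - 1) / (- 1 / \<alpha> + 1)) = t powr (\<alpha> - 1) / (1 / \<alpha> - 1)"
      by (metis minus_diff_eq minus_divide_left minus_divide_right add.commute uminus_add_conv_diff)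
    have 4: "0 < 1 / \<alpha> - 1" using \<alpha> by simp
    show ?thesis unfolding 2 3 using t 4
      by (subst ennreal_mult'[symmetric], simp, subst 1) (simp add: ennreal_plus[symmetric] del: ennreal_plus)
  qed
  also have "t powr (\<alpha> - 1) + t powr (\<alpha> - 1) / (1 / \<alpha> - 1) = (1 + 1 / (1 / \<alpha> - 1)) * t powr (\<alpha> - 1)"
    by (simp add: algebra_simps)
  finally show ?thesis .
qed

lemma nn_integral_mixture_le:
  assumes [measurable]: "h \<in> borel_measurable borel" and h: "\<And>\<tau>. \<tau> \<le> 0 \<Longrightarrow> h \<tau> = 0"
  shows "(\<integral>\<^sup>+x. \<integral>\<^sup>+\<tau>. ennreal (h \<tau>) * ennreal (space_green \<beta> \<nu> \<tau> x) \<partial>lborel \<partial>(lborel :: 'a measure)) \<le> (\<integral>\<^sup>+\<tau>. ennreal (h \<tau>) \<partial>lborel)"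
proof -
  have "(\<integral>\<^sup>+x. \<integral>\<^sup>+\<tau>. ennreal (h \<tau>) * ennreal (space_green \<beta> \<nu> \<tau> x) \<partial>lborel \<partial>(lborel :: 'a measure)) =
    (\<integral>\<^sup>+\<tau>. \<integral>\<^sup>+x. ennreal (h \<tau>) * ennreal (space_green \<beta> \<nu> \<tau> x) \<partial>(lborel :: 'a measure) \<partial>lborel)"
    by (rule lborel_pair.Fubini') measurable
  also have "\<dots> = (\<integral>\<^sup>+\<tau>. ennreal (h \<tau>) * (\<integral>\<^sup>+x. ennreal (space_green \<beta> \<nu> \<tau> x) \<partial>(lborel :: 'a measure)) \<partial>lborel)"
    by (intro nn_integral_cong nn_integral_cmult) measurable
  also have "\<dots> \<le> (\<integral>\<^sup>+\<tau>. ennreal (h \<tau>) * 1 \<partial>lborel)"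
  proof (rule nn_integral_mono)
    fix \<tau> :: real
    show "ennreal (h \<tau>) * (\<integral>\<^sup>+x. ennreal (space_green \<beta> \<nu> \<tau> x) \<partial>(lborel :: 'a measure)) \<le> ennreal (h \<tau>) * 1"
    proof (cases "0 < \<tau>")
      case True
      show ?thesis by (rule mult_left_mono[OF green_mass[OF True]]) simp
    qed (simp add: h)
  qed
  finally show ?thesis by simp
qed

lemma sub_kernel_nn_measurable[measurable (raw)]:
  assumes [measurable]: "f \<in> borel_measurable M" "g \<in> borel_measurable M"
  shows "(\<lambda>w. sub_kernel_nn (f w) (g w)) \<in> borel_measurable M"
  unfolding sub_kernel_nn_def by measurable

lemma sub_kernel_measurable[measurable (raw)]:
  assumes [measurable]: "f \<in> borel_measurable M" "g \<in> borel_measurable M"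
  shows "(\<lambda>w. sub_kernel (f w) (g w)) \<in> borel_measurable M"
  unfolding sub_kernel_def by measurable

lemma nn_integral_sub_kernel_nn_le:
  "\<exists>K>0. \<forall>t>0. (\<integral>\<^sup>+x. sub_kernel_nn t x \<partial>lborel) \<le> ennreal (K * t powr (\<alpha> - 1))"
proof -
  obtain C where C: "0 < C" "\<And>t \<tau>. 0 < t \<Longrightarrow> time_density t \<tau> \<le> C * time_bound (1 / t) \<tau>" using time_density_le by auto
  have "(\<integral>\<^sup>+x. sub_kernel_nn t x \<partial>lborel) \<le> ennreal (C * (1 + 1 / (1 / \<alpha> - 1)) * t powr (\<alpha> - 1))" if t: "0 < t" for t
  proof -
    have "(\<integral>\<^sup>+x. sub_kernel_nn t x \<partial>lborel) = (\<integral>\<^sup>+x. \<integral>\<^sup>+\<tau>. ennreal (time_density t \<tau>) * ennreal (space_green \<beta> \<nu> \<tau> x) \<partial>lborel \<partial>lborel)"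
      unfolding sub_kernel_nn_def by (simp add: ennreal_mult' time_density_nonneg)
    also have "\<dots> \<le> (\<integral>\<^sup>+\<tau>. ennreal (time_density t \<tau>) \<partial>lborel)"
      by (rule nn_integral_mixture_le) (auto simp: time_density_def)
    also have "\<dots> \<le> (\<integral>\<^sup>+\<tau>. ennreal C * ennreal (time_bound (1 / t) \<tau>) \<partial>lborel)"
      using C t by (intro nn_integral_mono) (simp add: ennreal_mult'[symmetric] ennreal_leI)
    also have "\<dots> = ennreal C * (\<integral>\<^sup>+\<tau>. ennreal (time_bound (1 / t) \<tau>) \<partial>lborel)"
      by (rule nn_integral_cmult) measurable
    also have "\<dots> \<le> ennreal C * ennreal ((1 + 1 / (1 / \<alpha> - 1)) * t powr (\<alpha> - 1))"
      by (intro mult_left_mono nn_integral_time_bound t) auto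
    also have "\<dots> = ennreal (C * (1 + 1 / (1 / \<alpha> - 1)) * t powr (\<alpha> - 1))"
      using C by (simp add: ennreal_mult'[symmetric] mult.assoc)
    finally show ?thesis .
  qed
  moreover have "0 < C * (1 + 1 / (1 / \<alpha> - 1))" using C \<alpha> by (intro mult_pos_pos add_pos_pos) auto
  ultimately show ?thesis by blast
qed

text \<open>The points at which the equation defining \<open>Y_kernel\<close> has a solution that is continuous in time;
  the uniform bounds in \<open>n\<close> make the exceptional null set independent of \<open>t\<close>.\<close>

definition good_point :: "'a \<Rightarrow> bool" where
  "good_point x \<longleftrightarrow> (\<forall>n. (\<integral>\<^sup>+\<tau>. ennreal (time_bound (real (Suc n)) \<tau>) * ennreal (space_green \<beta> \<nu> \<tau> x) \<partial>lborel) < \<infinity>) \<and>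
     (\<forall>n. (\<integral>\<^sup>+s. sub_kernel_nn s x * indicator {0<..real (Suc n)} s \<partial>lborel) < \<infinity>)"

text \<open>Every condition says that a function with finite integral in x is finite at x, and there
  are countably many. The second family uses that t^(\<alpha>-1) is integrable at 0.\<close>

lemma AE_good_point: "AE x in lborel. good_point x"
proof -
  have 1: "AE x in lborel. (\<integral>\<^sup>+\<tau>. ennreal (time_bound (real (Suc n)) \<tau>) * ennreal (space_green \<beta> \<nu> \<tau> x) \<partial>lborel) \<noteq> \<infinity>" for n
  proof (rule nn_integral_PInf_AE)
    have "(\<integral>\<^sup>+x. \<integral>\<^sup>+\<tau>. ennreal (time_bound (real (Suc n)) \<tau>) * ennreal (space_green \<beta> \<nu> \<tau> x) \<partial>lborel \<partial>(lborel :: 'a measure)) \<le> (\<integral>\<^sup>+\<tau>. ennreal (time_bound (real (Suc n)) \<tau>) \<partial>lborel)"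
      by (rule nn_integral_mixture_le) (auto simp: time_bound_def)
    also have "\<dots> \<le> ennreal ((1 + 1 / (1 / \<alpha> - 1)) * (1 / real (Suc n)) powr (\<alpha> - 1))"
      using nn_integral_time_bound[of "1 / real (Suc n)"] by simp
    finally show "(\<integral>\<^sup>+x. \<integral>\<^sup>+\<tau>. ennreal (time_bound (real (Suc n)) \<tau>) * ennreal (space_green \<beta> \<nu> \<tau> x) \<partial>lborel \<partial>(lborel :: 'a measure)) \<noteq> \<infinity>"
      by (auto simp: top_unique)
  qed measurable
  have 2: "AE x in lborel. (\<integral>\<^sup>+s. sub_kernel_nn s x * indicator {0<..real (Suc n)} s \<partial>lborel) \<noteq> \<infinity>" for n
  proof (rule nn_integral_PInf_AE)
    obtain K where K: "0 < K" "\<And>t. 0 < t \<Longrightarrow> (\<integral>\<^sup>+x. sub_kernel_nn t x \<partial>lborel) \<le> ennreal (K * t powr (\<alpha> - 1))"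
      using nn_integral_sub_kernel_nn_le by auto
    have "(\<integral>\<^sup>+x. \<integral>\<^sup>+s. sub_kernel_nn s x * indicator {0<..real (Suc n)} s \<partial>lborel \<partial>(lborel :: 'a measure)) =
      (\<integral>\<^sup>+s. \<integral>\<^sup>+x. sub_kernel_nn s x * indicator {0<..real (Suc n)} s \<partial>(lborel :: 'a measure) \<partial>lborel)"
      by (rule lborel_pair.Fubini') measurable
    also have "\<dots> = (\<integral>\<^sup>+s. (\<integral>\<^sup>+x. sub_kernel_nn s x \<partial>lborel) * indicator {0<..real (Suc n)} s \<partial>lborel)"
      by (intro nn_integral_cong nn_integral_multc) measurable
    also have "\<dots> \<le> (\<integral>\<^sup>+s. ennreal K * (ennreal (s powr (\<alpha> - 1)) * indicator {0..real (Suc n)} s) \<partial>lborel)"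
    proof (rule nn_integral_mono)
      fix s :: real
      show "(\<integral>\<^sup>+x. sub_kernel_nn s x \<partial>lborel) * indicator {0<..real (Suc n)} s \<le> ennreal K * (ennreal (s powr (\<alpha> - 1)) * indicator {0..real (Suc n)} s)"
        using K(2)[of s] K(1) by (cases "0 < s") (auto simp: indicator_def ennreal_mult'[symmetric])
    qed
    also have "\<dots> = ennreal K * ennreal (real (Suc n) powr (\<alpha> - 1 + 1) / (\<alpha> - 1 + 1))"
      using nn_integral_powr_from_0[of "\<alpha> - 1" "real (Suc n)"] \<alpha> by (subst nn_integral_cmult) auto
    finally show "(\<integral>\<^sup>+x. \<integral>\<^sup>+s. sub_kernel_nn s x * indicator {0<..real (Suc n)} s \<partial>lborel \<partial>(lborel :: 'a measure)) \<noteq> \<infinity>"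
      by (auto simp: top_unique ennreal_mult_eq_top_iff)
  qed measurable
  have "AE x in lborel. \<forall>n. (\<integral>\<^sup>+\<tau>. ennreal (time_bound (real (Suc n)) \<tau>) * ennreal (space_green \<beta> \<nu> \<tau> x) \<partial>lborel) \<noteq> \<infinity>"
    "AE x in lborel. \<forall>n. (\<integral>\<^sup>+s. sub_kernel_nn s x * indicator {0<..real (Suc n)} s \<partial>lborel) \<noteq> \<infinity>"
    unfolding AE_all_countable using 1 2 by blast+
  then show ?thesis
    by eventually_elim (simp add: good_point_def less_top)
qed

text \<open>By monotonicity of the envelope in its cutoff, one n > 1/t0 dominates all t \<ge> t0.
  Integrability, continuity in time and boundedness away from t = 0 follow from this
  majorant.\<close>

lemma good_point_bound:
  assumes x: "good_point x" and t0: "0 < t0"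
  shows "\<exists>w. integrable lborel w \<and> (\<forall>t\<ge>t0. \<forall>\<tau>. time_density t \<tau> * space_green \<beta> \<nu> \<tau> x \<le> w \<tau>)"
proof -
  obtain C where C: "0 < C" "\<And>t \<tau>. 0 < t \<Longrightarrow> time_density t \<tau> \<le> C * time_bound (1 / t) \<tau>" using time_density_le by auto
  obtain n :: nat where n: "1 / t0 < real n" using reals_Archimedean2 by blast
  define w where "w \<tau> = C * (time_bound (real (Suc n)) \<tau> * space_green \<beta> \<nu> \<tau> x)" for \<tau>
  have tb: "0 \<le> time_bound (real (Suc n)) \<tau> * space_green \<beta> \<nu> \<tau> x" for \<tau>
    using green_nonneg[of \<tau> x] by (cases "0 < \<tau>") (auto simp: time_bound_def)
  have tb0: "0 \<le> time_bound (real (Suc n)) \<tau>" for \<tau> by (simp add: time_bound_def)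
  have "integrable lborel (\<lambda>\<tau>. time_bound (real (Suc n)) \<tau> * space_green \<beta> \<nu> \<tau> x)"
  proof (rule integrableI_nonneg)
    show "(\<integral>\<^sup>+\<tau>. ennreal (time_bound (real (Suc n)) \<tau> * space_green \<beta> \<nu> \<tau> x) \<partial>lborel) < \<infinity>"
      using x tb0 unfolding good_point_def by (simp only: ennreal_mult')
  qed (use tb in auto)
  then have "integrable lborel w" unfolding w_def by simp
  moreover have "time_density t \<tau> * space_green \<beta> \<nu> \<tau> x \<le> w \<tau>" if t: "t0 \<le> t" for t \<tau>
  proof (cases "0 < \<tau>")
    case True
    have "1 / t \<le> 1 / t0" using t t0 by (simp add: frac_le)
    then have "1 / t \<le> real (Suc n)" using n by simp
    then have "time_bound (1 / t) \<tau> \<le> time_bound (real (Suc n)) \<tau>" unfolding time_bound_def by (intro mult_left_mono min.mono) auto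
    then have "time_density t \<tau> \<le> C * time_bound (real (Suc n)) \<tau>"
      using C(2)[of t \<tau>] C(1) t t0 by (meson less_le_trans mult_left_mono less_imp_le order_trans)
    then show ?thesis unfolding w_def using green_nonneg[OF True, of x]
      by (simp add: mult.assoc[symmetric] mult_right_mono)
  next
    case False
    then show ?thesis by (simp add: w_def time_density_def time_bound_def)
  qed
  ultimately show ?thesis by blast
qed

lemma good_point_integrable:
  assumes x: "good_point x" and t: "0 < t"
  shows "integrable lborel (\<lambda>\<tau>. time_density t \<tau> * space_green \<beta> \<nu> \<tau> x)"
proof -
  obtain w where w: "integrable lborel w" "\<And>s \<tau>. t \<le> s \<Longrightarrow> time_density s \<tau> * space_green \<beta> \<nu> \<tau> x \<le> w \<tau>"
    using good_point_bound[OF x t] by auto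
  show ?thesis
  proof (rule Bochner_Integration.integrable_bound[OF w(1)])
    show "AE \<tau> in lborel. norm (time_density t \<tau> * space_green \<beta> \<nu> \<tau> x) \<le> norm (w \<tau>)"
      using w(2)[of t] time_density_green_nonneg[of t _ x] by (intro AE_I2) (simp add: order_trans[OF _ abs_ge_self])
  qed measurable
qed

lemma ennreal_sub_kernel:
  assumes x: "good_point x" and t: "0 < t"
  shows "ennreal (sub_kernel t x) = sub_kernel_nn t x"
  unfolding sub_kernel_def sub_kernel_nn_def using good_point_integrable[OF assms] t
  by (subst nn_integral_eq_integral) (auto simp: time_density_green_nonneg)

lemma sub_kernel_nonneg: "0 \<le> sub_kernel t x"
  unfolding sub_kernel_def by (auto intro!: Bochner_Integration.integral_nonneg simp: time_density_green_nonneg)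

lemma continuous_on_sub_kernel:
  assumes x: "good_point x"
  shows "continuous_on {0<..} (\<lambda>t. sub_kernel t x)"
proof -
  have "isCont (\<lambda>t. LINT \<tau>|lborel. time_density t \<tau> * space_green \<beta> \<nu> \<tau> x) t0" if t0: "0 < t0" for t0
    unfolding isCont_def
  proof -
    have "0 < t0 / 2" using t0 by simp
    then obtain w where w: "integrable lborel w" "\<And>s \<tau>. t0 / 2 \<le> s \<Longrightarrow> time_density s \<tau> * space_green \<beta> \<nu> \<tau> x \<le> w \<tau>"
      using good_point_bound[OF x] by metis
    show "((\<lambda>t. LINT \<tau>|lborel. time_density t \<tau> * space_green \<beta> \<nu> \<tau> x) \<longlongrightarrow> (LINT \<tau>|lborel. time_density t0 \<tau> * space_green \<beta> \<nu> \<tau> x)) (at t0)"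
    proof (rule tendsto_integral_dominated[OF _ _ w(1)])
      have "\<forall>\<^sub>F s in at t0. t0 / 2 \<le> s"
        using order_tendstoD(1)[OF tendsto_ident_at[of t0 UNIV], of "t0 / 2"] t0 by (auto elim: eventually_mono)
      then show "\<forall>\<^sub>F s in at t0. AE \<tau> in lborel. \<bar>time_density s \<tau> * space_green \<beta> \<nu> \<tau> x\<bar> \<le> w \<tau>"
        by eventually_elim (use w(2) time_density_green_nonneg in \<open>auto intro!: AE_I2 simp: abs_of_nonneg\<close>)
      have cp: "isCont (stable_pdf \<alpha>) r" if "0 < r" for r
        using continuous_on_stable_pdf[OF \<alpha>] that by (simp add: continuous_on_eq_continuous_at)
      have "((\<lambda>t. time_density t \<tau> * space_green \<beta> \<nu> \<tau> x) \<longlongrightarrow> time_density t0 \<tau> * space_green \<beta> \<nu> \<tau> x) (at t0)" for \<tau>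
      proof (cases "0 < \<tau>")
        case True
        have "isCont (\<lambda>t. stable_pdf \<alpha> (t * \<tau> powr (- 1 / \<alpha>))) t0"
          by (rule isCont_o2[OF _ cp]) (use True t0 in auto)
        then show ?thesis unfolding isCont_def time_density_def by (intro tendsto_intros)
      qed (simp add: time_density_def)
      then show "AE \<tau> in lborel. ((\<lambda>t. time_density t \<tau> * space_green \<beta> \<nu> \<tau> x) \<longlongrightarrow> time_density t0 \<tau> * space_green \<beta> \<nu> \<tau> x) (at t0)"
        by simp
    qed measurable
  qed
  then have "continuous_on {0<..} (\<lambda>t. LINT \<tau>|lborel. time_density t \<tau> * space_green \<beta> \<nu> \<tau> x)"
    by (intro continuous_at_imp_continuous_on) auto
  then show ?thesis by (rule continuous_on_eq) (auto simp: sub_kernel_def)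
qed

text \<open>With c = \<tau>^(-1/\<alpha>) the substitution s = r/c reduces the integral to the
  convolution identity for p at T c; the leftover powers combine to c^(1+\<alpha>) =
  \<tau>^(-1-1/\<alpha>).\<close>

lemma nn_integral_rl_kernel_time_density:
  assumes T: "0 < T" and \<tau>: "0 < \<tau>"
  shows "(\<integral>\<^sup>+s. ennreal (rl_kernel (1 - \<alpha>) (T - s)) * indicator {0<..<T} s * ennreal (time_density s \<tau>) \<partial>lborel) =
    ennreal (T / \<alpha> * \<tau> powr (- 1 - 1 / \<alpha>) * stable_pdf \<alpha> (T * \<tau> powr (- 1 / \<alpha>)))"
proof -
  define c where "c = \<tau> powr (- 1 / \<alpha>)"
  have c: "0 < c" using \<tau> by (simp add: c_def)
  note rl = rl_kernel_nonneg[of "1 - \<alpha>"]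
  have "(\<integral>\<^sup>+s. ennreal (rl_kernel (1 - \<alpha>) (T - s)) * indicator {0<..<T} s * ennreal (time_density s \<tau>) \<partial>lborel) =
    ennreal \<bar>1 / c\<bar> * (\<integral>\<^sup>+r. ennreal (rl_kernel (1 - \<alpha>) (T - (0 + 1 / c * r))) * indicator {0<..<T} (0 + 1 / c * r) * ennreal (time_density (0 + 1 / c * r) \<tau>) \<partial>lborel)"
    using c by (intro nn_integral_real_affine) (auto simp: rl_kernel_def)
  also have "\<dots> = (\<integral>\<^sup>+r. ennreal (c powr \<alpha>) * (ennreal (rl_kernel (1 - \<alpha>) (T * c - r) * stable_pdf \<alpha> r) * indicator {0<..<T * c} r) \<partial>lborel)"
  proof (subst nn_integral_cmult[symmetric], simp add: rl_kernel_def, rule nn_integral_cong)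
    fix r :: real
    show "ennreal \<bar>1 / c\<bar> * (ennreal (rl_kernel (1 - \<alpha>) (T - (0 + 1 / c * r))) * indicator {0<..<T} (0 + 1 / c * r) * ennreal (time_density (0 + 1 / c * r) \<tau>)) =
      ennreal (c powr \<alpha>) * (ennreal (rl_kernel (1 - \<alpha>) (T * c - r) * stable_pdf \<alpha> r) * indicator {0<..<T * c} r)"
    proof (cases "0 < r \<and> r < T * c")
      case True
      have m: "0 + 1 / c * r \<in> {0<..<T}" using True c by (simp add: field_simps)
      have e: "T - (0 + 1 / c * r) = (T * c - r) / c" using c by (simp add: field_simps)
      have "(T * c - r) powr (- \<alpha>) = (T - (0 + 1 / c * r)) powr (- \<alpha>) * c powr (- \<alpha>)"
        unfolding e using True c by (simp add: powr_mult[symmetric])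
      then have k: "rl_kernel (1 - \<alpha>) (T - (0 + 1 / c * r)) = c powr \<alpha> * rl_kernel (1 - \<alpha>) (T * c - r)"
        using c by (simp add: rl_kernel_def powr_minus field_simps)
      have d: "time_density (0 + 1 / c * r) \<tau> = c * stable_pdf \<alpha> r"
        unfolding time_density_def c_def[symmetric] using \<tau> c by simp
      have i: "indicator {0<..<T} (0 + 1 / c * r) = (1::ennreal)" "indicator {0<..<T * c} r = (1::ennreal)" using m True by auto
      have "ennreal \<bar>1 / c\<bar> * (ennreal (c powr \<alpha> * rl_kernel (1 - \<alpha>) (T * c - r)) * ennreal (c * stable_pdf \<alpha> r)) =
        ennreal (1 / c * (c powr \<alpha> * rl_kernel (1 - \<alpha>) (T * c - r) * (c * stable_pdf \<alpha> r)))"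
        using c rl[of "T * c - r"] \<alpha> pdf_ge_0[of r] by (simp add: ennreal_mult[symmetric])
      also have "1 / c * (c powr \<alpha> * rl_kernel (1 - \<alpha>) (T * c - r) * (c * stable_pdf \<alpha> r)) = c powr \<alpha> * (rl_kernel (1 - \<alpha>) (T * c - r) * stable_pdf \<alpha> r)"
        using c by simp
      finally show ?thesis unfolding k d i using c rl[of "T * c - r"] \<alpha> pdf_ge_0[of r] by (simp add: ennreal_mult)
    next
      case False
      have "0 + 1 / c * r \<notin> {0<..<T}" using False c by (simp add: field_simps zero_less_divide_iff)
      then have "indicator {0<..<T} (0 + 1 / c * r) = (0::ennreal)" "indicator {0<..<T * c} r = (0::ennreal)" using False by (simp_all only: indicator_eq_0_iff greaterThanLessThan_iff not_False_eq_True)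
      then show ?thesis by simp
    qed
  qed
  also have "\<dots> = ennreal (c powr \<alpha>) * ennreal (T * c / \<alpha> * stable_pdf \<alpha> (T * c))"
    using nn_integral_rl_kernel_stable_pdf[OF \<alpha>, of "T * c"] T c
    by (subst nn_integral_cmult) (auto simp: rl_kernel_def)
  also have "\<dots> = ennreal (T / \<alpha> * (c * c powr \<alpha>) * stable_pdf \<alpha> (T * c))"
    by (simp add: ennreal_mult'[symmetric] mult_ac)
  also have "c * c powr \<alpha> = \<tau> powr (- 1 - 1 / \<alpha>)"
  proof -
    have "c * c powr \<alpha> = c powr (1 + \<alpha>)" using c by (simp add: powr_mult_base)
    also have "\<dots> = \<tau> powr (- 1 / \<alpha> * (1 + \<alpha>))" unfolding c_def by (rule powr_powr)
    also have "- 1 / \<alpha> * (1 + \<alpha>) = - 1 - 1 / \<alpha>" using \<alpha> by (simp add: field_simps)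
    finally show ?thesis .
  qed
  finally show ?thesis by (simp add: c_def)
qed

section \<open>The kernel Z and the Abel equation for Y\<close>

definition Z_nn :: "real \<Rightarrow> 'a \<Rightarrow> ennreal" where
  "Z_nn t x = (\<integral>\<^sup>+s. ennreal (indicator {0<..} s * (1 / \<alpha> * (s powr (- 1 - 1 / \<alpha>) * stable_pdf \<alpha> (s powr (- 1 / \<alpha>))))) * ennreal (space_green \<beta> \<nu> (t powr \<alpha> * s) x) \<partial>lborel)"

lemma Z_integrand_nonneg:
  "0 < t \<Longrightarrow> 0 \<le> indicator {0<..} s * (space_green \<beta> \<nu> (t powr \<alpha> * s) x * s powr (- 1 - 1 / \<alpha>) * stable_density \<alpha> 1 (s powr (- 1 / \<alpha>)))"
  using green_nonneg[of "t powr \<alpha> * s" x] pdf_ge_0 by (auto simp: stable_density_eq[OF \<alpha>] indicator_def)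

lemma Z_nn_eq:
  assumes t: "0 < t"
  shows "Z_nn t x = ennreal (1 / \<alpha>) * (\<integral>\<^sup>+s. ennreal (indicator {0<..} s * (space_green \<beta> \<nu> (t powr \<alpha> * s) x * s powr (- 1 - 1 / \<alpha>) * stable_density \<alpha> 1 (s powr (- 1 / \<alpha>)))) \<partial>lborel)"
proof -
  have "Z_nn t x = (\<integral>\<^sup>+s. ennreal (1 / \<alpha>) * ennreal (indicator {0<..} s * (space_green \<beta> \<nu> (t powr \<alpha> * s) x * s powr (- 1 - 1 / \<alpha>) * stable_density \<alpha> 1 (s powr (- 1 / \<alpha>)))) \<partial>lborel)"
    unfolding Z_nn_def
  proof (rule nn_integral_cong)
    fix s :: real
    show "ennreal (indicator {0<..} s * (1 / \<alpha> * (s powr (- 1 - 1 / \<alpha>) * stable_pdf \<alpha> (s powr (- 1 / \<alpha>))))) * ennreal (space_green \<beta> \<nu> (t powr \<alpha> * s) x) =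
      ennreal (1 / \<alpha>) * ennreal (indicator {0<..} s * (space_green \<beta> \<nu> (t powr \<alpha> * s) x * s powr (- 1 - 1 / \<alpha>) * stable_density \<alpha> 1 (s powr (- 1 / \<alpha>))))"
      using \<alpha> t pdf_ge_0[of "s powr (- 1 / \<alpha>)"] green_nonneg[of "t powr \<alpha> * s" x]
      by (cases "0 < s") (auto simp: stable_density_eq[OF \<alpha>] ennreal_mult[symmetric] mult_ac)
  qed
  then show ?thesis by (simp add: nn_integral_cmult stable_density_eq[OF \<alpha>])
qed

lemma Z_kernel_alt:
  "Z_kernel \<alpha> \<beta> \<nu> t x = 1 / \<alpha> * (LINT s|lborel. indicator {0<..} s * (space_green \<beta> \<nu> (t powr \<alpha> * s) x * s powr (- 1 - 1 / \<alpha>) * stable_density \<alpha> 1 (s powr (- 1 / \<alpha>))))"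
  by (simp add: Z_kernel_def set_lebesgue_integral_def)

text \<open>Holds at every x: where the defining integral diverges, the Bochner integral defaults to
  0.\<close>

lemma Z_kernel_le: 
  assumes t: "0 < t"
  shows "ennreal (Z_kernel \<alpha> \<beta> \<nu> t x) \<le> Z_nn t x"
proof (cases "integrable lborel (\<lambda>s. indicator {0<..} s * (space_green \<beta> \<nu> (t powr \<alpha> * s) x * s powr (- 1 - 1 / \<alpha>) * stable_density \<alpha> 1 (s powr (- 1 / \<alpha>))))")
  case True
  show ?thesis unfolding Z_nn_eq[OF t] Z_kernel_alt nn_integral_eq_integral[OF True AE_I2[OF Z_integrand_nonneg[OF t]]]
    by (subst ennreal_mult') (use \<alpha> in simp_all)
qed (simp add: Z_kernel_alt not_integrable_integral_eq)

lemma Z_kernel_eq: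
  assumes t: "0 < t" and fin: "Z_nn t x < \<infinity>"
  shows "0 \<le> Z_kernel \<alpha> \<beta> \<nu> t x" "ennreal (Z_kernel \<alpha> \<beta> \<nu> t x) = Z_nn t x"
proof -
  let ?f = "\<lambda>s. indicator {0<..} s * (space_green \<beta> \<nu> (t powr \<alpha> * s) x * s powr (- 1 - 1 / \<alpha>) * stable_density \<alpha> 1 (s powr (- 1 / \<alpha>)))"
  have "integrable lborel ?f"
  proof (rule integrableI_nonneg)
    show "(\<integral>\<^sup>+s. ennreal (?f s) \<partial>lborel) < \<infinity>"
      using fin \<alpha> unfolding Z_nn_eq[OF t] by (auto simp: ennreal_mult_less_top)
    show "?f \<in> borel_measurable lborel" unfolding stable_density_eq[OF \<alpha>] by measurable
  qed (intro AE_I2 Z_integrand_nonneg t)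
  then have eq: "(\<integral>\<^sup>+s. ennreal (?f s) \<partial>lborel) = ennreal (LINT s|lborel. ?f s)"
    by (intro nn_integral_eq_integral AE_I2 Z_integrand_nonneg t)
  show "ennreal (Z_kernel \<alpha> \<beta> \<nu> t x) = Z_nn t x"
    unfolding Z_nn_eq[OF t] Z_kernel_alt eq by (subst ennreal_mult') (use \<alpha> in simp_all)
  show "0 \<le> Z_kernel \<alpha> \<beta> \<nu> t x"
    unfolding Z_kernel_alt using \<alpha> by (intro mult_nonneg_nonneg Bochner_Integration.integral_nonneg Z_integrand_nonneg t) auto
qed

text \<open>After exchanging integrals, the convolution in time acts on \<open>time_density\<close>
  alone. The substitution \<tau> = t^\<alpha> s then produces the integral that defines Z, as an
  identity in [0, \<infinity>].\<close>

lemma Z_nn_conv: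
  assumes t: "0 < t"
  shows "(\<integral>\<^sup>+s. ennreal (rl_kernel (1 - \<alpha>) (t - s)) * indicator {0<..<t} s * sub_kernel_nn s x \<partial>lborel) = Z_nn t x"
proof -
  have "(\<integral>\<^sup>+s. ennreal (rl_kernel (1 - \<alpha>) (t - s)) * indicator {0<..<t} s * sub_kernel_nn s x \<partial>lborel) =
    (\<integral>\<^sup>+s. \<integral>\<^sup>+\<tau>. ennreal (rl_kernel (1 - \<alpha>) (t - s)) * indicator {0<..<t} s * ennreal (time_density s \<tau> * space_green \<beta> \<nu> \<tau> x) \<partial>lborel \<partial>lborel)"
    unfolding sub_kernel_nn_def by (intro nn_integral_cong nn_integral_cmult[symmetric]) measurable
  also have "\<dots> = (\<integral>\<^sup>+\<tau>. \<integral>\<^sup>+s. ennreal (rl_kernel (1 - \<alpha>) (t - s)) * indicator {0<..<t} s * ennreal (time_density s \<tau> * space_green \<beta> \<nu> \<tau> x) \<partial>lborel \<partial>lborel)"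
    by (rule lborel_pair.Fubini') measurable
  also have "\<dots> = (\<integral>\<^sup>+\<tau>. ennreal (indicator {0<..} \<tau> * (t / \<alpha> * \<tau> powr (- 1 - 1 / \<alpha>) * stable_pdf \<alpha> (t * \<tau> powr (- 1 / \<alpha>)))) * ennreal (space_green \<beta> \<nu> \<tau> x) \<partial>lborel)"
  proof (rule nn_integral_cong)
    fix \<tau> :: real
    show "(\<integral>\<^sup>+s. ennreal (rl_kernel (1 - \<alpha>) (t - s)) * indicator {0<..<t} s * ennreal (time_density s \<tau> * space_green \<beta> \<nu> \<tau> x) \<partial>lborel) =
      ennreal (indicator {0<..} \<tau> * (t / \<alpha> * \<tau> powr (- 1 - 1 / \<alpha>) * stable_pdf \<alpha> (t * \<tau> powr (- 1 / \<alpha>)))) * ennreal (space_green \<beta> \<nu> \<tau> x)"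
    proof (cases "0 < \<tau>")
      case True
      have "(\<integral>\<^sup>+s. ennreal (rl_kernel (1 - \<alpha>) (t - s)) * indicator {0<..<t} s * ennreal (time_density s \<tau> * space_green \<beta> \<nu> \<tau> x) \<partial>lborel) =
        (\<integral>\<^sup>+s. ennreal (rl_kernel (1 - \<alpha>) (t - s)) * indicator {0<..<t} s * ennreal (time_density s \<tau>) * ennreal (space_green \<beta> \<nu> \<tau> x) \<partial>lborel)"
        by (simp add: ennreal_mult' time_density_nonneg mult.assoc)
      also have "\<dots> = (\<integral>\<^sup>+s. ennreal (rl_kernel (1 - \<alpha>) (t - s)) * indicator {0<..<t} s * ennreal (time_density s \<tau>) \<partial>lborel) * ennreal (space_green \<beta> \<nu> \<tau> x)"
        by (rule nn_integral_multc) measurable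
      finally show ?thesis unfolding nn_integral_rl_kernel_time_density[OF t True] using True by simp
    qed (simp add: time_density_def)
  qed
  also have "\<dots> = ennreal \<bar>t powr \<alpha>\<bar> * (\<integral>\<^sup>+s. ennreal (indicator {0<..} (0 + t powr \<alpha> * s) * (t / \<alpha> * (0 + t powr \<alpha> * s) powr (- 1 - 1 / \<alpha>) * stable_pdf \<alpha> (t * (0 + t powr \<alpha> * s) powr (- 1 / \<alpha>)))) * ennreal (space_green \<beta> \<nu> (0 + t powr \<alpha> * s) x) \<partial>lborel)"
    using t by (intro nn_integral_real_affine) auto
  also have "\<dots> = Z_nn t x" unfolding Z_nn_def
  proof (subst nn_integral_cmult[symmetric], simp, rule nn_integral_cong)
    fix s :: real
    show "ennreal \<bar>t powr \<alpha>\<bar> * (ennreal (indicator {0<..} (0 + t powr \<alpha> * s) * (t / \<alpha> * (0 + t powr \<alpha> * s) powr (- 1 - 1 / \<alpha>) * stable_pdf \<alpha> (t * (0 + t powr \<alpha> * s) powr (- 1 / \<alpha>)))) * ennreal (space_green \<beta> \<nu> (0 + t powr \<alpha> * s) x)) =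
      ennreal (indicator {0<..} s * (1 / \<alpha> * (s powr (- 1 - 1 / \<alpha>) * stable_pdf \<alpha> (s powr (- 1 / \<alpha>))))) * ennreal (space_green \<beta> \<nu> (t powr \<alpha> * s) x)"
    proof (cases "0 < s")
      case True
      have 1: "(t powr \<alpha> * s) powr (- 1 / \<alpha>) = s powr (- 1 / \<alpha>) / t"
        using True t \<alpha> by (simp add: powr_mult powr_powr powr_minus_divide)
      have 2: "(t powr \<alpha> * s) powr (- 1 - 1 / \<alpha>) = s powr (- 1 - 1 / \<alpha>) / (t * t powr \<alpha>)"
      proof -
        have "\<alpha> * (- 1 - 1 / \<alpha>) = - (1 + \<alpha>)" using \<alpha> by (simp add: field_simps)
        then have "(t powr \<alpha>) powr (- 1 - 1 / \<alpha>) = t powr (- (1 + \<alpha>))" by (simp only: powr_powr)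
        also have "\<dots> = 1 / t powr (1 + \<alpha>)" by (rule powr_minus_divide)
        also have "t powr (1 + \<alpha>) = t * t powr \<alpha>" using t by (simp add: powr_mult_base)
        finally show ?thesis using True t by (simp add: powr_mult)
      qed
      let ?X = "t / \<alpha> * (t powr \<alpha> * s) powr (- 1 - 1 / \<alpha>) * stable_pdf \<alpha> (t * (t powr \<alpha> * s) powr (- 1 / \<alpha>))"
      have e: "t powr \<alpha> * ?X = 1 / \<alpha> * (s powr (- 1 - 1 / \<alpha>) * stable_pdf \<alpha> (s powr (- 1 / \<alpha>)))"
        unfolding 1 2 using t by simp
      have i: "indicator {0<..} (t powr \<alpha> * s) = (1::real)" "indicator {0<..} s = (1::real)"
        using True t by auto
      have "ennreal \<bar>t powr \<alpha>\<bar> * (ennreal ?X * ennreal (space_green \<beta> \<nu> (t powr \<alpha> * s) x)) =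
        ennreal (\<bar>t powr \<alpha>\<bar> * ?X) * ennreal (space_green \<beta> \<nu> (t powr \<alpha> * s) x)"
        by (subst ennreal_mult'[of "\<bar>t powr \<alpha>\<bar>"], simp, rule mult.assoc[symmetric])
      also have "\<bar>t powr \<alpha>\<bar> * ?X = 1 / \<alpha> * (s powr (- 1 - 1 / \<alpha>) * stable_pdf \<alpha> (s powr (- 1 / \<alpha>)))"
        unfolding e[symmetric] by simp
      finally show ?thesis unfolding add_0 i mult_1 .
    next
      case False
      have "\<not> 0 < 0 + t powr \<alpha> * s" using False t by (simp add: zero_less_mult_iff)
      then show ?thesis using False by simp
    qed
  qed
  finally show ?thesis .
qed

text \<open>Split the convolution at t/2. For s \<le> t/2 the fractional kernel is bounded and the
  mixture is integrable in time; for s > t/2 the mixture is bounded and the kernel is integrable.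
  The two clauses of \<open>good_point\<close> provide exactly this.\<close>

lemma good_point_Z_nn_finite:
  assumes x: "good_point x" and t: "0 < t"
  shows "Z_nn t x < \<infinity>"
proof -
  have G: "0 < Gamma (1 - \<alpha>)" using \<alpha> by (intro Gamma_real_pos) simp
  have "0 < t / 2" using t by simp
  then obtain w where w: "integrable lborel w" "\<And>s \<tau>. t / 2 \<le> s \<Longrightarrow> time_density s \<tau> * space_green \<beta> \<nu> \<tau> x \<le> w \<tau>"
    using good_point_bound[OF x] by metis
  define B where "B = (\<integral>\<^sup>+\<tau>. ennreal (w \<tau>) \<partial>lborel)"
  have B: "B < \<infinity>" unfolding B_def using w(1) by (simp add: integrable_iff_bounded) (meson ennreal_leI abs_ge_self le_less_trans nn_integral_mono)
  have sB: "sub_kernel_nn s x \<le> B" if "t / 2 \<le> s" for s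
    unfolding sub_kernel_nn_def B_def using w(2) that by (intro nn_integral_mono ennreal_leI) auto
  obtain n :: nat where n: "t < real n" using reals_Archimedean2 by blast
  have "Z_nn t x \<le> (\<integral>\<^sup>+s. ennreal ((t / 2) powr (- \<alpha>) / Gamma (1 - \<alpha>)) * (sub_kernel_nn s x * indicator {0<..real (Suc n)} s) + B * (ennreal (rl_kernel (1 - \<alpha>) (t - s)) * indicator {0..t} (t - s)) \<partial>lborel)"
    unfolding Z_nn_conv[OF t, symmetric]
  proof (rule nn_integral_mono)
    fix s :: real
    show "ennreal (rl_kernel (1 - \<alpha>) (t - s)) * indicator {0<..<t} s * sub_kernel_nn s x \<le> ennreal ((t / 2) powr (- \<alpha>) / Gamma (1 - \<alpha>)) * (sub_kernel_nn s x * indicator {0<..real (Suc n)} s) + B * (ennreal (rl_kernel (1 - \<alpha>) (t - s)) * indicator {0..t} (t - s))"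
    proof (cases "0 < s \<and> s < t")
      case True
      show ?thesis
      proof (cases "s \<le> t / 2")
        case s: True
        have "(t - s) powr (- \<alpha>) \<le> (t / 2) powr (- \<alpha>)" using s t \<alpha> by (intro powr_mono2') auto
        then have "rl_kernel (1 - \<alpha>) (t - s) \<le> (t / 2) powr (- \<alpha>) / Gamma (1 - \<alpha>)"
          using G by (simp add: rl_kernel_def divide_right_mono)
        then show ?thesis using True n by (intro add_increasing2) (auto intro: mult_right_mono ennreal_leI)
      next
        case s: False
        then show ?thesis using sB[of s] True by (intro add_increasing) (auto simp: mult.commute[of B] intro: mult_left_mono)
      qed
    qed simp
  qed
  also have "\<dots> = ennreal ((t / 2) powr (- \<alpha>) / Gamma (1 - \<alpha>)) * (\<integral>\<^sup>+s. sub_kernel_nn s x * indicator {0<..real (Suc n)} s \<partial>lborel)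
     + B * (\<integral>\<^sup>+s. ennreal (rl_kernel (1 - \<alpha>) (t - s)) * indicator {0..t} (t - s) \<partial>lborel)"
    by (subst nn_integral_add) (auto simp: nn_integral_cmult)
  also have "(\<integral>\<^sup>+s. ennreal (rl_kernel (1 - \<alpha>) (t - s)) * indicator {0..t} (t - s) \<partial>lborel) = (\<integral>\<^sup>+s. ennreal (rl_kernel (1 - \<alpha>) s) * indicator {0..t} s \<partial>lborel)"
    using nn_integral_real_affine[of "\<lambda>s. ennreal (rl_kernel (1 - \<alpha>) s) * indicator {0..t} s" "-1" t] by simp
  also have "\<dots> = ennreal (t powr (1 - \<alpha>) / (1 - \<alpha>) / Gamma (1 - \<alpha>))" using t by (intro nn_integral_rl_kernel[OF \<alpha>]) simp
  also have "ennreal ((t / 2) powr (- \<alpha>) / Gamma (1 - \<alpha>)) * (\<integral>\<^sup>+s. sub_kernel_nn s x * indicator {0<..real (Suc n)} s \<partial>lborel)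
     + B * ennreal (t powr (1 - \<alpha>) / (1 - \<alpha>) / Gamma (1 - \<alpha>)) < \<infinity>"
  proof -
    have "(\<integral>\<^sup>+s. sub_kernel_nn s x * indicator {0<..real (Suc n)} s \<partial>lborel) < \<infinity>"
      using x unfolding good_point_def by blast
    then show ?thesis using B by (simp add: ennreal_mult_less_top del: of_nat_Suc)
  qed
  finally show ?thesis .
qed

lemma sub_kernel_Abel:
  assumes x: "good_point x" and t: "0 < t"
  shows "has_bochner_integral lborel (\<lambda>s. indicator {0<..<t} s * (rl_kernel (1 - \<alpha>) (t - s) * sub_kernel s x)) (Z_kernel \<alpha> \<beta> \<nu> t x)"
proof (rule has_bochner_integral_nn_integral)
  note rl = rl_kernel_nonneg[of "1 - \<alpha>"]
  note fin = good_point_Z_nn_finite[OF x t]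
  show "(\<lambda>s. indicator {0<..<t} s * (rl_kernel (1 - \<alpha>) (t - s) * sub_kernel s x)) \<in> borel_measurable lborel" by measurable
  show "AE s in lborel. 0 \<le> indicator {0<..<t} s * (rl_kernel (1 - \<alpha>) (t - s) * sub_kernel s x)"
    using rl \<alpha> sub_kernel_nonneg by (intro AE_I2 mult_nonneg_nonneg) auto
  show "0 \<le> Z_kernel \<alpha> \<beta> \<nu> t x" by (rule Z_kernel_eq(1)[OF t fin])
  have "(\<integral>\<^sup>+s. ennreal (indicator {0<..<t} s * (rl_kernel (1 - \<alpha>) (t - s) * sub_kernel s x)) \<partial>lborel) =
    (\<integral>\<^sup>+s. ennreal (rl_kernel (1 - \<alpha>) (t - s)) * indicator {0<..<t} s * sub_kernel_nn s x \<partial>lborel)"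
  proof (rule nn_integral_cong)
    fix s :: real
    show "ennreal (indicator {0<..<t} s * (rl_kernel (1 - \<alpha>) (t - s) * sub_kernel s x)) = ennreal (rl_kernel (1 - \<alpha>) (t - s)) * indicator {0<..<t} s * sub_kernel_nn s x"
      using ennreal_sub_kernel[OF x, of s] rl[of "t - s"] \<alpha> by (auto simp: indicator_def ennreal_mult')
  qed
  then show "(\<integral>\<^sup>+s. ennreal (indicator {0<..<t} s * (rl_kernel (1 - \<alpha>) (t - s) * sub_kernel s x)) \<partial>lborel) = ennreal (Z_kernel \<alpha> \<beta> \<nu> t x)"
    unfolding Z_nn_conv[OF t] Z_kernel_eq(2)[OF t fin] .
qed

text \<open>\<open>sub_kernel_Abel\<close> gives existence in the definite description, and
  \<open>Abel_unique\<close> applied to the difference of two candidates gives uniqueness.\<close>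

lemma Y_kernel_eq:
  assumes x: "good_point x"
  shows "Y_kernel \<alpha> \<beta> \<nu> t x = sub_kernel t x"
proof -
  have "(THE y. continuous_on {0<..} y \<and> (\<forall>\<tau>\<le>0. y \<tau> = 0) \<and>
     (\<forall>\<tau>>0. has_bochner_integral lborel (\<lambda>s. indicator {0<..<\<tau>} s * (rl_kernel (1 - \<alpha>) (\<tau> - s) * y s)) (Z_kernel \<alpha> \<beta> \<nu> \<tau> x))) =
    (\<lambda>t. sub_kernel t x)"
  proof (rule the_equality)
    show "continuous_on {0<..} (\<lambda>t. sub_kernel t x) \<and> (\<forall>\<tau>\<le>0. sub_kernel \<tau> x = 0) \<and>
     (\<forall>\<tau>>0. has_bochner_integral lborel (\<lambda>s. indicator {0<..<\<tau>} s * (rl_kernel (1 - \<alpha>) (\<tau> - s) * sub_kernel s x)) (Z_kernel \<alpha> \<beta> \<nu> \<tau> x))"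
      using continuous_on_sub_kernel[OF x] sub_kernel_Abel[OF x] by (simp add: sub_kernel_def)
    fix y assume y: "continuous_on {0<..} y \<and> (\<forall>\<tau>\<le>0. y \<tau> = 0) \<and>
     (\<forall>\<tau>>0. has_bochner_integral lborel (\<lambda>s. indicator {0<..<\<tau>} s * (rl_kernel (1 - \<alpha>) (\<tau> - s) * y s)) (Z_kernel \<alpha> \<beta> \<nu> \<tau> x))"
    show "y = (\<lambda>t. sub_kernel t x)"
    proof
      fix t show "y t = sub_kernel t x"
      proof (cases "0 < t")
        case True
        have "y t - sub_kernel t x = 0"
        proof (rule Abel_unique[OF \<alpha> _ _ True])
          show "continuous_on {0<..} (\<lambda>t. y t - sub_kernel t x)"
            using y continuous_on_sub_kernel[OF x] by (intro continuous_intros) auto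
          fix \<tau> :: real assume \<tau>: "0 < \<tau>"
          have "has_bochner_integral lborel (\<lambda>s. indicator {0<..<\<tau>} s * (rl_kernel (1 - \<alpha>) (\<tau> - s) * y s) - indicator {0<..<\<tau>} s * (rl_kernel (1 - \<alpha>) (\<tau> - s) * sub_kernel s x)) (Z_kernel \<alpha> \<beta> \<nu> \<tau> x - Z_kernel \<alpha> \<beta> \<nu> \<tau> x)"
            using y \<tau> by (intro has_bochner_integral_diff sub_kernel_Abel[OF x]) auto
          then show "has_bochner_integral lborel (\<lambda>s. indicator {0<..<\<tau>} s * (rl_kernel (1 - \<alpha>) (\<tau> - s) * (y s - sub_kernel s x))) 0"
            by (simp add: algebra_simps)
        qed
        then show ?thesis by simp
      qed (use y in \<open>auto simp: sub_kernel_def\<close>)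
    qed
  qed
  then show ?thesis unfolding Y_kernel_def by simp
qed

lemma Z_kernel_measurable[measurable (raw)]:
  assumes [measurable]: "f \<in> borel_measurable M" "g \<in> borel_measurable M"
  shows "(\<lambda>w. Z_kernel \<alpha> \<beta> \<nu> (f w) (g w)) \<in> borel_measurable M"
  unfolding Z_kernel_alt stable_density_eq[OF \<alpha>] by measurable

text \<open>Every G has mass at most 1, so the mass of the mixing weight is a bound independent of
  t. Near s = 0 the decay p(s^(-1/\<alpha>)) \<le> C s^(1+1/\<alpha>) cancels the singular power; at
  infinity p is bounded and s^(-1-1/\<alpha>) is integrable.\<close>

lemma nn_integral_Z_kernel_le:
  "\<exists>K>0. \<forall>t>0. (\<integral>\<^sup>+x. ennreal (Z_kernel \<alpha> \<beta> \<nu> t x) \<partial>lborel) \<le> ennreal K"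
proof -
  obtain C where C: "0 < C" "\<And>s. 0 < s \<Longrightarrow> stable_pdf \<alpha> s \<le> C" "\<And>s. 0 < s \<Longrightarrow> stable_pdf \<alpha> s \<le> C * s powr (- (1 + \<alpha>))"
    using stable_pdf_decay[OF \<alpha>] by auto
  define h where "h s = indicator {0<..} s * (1 / \<alpha> * (s powr (- 1 - 1 / \<alpha>) * stable_pdf \<alpha> (s powr (- 1 / \<alpha>))))" for s
  have [measurable]: "h \<in> borel_measurable borel" unfolding h_def[abs_def] by measurable
  have "(\<integral>\<^sup>+s. ennreal (h s) \<partial>lborel) \<le> (\<integral>\<^sup>+s. ennreal (C / \<alpha>) * indicator {0..1} s + ennreal (C / \<alpha>) * (ennreal (s powr (- 1 - 1 / \<alpha>)) * indicator {1..} s) \<partial>lborel)"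
  proof (rule nn_integral_mono)
    fix s :: real
    show "ennreal (h s) \<le> ennreal (C / \<alpha>) * indicator {0..1} s + ennreal (C / \<alpha>) * (ennreal (s powr (- 1 - 1 / \<alpha>)) * indicator {1..} s)"
    proof (cases "0 < s")
      case True
      show ?thesis
      proof (cases "s \<le> 1")
        case s: True
        have "s powr (- 1 - 1 / \<alpha>) * stable_pdf \<alpha> (s powr (- 1 / \<alpha>)) \<le> s powr (- 1 - 1 / \<alpha>) * (C * (s powr (- 1 / \<alpha>)) powr (- (1 + \<alpha>)))"
          using True by (intro mult_left_mono C) auto
        also have "(s powr (- 1 / \<alpha>)) powr (- (1 + \<alpha>)) = s powr (1 + 1 / \<alpha>)"
        proof -
          have "- 1 / \<alpha> * (- (1 + \<alpha>)) = 1 + 1 / \<alpha>" using \<alpha> by (simp add: field_simps)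
          then show ?thesis by (simp only: powr_powr)
        qed
        also have "s powr (- 1 - 1 / \<alpha>) * (C * s powr (1 + 1 / \<alpha>)) = C * s powr ((- 1 - 1 / \<alpha>) + (1 + 1 / \<alpha>))"
          by (simp only: powr_add mult_ac)
        also have "\<dots> = C" using True by simp
        finally have "h s \<le> C / \<alpha>" using True \<alpha> by (simp add: h_def field_simps)
        then show ?thesis using True s by (intro add_increasing2) (auto intro: ennreal_leI)
      next
        case s: False
        have "s powr (- 1 - 1 / \<alpha>) * stable_pdf \<alpha> (s powr (- 1 / \<alpha>)) \<le> s powr (- 1 - 1 / \<alpha>) * C"
          using True by (intro mult_left_mono C) auto
        then have "h s \<le> C / \<alpha> * s powr (- 1 - 1 / \<alpha>)" using True \<alpha> by (simp add: h_def field_simps)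
        then show ?thesis using s C \<alpha> by (intro add_increasing) (auto simp: ennreal_mult'[symmetric] intro: ennreal_leI)
      qed
    qed (simp add: h_def)
  qed
  also have "\<dots> = ennreal (C / \<alpha>) * 1 + ennreal (C / \<alpha>) * ennreal (- (1 powr (- 1 - 1 / \<alpha> + 1) / (- 1 - 1 / \<alpha> + 1)))"
    using nn_integral_powr_to_inf[of "- 1 - 1 / \<alpha>" 1] \<alpha>
    by (subst nn_integral_add) (auto simp: nn_integral_cmult nn_integral_cmult_indicator)
  also have "\<dots> < \<infinity>" by (simp add: ennreal_mult_less_top)
  finally have fin: "(\<integral>\<^sup>+s. ennreal (h s) \<partial>lborel) < \<infinity>" .
  have le: "(\<integral>\<^sup>+x. ennreal (Z_kernel \<alpha> \<beta> \<nu> t x) \<partial>lborel) \<le> (\<integral>\<^sup>+s. ennreal (h s) \<partial>lborel)" if t: "0 < t" for t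
  proof -
    have "(\<integral>\<^sup>+x. ennreal (Z_kernel \<alpha> \<beta> \<nu> t x) \<partial>lborel) \<le> (\<integral>\<^sup>+x. Z_nn t x \<partial>lborel)"
      by (intro nn_integral_mono Z_kernel_le t)
    also have "\<dots> = (\<integral>\<^sup>+s. \<integral>\<^sup>+x. ennreal (h s) * ennreal (space_green \<beta> \<nu> (t powr \<alpha> * s) x) \<partial>(lborel :: 'a measure) \<partial>lborel)"
      unfolding Z_nn_def h_def[symmetric] by (rule lborel_pair.Fubini') measurable
    also have "\<dots> = (\<integral>\<^sup>+s. ennreal (h s) * (\<integral>\<^sup>+x. ennreal (space_green \<beta> \<nu> (t powr \<alpha> * s) x) \<partial>(lborel :: 'a measure)) \<partial>lborel)"
      by (intro nn_integral_cong nn_integral_cmult) measurable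
    also have "\<dots> \<le> (\<integral>\<^sup>+s. ennreal (h s) * 1 \<partial>lborel)"
    proof (rule nn_integral_mono)
      fix s :: real
      show "ennreal (h s) * (\<integral>\<^sup>+x. ennreal (space_green \<beta> \<nu> (t powr \<alpha> * s) x) \<partial>(lborel :: 'a measure)) \<le> ennreal (h s) * 1"
      proof (cases "0 < s")
        case True
        then show ?thesis using t by (intro mult_left_mono green_mass) auto
      qed (simp add: h_def)
    qed
    finally show ?thesis by simp
  qed
  obtain K where K: "0 \<le> K" "(\<integral>\<^sup>+s. ennreal (h s) \<partial>lborel) = ennreal K"
    using fin by (cases "\<integral>\<^sup>+s. ennreal (h s) \<partial>lborel") auto
  have "(\<integral>\<^sup>+x. ennreal (Z_kernel \<alpha> \<beta> \<nu> t x) \<partial>lborel) \<le> ennreal (K + 1)" if "0 < t" for t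
    using le[OF that] K by (auto intro: order_trans ennreal_leI)
  then show ?thesis using K(1) by (intro exI[of _ "K + 1"]) auto
qed

end

subsection \<open>Volterra equations with bounded forcing\<close>

text \<open>Take v = \<phi>_(i+1) / 2, the right end of a plateau. There the model function is
  \<phi>_(i+1) - \<phi>_i \<le> 2 v, and these v are unbounded because the sequence more than
  doubles at each step.\<close>

lemma osgood_type_linear:
  assumes f: "osgood_type k f"
  shows "\<exists>C>0. \<forall>B. \<exists>v\<ge>B. 0 < v \<and> f v \<le> C * v"
proof -
  obtain \<phi>0 c C where k: "1 < k" and p: "2 powr (1 / (k - 1)) < \<phi>0" and C: "0 < C"
    and fC: "\<And>s. 0 \<le> s \<Longrightarrow> f s \<le> C * osgood_fun k \<phi>0 s"
    using f unfolding osgood_type_def by blast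
  let ?\<phi> = "osgood_seq k \<phi>0"
  have p0: "0 < \<phi>0" using p powr_ge_zero[of 2 "1 / (k - 1)"] by linarith
  have st: "\<phi>0 \<le> ?\<phi> i" "2 * ?\<phi> i < ?\<phi> (Suc i)" for i using osgood_seq_step[OF k p] by auto
  have grow: "2 ^ i * \<phi>0 \<le> ?\<phi> i" for i
  proof (induction i)
    case (Suc i)
    then have "2 ^ Suc i * \<phi>0 \<le> 2 * ?\<phi> i" by simp
    also have "\<dots> \<le> ?\<phi> (Suc i)" using st(2)[of i] by (rule less_imp_le)
    finally show ?case .
  qed simp
  have "\<exists>v\<ge>B. 0 < v \<and> f v \<le> 2 * C * v" for B
  proof -
    obtain i where i: "B / \<phi>0 < 2 ^ i" using real_arch_pow[of 2 "B / \<phi>0"] by auto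
    let ?v = "?\<phi> (Suc i) / 2"
    have "B < 2 ^ i * \<phi>0" using i p0 by (simp add: field_simps)
    also have "\<dots> \<le> ?\<phi> i" by (rule grow)
    also have "\<dots> < ?v" using st(2)[of i] by simp
    finally have v: "B < ?v" .
    have pos: "0 < ?\<phi> i" "0 < ?v" using st(1)[of i] st(2)[of i] p0 by linarith+
    have "?v \<in> {?\<phi> i .. ?\<phi> (Suc i) / 2}" using st(2)[of i] by simp
    from osgood_fun_clauses(2)[OF k p this]
    have "osgood_fun k \<phi>0 ?v \<le> 2 * ?v" using pos by simp
    then have "C * osgood_fun k \<phi>0 ?v \<le> C * (2 * ?v)" using C by (intro mult_left_mono) auto
    then have "f ?v \<le> 2 * C * ?v" using fC[of ?v] pos by simp
    then show ?thesis using v pos by (intro exI[of _ ?v]) auto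
  qed
  then show ?thesis using C by (intro exI[of _ "2 * C"]) auto
qed

lemma nn_integral_powr_reflect:
  fixes t a c :: real
  assumes a: "0 < a" and c: "0 \<le> c"
  shows "(\<integral>\<^sup>+s. ennreal ((t - s) powr (a - 1)) * indicator {0..c} (t - s) \<partial>lborel) = ennreal (c powr a / a)"
proof -
  have "(\<integral>\<^sup>+s. ennreal ((t - s) powr (a - 1)) * indicator {0..c} (t - s) \<partial>lborel) = (\<integral>\<^sup>+s. ennreal (s powr (a - 1)) * indicator {0..c} s \<partial>lborel)"
    using nn_integral_real_affine[of "\<lambda>s. ennreal (s powr (a - 1)) * indicator {0..c} s" "-1" t] by simp
  then show ?thesis using nn_integral_powr_from_0[of "a - 1" c] assms by simp
qed

text \<open>Since \<open>f\<close> grows at most linearly along a sequence tending to infinity, a step function with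
  values in that sequence and a fixed step length is a supersolution on the whole half line.\<close>

lemma global_supersolution:
  fixes f :: "real \<Rightarrow> real"
  assumes a: "0 < a" and K: "0 < K" and A: "0 \<le> A"
    and mono: "mono_on {0..} f" and f0: "\<And>s. 0 \<le> s \<Longrightarrow> 0 \<le> f s"
    and lin: "\<exists>C>0. \<forall>B. \<exists>v\<ge>B. 0 < v \<and> f v \<le> C * v"
  shows "\<exists>V::real \<Rightarrow> real. mono_on {0..} V \<and> (\<forall>t. 0 < V t) \<and>
    (\<forall>t>0. ennreal A + (\<integral>\<^sup>+s. ennreal (K * (t - s) powr (a - 1)) * ennreal (f (V s)) * indicator {0<..<t} s \<partial>lborel) \<le> ennreal (V t))"
proof -
  obtain C where C: "0 < C" "\<And>B. \<exists>v\<ge>B. 0 < v \<and> f v \<le> C * v" using lin by auto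
  define pick where "pick B = (SOME v. B \<le> v \<and> 0 < v \<and> f v \<le> C * v)" for B
  have pick: "B \<le> pick B" "0 < pick B" "f (pick B) \<le> C * pick B" for B
    using someI_ex[OF C(2)[of B]] unfolding pick_def by auto
  \<comment> \<open>Chosen so that C K \<tau>^a / a = 1/2: since f(v) \<le> C v, the current step
    contributes at most half of its own value, whatever that value is.\<close>
  define \<tau> where "\<tau> = (a / (2 * C * K)) powr (1 / a)"
  have \<tau>: "0 < \<tau>" using a C K by (simp add: \<tau>_def)
  have \<tau>a: "\<tau> powr a = a / (2 * C * K)" using a C K by (simp add: \<tau>_def powr_powr)
  \<comment> \<open>Each new value is at least twice A plus everything the earlier steps can
    contribute. Step j + 1 ends at time (j + 2) \<tau>, which explains the index shift.\<close>
  define v where "v = rec_nat (pick (2 * A)) (\<lambda>j x. pick (max x (2 * (A + f x * (K * (real (j + 2) * \<tau>) powr a / a)))))"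
  have vS: "v (Suc j) = pick (max (v j) (2 * (A + f (v j) * (K * (real (j + 2) * \<tau>) powr a / a))))" for j by (simp add: v_def)
  have v0: "v 0 = pick (2 * A)" by (simp add: v_def)
  have vpos: "0 < v j" and vlin: "f (v j) \<le> C * v j" for j
    by (cases j; simp add: v0 vS pick)+
  have vmono: "v i \<le> v j" if "i \<le> j" for i j
    using that by (rule lift_Suc_mono_le[rotated]) (use pick(1) in \<open>auto simp: vS intro: order_trans[OF max.cobounded1]\<close>)
  define V where "V t = v (nat \<lfloor>t / \<tau>\<rfloor>)" for t
  have idx: "real (nat \<lfloor>t / \<tau>\<rfloor>) * \<tau> \<le> t \<and> t < (real (nat \<lfloor>t / \<tau>\<rfloor>) + 1) * \<tau>" if "0 \<le> t" for t
  proof -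
    have 0: "0 \<le> \<lfloor>t / \<tau>\<rfloor>" using that \<tau> by simp
    have "of_int \<lfloor>t / \<tau>\<rfloor> \<le> t / \<tau>" "t / \<tau> < of_int \<lfloor>t / \<tau>\<rfloor> + 1" by linarith+
    then have "of_int \<lfloor>t / \<tau>\<rfloor> * \<tau> \<le> t" "t < (of_int \<lfloor>t / \<tau>\<rfloor> + 1) * \<tau>"
      unfolding pos_le_divide_eq[OF \<tau>] pos_divide_less_eq[OF \<tau>] .
    then show ?thesis using 0 by simp
  qed
  have Vmono: "mono_on {0..} V"
    unfolding V_def using \<tau> by (intro mono_onI vmono nat_mono floor_mono divide_right_mono) auto
  have fmono: "f x \<le> f y" if "0 \<le> x" "x \<le> y" for x y
    using mono that by (auto simp: mono_on_def)
  have "ennreal A + (\<integral>\<^sup>+s. ennreal (K * (t - s) powr (a - 1)) * ennreal (f (V s)) * indicator {0<..<t} s \<partial>lborel) \<le> ennreal (V t)"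
    if t: "0 < t" for t
  proof -
    define j where "j = nat \<lfloor>t / \<tau>\<rfloor>"
    have j: "real j * \<tau> \<le> t" "t < (real j + 1) * \<tau>" using idx[of t] t by (auto simp: j_def)
    have Vt: "V t = v j" by (simp add: V_def j_def)
    \<comment> \<open>By monotonicity \<open>P\<close> bounds f(V s) over all steps before the
      current one; there are none when j = 0.\<close>
    define P where "P = (case j of 0 \<Rightarrow> 0 | Suc i \<Rightarrow> f (v i))"
    have P: "0 \<le> P" unfolding P_def using f0 vpos by (auto split: nat.split intro: less_imp_le)
    have fj: "0 \<le> f (v j)" using f0 vpos by (simp add: less_imp_le)
    have half: "A + P * (K * t powr a / a) \<le> v j / 2"
    proof (cases j)
      case 0
      then show ?thesis using pick(1)[of "2 * A"] by (simp add: P_def v0)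
    next
      case (Suc i)
      have "t powr a \<le> (real (i + 2) * \<tau>) powr a" using j t a Suc by (intro powr_mono2) (auto simp: algebra_simps)
      then have "f (v i) * (K * t powr a / a) \<le> f (v i) * (K * (real (i + 2) * \<tau>) powr a / a)"
        using K a f0[of "v i"] vpos[of i] by (intro mult_left_mono divide_right_mono) auto
      then have "A + P * (K * t powr a / a) \<le> A + f (v i) * (K * (real (i + 2) * \<tau>) powr a / a)"
        by (simp add: P_def Suc)
      also have "2 * (A + f (v i) * (K * (real (i + 2) * \<tau>) powr a / a)) \<le> v j"
        unfolding Suc vS by (rule order_trans[OF max.cobounded2 pick(1)])
      then have "A + f (v i) * (K * (real (i + 2) * \<tau>) powr a / a) \<le> v j / 2" by (simp only: le_divide_eq_numeral1(1)) (simp only: mult.commute)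
      finally show ?thesis .
    qed
    have "f (v j) * (K * \<tau> powr a / a) \<le> C * v j * (K * \<tau> powr a / a)"
      using vlin K a by (intro mult_right_mono) auto
    also have "\<dots> = v j / 2" unfolding \<tau>a using C K a by (simp add: field_simps)
    finally have half': "f (v j) * (K * \<tau> powr a / a) \<le> v j / 2" .
    \<comment> \<open>Earlier steps are bounded by \<open>P\<close> on all of (0, t). A time s in
      the current step satisfies t - s \<le> \<tau>, so there the kernel is integrated over a length
      \<tau> only.\<close>
    have "(\<integral>\<^sup>+s. ennreal (K * (t - s) powr (a - 1)) * ennreal (f (V s)) * indicator {0<..<t} s \<partial>lborel) \<le>
      (\<integral>\<^sup>+s. ennreal (K * P) * (ennreal ((t - s) powr (a - 1)) * indicator {0..t} (t - s)) +
         ennreal (K * f (v j)) * (ennreal ((t - s) powr (a - 1)) * indicator {0..\<tau>} (t - s)) \<partial>lborel)"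
    proof (rule nn_integral_mono)
      fix s
      show "ennreal (K * (t - s) powr (a - 1)) * ennreal (f (V s)) * indicator {0<..<t} s \<le>
         ennreal (K * P) * (ennreal ((t - s) powr (a - 1)) * indicator {0..t} (t - s)) +
         ennreal (K * f (v j)) * (ennreal ((t - s) powr (a - 1)) * indicator {0..\<tau>} (t - s))"
      proof (cases "0 < s \<and> s < t")
        case True
        define i where "i = nat \<lfloor>s / \<tau>\<rfloor>"
        have i: "real i * \<tau> \<le> s" "s < (real i + 1) * \<tau>" using idx[of s] True by (auto simp: i_def)
        have Vs: "V s = v i" by (simp add: V_def i_def)
        have "real i * \<tau> < (real j + 1) * \<tau>" using i(1) j(2) True by linarith
        then have "real i < real j + 1" using \<tau> by (simp add: mult_less_cancel_right)
        then have ij: "i \<le> j" by simp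
        show ?thesis
        proof (cases "i = j")
          case True
          have "t - s \<le> \<tau>" using True i(1) j(2) by (simp add: algebra_simps)
          then show ?thesis using \<open>0 < s \<and> s < t\<close> True K fj unfolding Vs
            by (intro add_increasing) (auto simp: ennreal_mult'[symmetric] mult_ac)
        next
          case False
          then obtain j' where j': "j = Suc j'" "i \<le> j'" using ij by (cases j) auto
          have "f (v i) \<le> P" unfolding P_def j'(1) using fmono[OF less_imp_le[OF vpos] vmono[OF j'(2)]] by simp
          then have "K * (t - s) powr (a - 1) * f (v i) \<le> K * P * (t - s) powr (a - 1)"
            using K by (simp add: mult_left_mono mult_right_mono mult_ac)
          then show ?thesis using True K P f0[of "v i"] vpos[of i] unfolding Vs
            by (intro add_increasing2) (auto simp: ennreal_mult'[symmetric] intro: ennreal_leI)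
        qed
      qed simp
    qed
    also have "\<dots> = ennreal (K * P) * ennreal (t powr a / a) + ennreal (K * f (v j)) * ennreal (\<tau> powr a / a)"
      using nn_integral_powr_reflect[OF a, of t t] nn_integral_powr_reflect[OF a, of \<tau> t] t \<tau>
      by (subst nn_integral_add) (auto simp: nn_integral_cmult)
    also have "\<dots> = ennreal (P * (K * t powr a / a) + f (v j) * (K * \<tau> powr a / a))"
      using K P fj a by (simp add: ennreal_mult'[symmetric] ennreal_plus[symmetric] mult_ac del: ennreal_plus)
    finally have "ennreal A + (\<integral>\<^sup>+s. ennreal (K * (t - s) powr (a - 1)) * ennreal (f (V s)) * indicator {0<..<t} s \<partial>lborel) \<le>
      ennreal A + ennreal (P * (K * t powr a / a) + f (v j) * (K * \<tau> powr a / a))" by (rule add_left_mono)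
    also have "\<dots> = ennreal (A + (P * (K * t powr a / a) + f (v j) * (K * \<tau> powr a / a)))"
      using A K P fj a by (intro ennreal_plus[symmetric] add_nonneg_nonneg mult_nonneg_nonneg divide_nonneg_nonneg) auto
    also have "\<dots> \<le> ennreal (v j)" using half half' by (intro ennreal_leI) linarith
    finally show ?thesis unfolding Vt .
  qed
  moreover have "0 < V t" for t unfolding V_def by (rule vpos)
  ultimately show ?thesis using Vmono by blast
qed

section \<open>Monotone iteration and uniqueness for an abstract kernel\<close>

lemma nn_integral_lborel_reflect:
  fixes g :: "'a::euclidean_space \<Rightarrow> ennreal"
  assumes [measurable]: "g \<in> borel_measurable borel"
  shows "(\<integral>\<^sup>+y. g (x - y) \<partial>lborel) = (\<integral>\<^sup>+y. g y \<partial>lborel)"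
proof -
  have "(\<integral>\<^sup>+y. g y \<partial>lborel) = (\<integral>\<^sup>+y. g (x + y) \<partial>lborel)"
    by (subst lborel_distr_plus[of x, symmetric], subst nn_integral_distr) auto
  also have "\<dots> = (\<integral>\<^sup>+y. g (x - y) \<partial>lborel)"
    by (subst lborel_affine[of "- 1" 0], simp, subst nn_integral_density, simp, simp, subst nn_integral_distr) auto
  finally show ?thesis ..
qed

definition nonlinearity :: "(real \<Rightarrow> real) \<Rightarrow> ennreal \<Rightarrow> ennreal" where
  "nonlinearity f u = ennreal (f (enn2real u))"

definition duhamel ::
  "(real \<Rightarrow> real) \<Rightarrow> (real \<Rightarrow> 'a::euclidean_space \<Rightarrow> ennreal) \<Rightarrow> (real \<times> 'a \<Rightarrow> ennreal) \<Rightarrow> real \<Rightarrow> 'a \<Rightarrow> ennreal"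
  where "duhamel f Y u t x =
    (\<integral>\<^sup>+s. (\<integral>\<^sup>+y. Y (t - s) (x - y) * nonlinearity f (u (s, y)) \<partial>lborel) * indicator {0<..<t} s \<partial>lborel)"

context
  fixes a K :: real and f :: "real \<Rightarrow> real"
    and Y :: "real \<Rightarrow> 'a::euclidean_space \<Rightarrow> ennreal" and A :: "real \<Rightarrow> 'a \<Rightarrow> ennreal"
  assumes a: "0 < a" and K: "0 < K"
    and Y_meas: "(\<lambda>p. Y (fst p) (snd p)) \<in> borel_measurable (borel \<Otimes>\<^sub>M borel)"
    and A_meas: "(\<lambda>p. A (fst p) (snd p)) \<in> borel_measurable (borel \<Otimes>\<^sub>M borel)"
    and Y_mass: "\<And>t. 0 < t \<Longrightarrow> (\<integral>\<^sup>+x. Y t x \<partial>lborel) \<le> ennreal (K * t powr (a - 1))"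
    and f_cont: "continuous_on {0..} f" and f_mono: "mono_on {0..} f" and f_nonneg: "\<And>s. 0 \<le> s \<Longrightarrow> 0 \<le> f s"
begin

lemma Y_measurable[measurable (raw)]:
  assumes "g \<in> borel_measurable M" "h \<in> borel_measurable M"
  shows "(\<lambda>w. Y (g w) (h w)) \<in> borel_measurable M"
  using measurable_compose[OF measurable_Pair[OF assms] Y_meas] by simp

lemma A_measurable[measurable (raw)]:
  assumes "g \<in> borel_measurable M" "h \<in> borel_measurable M"
  shows "(\<lambda>w. A (g w) (h w)) \<in> borel_measurable M"
  using measurable_compose[OF measurable_Pair[OF assms] A_meas] by simp

lemma nonlinearity_measurable[measurable]: "nonlinearity f \<in> borel_measurable borel"
proof -
  have "continuous_on UNIV (\<lambda>r. f (max 0 r))"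
    by (intro continuous_on_compose2[OF f_cont] continuous_intros) auto
  then have [measurable]: "(\<lambda>r. f (max 0 r)) \<in> borel_measurable borel" by (rule borel_measurable_continuous_onI)
  have "(\<lambda>u. ennreal (f (max 0 (enn2real u)))) \<in> borel_measurable borel" by measurable
  then show ?thesis unfolding nonlinearity_def[abs_def] by simp
qed

text \<open>Finiteness of v matters: \<open>enn2real\<close> sends \<infinity> to 0, which breaks
  monotonicity at the top.\<close>

lemma nonlinearity_mono: "u \<le> v \<Longrightarrow> v < \<infinity> \<Longrightarrow> nonlinearity f u \<le> nonlinearity f v"
  unfolding nonlinearity_def by (intro ennreal_leI mono_onD[OF f_mono]) (auto intro: enn2real_mono)

lemma duhamel_measurable[measurable (raw)]:
  assumes [measurable]: "u \<in> borel_measurable (borel \<Otimes>\<^sub>M borel)" "g \<in> borel_measurable M" "h \<in> borel_measurable M"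
  shows "(\<lambda>w. duhamel f Y u (g w) (h w)) \<in> borel_measurable M"
proof -
  have "indicator {0<..<t} s = (if 0 < s \<and> s < t then 1 else 0 :: ennreal)" for s t :: real by (simp add: indicator_def)
  then show ?thesis unfolding duhamel_def by simp
qed

lemma nn_integral_kernel_le:
  assumes t: "s < t" and c: "\<And>y. N y \<le> ennreal c"
  shows "(\<integral>\<^sup>+y. Y (t - s) (x - y) * N y \<partial>lborel) \<le> ennreal (K * (t - s) powr (a - 1)) * ennreal c"
proof -
  have "(\<integral>\<^sup>+y. Y (t - s) (x - y) * N y \<partial>lborel) \<le> (\<integral>\<^sup>+y. Y (t - s) (x - y) * ennreal c \<partial>lborel)"
    by (intro nn_integral_mono mult_left_mono c) auto
  also have "\<dots> = (\<integral>\<^sup>+y. Y (t - s) (x - y) \<partial>lborel) * ennreal c"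
    by (rule nn_integral_multc) measurable
  also have "(\<integral>\<^sup>+y. Y (t - s) (x - y) \<partial>lborel) = (\<integral>\<^sup>+y. Y (t - s) y \<partial>lborel)"
    by (rule nn_integral_lborel_reflect) measurable
  also have "\<dots> * ennreal c \<le> ennreal (K * (t - s) powr (a - 1)) * ennreal c"
    using t by (intro mult_right_mono Y_mass) auto
  finally show ?thesis .
qed

text \<open>The iterates increase from 0, and the supersolution bounds them uniformly in n and x.
  Hence the supremum is finite for t > 0 and solves the equation at every such (t, x), not merely
  almost everywhere.\<close>

lemma exists_bounded_solution:
  assumes A0: "0 \<le> A0" and A: "\<And>t x. 0 < t \<Longrightarrow> A t x \<le> ennreal A0"
    and lin: "\<exists>C>0. \<forall>B. \<exists>v\<ge>B. 0 < v \<and> f v \<le> C * v"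
  shows "\<exists>u V. u \<in> borel_measurable (borel \<Otimes>\<^sub>M borel) \<and> mono_on {0..} V \<and>
    (\<forall>t>0. \<forall>x. u (t, x) \<le> ennreal (V t) \<and> u (t, x) = A t x + duhamel f Y u t x)"
proof -
  obtain V :: "real \<Rightarrow> real" where V: "mono_on {0..} V" "\<And>t. 0 < V t"
    "\<And>t. 0 < t \<Longrightarrow> ennreal A0 + (\<integral>\<^sup>+s. ennreal (K * (t - s) powr (a - 1)) * ennreal (f (V s)) * indicator {0<..<t} s \<partial>lborel) \<le> ennreal (V t)"
    using global_supersolution[OF a K A0 f_mono f_nonneg lin] by blast
  define U where "U = rec_nat (\<lambda>_. 0) (\<lambda>_ u p. A (fst p) (snd p) + duhamel f Y u (fst p) (snd p))"
  have U0: "U 0 = (\<lambda>_. 0)" and US: "U (Suc n) p = A (fst p) (snd p) + duhamel f Y (U n) (fst p) (snd p)" for n p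
    by (simp_all add: U_def)
  have Um[measurable]: "U n \<in> borel_measurable (borel \<Otimes>\<^sub>M borel)" for n
  proof (induction n)
    case (Suc n)
    note Suc[measurable]
    have "U (Suc n) = (\<lambda>p. A (fst p) (snd p) + duhamel f Y (U n) (fst p) (snd p))" by (auto simp: US)
    then show ?case by simp
  qed (simp add: U0)
  have bound: "U n (t, x) \<le> ennreal (V t)" if "0 < t" for n t x
    using that
  proof (induction n arbitrary: t x)
    case (Suc n)
    have "duhamel f Y (U n) t x \<le> (\<integral>\<^sup>+s. ennreal (K * (t - s) powr (a - 1)) * ennreal (f (V s)) * indicator {0<..<t} s \<partial>lborel)"
      unfolding duhamel_def
    proof (rule nn_integral_mono)
      fix s
      show "(\<integral>\<^sup>+y. Y (t - s) (x - y) * nonlinearity f (U n (s, y)) \<partial>lborel) * indicator {0<..<t} s \<le> ennreal (K * (t - s) powr (a - 1)) * ennreal (f (V s)) * indicator {0<..<t} s"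
      proof (cases "0 < s \<and> s < t")
        case True
        have "nonlinearity f (U n (s, y)) \<le> ennreal (f (V s))" for y
          using nonlinearity_mono[OF Suc.IH[of s y]] True V(2)[of s] by (simp add: nonlinearity_def)
        then show ?thesis using True by (intro mult_right_mono nn_integral_kernel_le) auto
      qed simp
    qed
    then have "U (Suc n) (t, x) \<le> ennreal A0 + (\<integral>\<^sup>+s. ennreal (K * (t - s) powr (a - 1)) * ennreal (f (V s)) * indicator {0<..<t} s \<partial>lborel)"
      unfolding US using A[OF Suc.prems, of x] by (intro add_mono) auto
    then show ?case using V(3)[OF Suc.prems] by (rule order_trans)
  qed (simp add: U0)
  have fin: "U n (t, x) < \<infinity>" if "0 < t" for n t x
    using bound[OF that, of n x] by (auto intro: le_less_trans)
  have inc: "U n (t, x) \<le> U (Suc n) (t, x)" if "0 < t" for n t x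
    using that
  proof (induction n arbitrary: t x)
    case (Suc n)
    have "duhamel f Y (U n) t x \<le> duhamel f Y (U (Suc n)) t x" unfolding duhamel_def
    proof (rule nn_integral_mono)
      fix s
      show "(\<integral>\<^sup>+y. Y (t - s) (x - y) * nonlinearity f (U n (s, y)) \<partial>lborel) * indicator {0<..<t} s \<le> (\<integral>\<^sup>+y. Y (t - s) (x - y) * nonlinearity f (U (Suc n) (s, y)) \<partial>lborel) * indicator {0<..<t} s"
      proof (cases "0 < s \<and> s < t")
        case True
        then show ?thesis by (intro mult_right_mono nn_integral_mono mult_left_mono nonlinearity_mono Suc.IH fin) auto
      qed simp
    qed
    then show ?case unfolding US[of n] US[of "Suc n"] by (simp add: add_left_mono)
  qed (simp add: U0)
  have incs: "incseq (\<lambda>n. U n (t, x))" if "0 < t" for t x using inc[OF that] by (rule incseq_SucI)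
  define u where "u p = (SUP n. U n p)" for p
  have um: "u \<in> borel_measurable (borel \<Otimes>\<^sub>M borel)" unfolding u_def[abs_def] by measurable
  have ub: "u (t, x) \<le> ennreal (V t)" if "0 < t" for t x
    unfolding u_def by (rule SUP_least) (rule bound[OF that])
  \<comment> \<open>The supremum passes through f by continuity, as a limit; finiteness of u is
    needed because \<open>enn2real\<close> is not continuous at \<infinity>.\<close>
  have NSUP: "(SUP n. nonlinearity f (U n (s, y))) = nonlinearity f (u (s, y))" if s: "0 < s" for s y
  proof (rule LIMSEQ_unique[OF LIMSEQ_SUP])
    show "incseq (\<lambda>n. nonlinearity f (U n (s, y)))"
      by (rule incseq_SucI) (rule nonlinearity_mono[OF inc[OF s] fin[OF s]])
    have ufin: "u (s, y) < \<infinity>" using ub[OF s, of y] by (auto intro: le_less_trans)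
    have "(\<lambda>n. U n (s, y)) \<longlonglongrightarrow> u (s, y)" unfolding u_def by (rule LIMSEQ_SUP[OF incs[OF s]])
    then have "(\<lambda>n. enn2real (U n (s, y))) \<longlonglongrightarrow> enn2real (u (s, y))"
      using ufin by (intro tendsto_enn2real) auto
    then have "(\<lambda>n. f (enn2real (U n (s, y)))) \<longlonglongrightarrow> f (enn2real (u (s, y)))"
      by (rule continuous_on_tendsto_compose[OF f_cont]) auto
    then show "(\<lambda>n. nonlinearity f (U n (s, y))) \<longlonglongrightarrow> nonlinearity f (u (s, y))"
      unfolding nonlinearity_def by (rule tendsto_ennrealI)
  qed
  have duh: "(SUP n. duhamel f Y (U n) t x) = duhamel f Y u t x" for t x
  proof -
    have innr: "(SUP n. (\<integral>\<^sup>+y. Y (t - s) (x - y) * nonlinearity f (U n (s, y)) \<partial>lborel) * indicator {0<..<t} s) =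
        (\<integral>\<^sup>+y. Y (t - s) (x - y) * nonlinearity f (u (s, y)) \<partial>lborel) * indicator {0<..<t} s" for s
    proof (cases "0 < s \<and> s < t")
      case True
      then have s: "0 < s" by simp
      have "(\<integral>\<^sup>+y. Y (t - s) (x - y) * nonlinearity f (u (s, y)) \<partial>lborel) = (\<integral>\<^sup>+y. (SUP n. Y (t - s) (x - y) * nonlinearity f (U n (s, y))) \<partial>lborel)"
        by (simp add: NSUP[OF s, symmetric] SUP_mult_left_ennreal)
      also have "\<dots> = (SUP n. \<integral>\<^sup>+y. Y (t - s) (x - y) * nonlinearity f (U n (s, y)) \<partial>lborel)"
      proof (rule nn_integral_monotone_convergence_SUP)
        show "incseq (\<lambda>n y. Y (t - s) (x - y) * nonlinearity f (U n (s, y)))"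
          by (intro incseq_SucI le_funI mult_left_mono nonlinearity_mono inc fin s) auto
      qed measurable
      finally show ?thesis using True by simp
    qed simp
    have "duhamel f Y u t x = (\<integral>\<^sup>+s. (SUP n. (\<integral>\<^sup>+y. Y (t - s) (x - y) * nonlinearity f (U n (s, y)) \<partial>lborel) * indicator {0<..<t} s) \<partial>lborel)"
      unfolding innr duhamel_def ..
    also have "\<dots> = (SUP n. \<integral>\<^sup>+s. (\<integral>\<^sup>+y. Y (t - s) (x - y) * nonlinearity f (U n (s, y)) \<partial>lborel) * indicator {0<..<t} s \<partial>lborel)"
    proof (rule nn_integral_monotone_convergence_SUP)
      show "incseq (\<lambda>n s. (\<integral>\<^sup>+y. Y (t - s) (x - y) * nonlinearity f (U n (s, y)) \<partial>lborel) * indicator {0<..<t} s)"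
      proof (intro incseq_SucI le_funI)
        fix n s
        show "(\<integral>\<^sup>+y. Y (t - s) (x - y) * nonlinearity f (U n (s, y)) \<partial>lborel) * indicator {0<..<t} s \<le> (\<integral>\<^sup>+y. Y (t - s) (x - y) * nonlinearity f (U (Suc n) (s, y)) \<partial>lborel) * indicator {0<..<t} s"
        proof (cases "0 < s \<and> s < t")
          case True
          then show ?thesis by (intro mult_right_mono nn_integral_mono mult_left_mono nonlinearity_mono inc fin) auto
        qed simp
      qed
    qed measurable
    finally show ?thesis unfolding duhamel_def ..
  qed
  have dinc: "incseq (\<lambda>n. duhamel f Y (U n) t x)" if t: "0 < t" for t x
  proof (rule incseq_SucI, unfold duhamel_def, rule nn_integral_mono)
    fix n s
    show "(\<integral>\<^sup>+y. Y (t - s) (x - y) * nonlinearity f (U n (s, y)) \<partial>lborel) * indicator {0<..<t} s \<le> (\<integral>\<^sup>+y. Y (t - s) (x - y) * nonlinearity f (U (Suc n) (s, y)) \<partial>lborel) * indicator {0<..<t} s"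
    proof (cases "0 < s \<and> s < t")
      case True
      then show ?thesis by (intro mult_right_mono nn_integral_mono mult_left_mono nonlinearity_mono inc fin) auto
    qed simp
  qed
  have "u (t, x) = A t x + duhamel f Y u t x" if t: "0 < t" for t x
  proof (rule LIMSEQ_unique)
    have "(\<lambda>n. U n (t, x)) \<longlonglongrightarrow> u (t, x)" unfolding u_def by (rule LIMSEQ_SUP[OF incs[OF t]])
    then show "(\<lambda>n. U (Suc n) (t, x)) \<longlonglongrightarrow> u (t, x)" by (rule LIMSEQ_Suc)
    have "(\<lambda>n. duhamel f Y (U n) t x) \<longlonglongrightarrow> duhamel f Y u t x"
      unfolding duh[symmetric] by (rule LIMSEQ_SUP[OF dinc[OF t]])
    then show "(\<lambda>n. U (Suc n) (t, x)) \<longlonglongrightarrow> A t x + duhamel f Y u t x"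
      unfolding US by (auto intro: tendsto_add)
  qed
  then show ?thesis using um V(1) ub by blast
qed

text \<open>Instead of a fixed point theorem, the estimate |u - v| \<le> B exp(l t), valid almost
  everywhere, is improved to B/2 in place of B. Starting from B = M, which holds since both values
  lie in [0, M], it is halved indefinitely.\<close>

lemma bounded_solutions_eq:
  assumes um[measurable]: "u \<in> borel_measurable (borel \<Otimes>\<^sub>M borel)" and vm[measurable]: "v \<in> borel_measurable (borel \<Otimes>\<^sub>M borel)"
    and M: "0 \<le> M" and L: "0 < L" and lip: "\<And>r s. r \<in> {0..M} \<Longrightarrow> s \<in> {0..M} \<Longrightarrow> \<bar>f r - f s\<bar> \<le> L * \<bar>r - s\<bar>"
    and u: "AE p in lborel. 0 < fst p \<and> fst p < T \<longrightarrow> u p \<le> ennreal M \<and> u p = A (fst p) (snd p) + duhamel f Y u (fst p) (snd p)"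
    and v: "AE p in lborel. 0 < fst p \<and> fst p < T \<longrightarrow> v p \<le> ennreal M \<and> v p = A (fst p) (snd p) + duhamel f Y v (fst p) (snd p)"
  shows "AE p in lborel. 0 < fst p \<and> fst p < T \<longrightarrow> u p = v p"
proof -
  have G: "0 < Gamma a" using a by (rule Gamma_real_pos)
  \<comment> \<open>Convolution of K L t^(a-1) with exp(l t) yields at most the factor K L Gamma(a)
    l^(-a), and this l makes it 1/2.\<close>
  define l where "l = (2 * L * K * Gamma a) powr (1 / a)"
  have l: "0 < l" using L K G by (simp add: l_def)
  have la: "l powr (- a) * (L * K * Gamma a) = 1 / 2"
  proof -
    have "l powr (- a) = inverse (2 * L * K * Gamma a)"
      using L K G a by (simp add: l_def powr_powr powr_minus del: inverse_mult_distrib)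
    then show ?thesis using L K less_imp_neq[OF G] by (simp add: field_simps)
  qed
  have conv: "(\<integral>\<^sup>+s. ennreal (K * (t - s) powr (a - 1)) * ennreal (L * (B * exp (l * s))) * indicator {0<..<t} s \<partial>lborel) \<le> ennreal (B / 2 * exp (l * t))"
    if B: "0 \<le> B" for B t
  proof -
    let ?c = "K * Gamma a * L * B * exp (l * t)"
    have c: "0 \<le> ?c" using K G L B by simp
    have "(\<integral>\<^sup>+s. ennreal (K * (t - s) powr (a - 1)) * ennreal (L * (B * exp (l * s))) * indicator {0<..<t} s \<partial>lborel) \<le>
      (\<integral>\<^sup>+s. ennreal ?c * ennreal (indicator {0<..} (t - s) * (exp (- l * (t - s)) * rl_kernel a (t - s))) \<partial>lborel)"
    proof (rule nn_integral_mono)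
      fix s
      show "ennreal (K * (t - s) powr (a - 1)) * ennreal (L * (B * exp (l * s))) * indicator {0<..<t} s \<le> ennreal ?c * ennreal (indicator {0<..} (t - s) * (exp (- l * (t - s)) * rl_kernel a (t - s)))"
      proof (cases "0 < s \<and> s < t")
        case True
        have "exp (l * t) * exp (- l * (t - s)) = exp (l * s)" by (simp add: algebra_simps flip: exp_add)
        then have "K * (t - s) powr (a - 1) * (L * (B * exp (l * s))) = K * Gamma a * L * B * (exp (l * t) * exp (- l * (t - s))) * rl_kernel a (t - s)"
          using G by (simp add: rl_kernel_def)
        also have "\<dots> = ?c * (exp (- l * (t - s)) * rl_kernel a (t - s))" by (simp only: mult_ac)
        finally have e: "K * (t - s) powr (a - 1) * (L * (B * exp (l * s))) = ?c * (exp (- l * (t - s)) * rl_kernel a (t - s))" .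
        have "ennreal (K * (t - s) powr (a - 1)) * ennreal (L * (B * exp (l * s))) = ennreal (K * (t - s) powr (a - 1) * (L * (B * exp (l * s))))"
          by (rule ennreal_mult'[symmetric]) (use K in simp)
        also have "\<dots> = ennreal ?c * ennreal (exp (- l * (t - s)) * rl_kernel a (t - s))"
          unfolding e by (rule ennreal_mult'[OF c])
        finally show ?thesis using True by simp
      qed simp
    qed
    also have "\<dots> = ennreal ?c * (\<integral>\<^sup>+s. ennreal (indicator {0<..} (t - s) * (exp (- l * (t - s)) * rl_kernel a (t - s))) \<partial>lborel)"
      by (rule nn_integral_cmult) measurable
    also have "(\<integral>\<^sup>+s. ennreal (indicator {0<..} (t - s) * (exp (- l * (t - s)) * rl_kernel a (t - s))) \<partial>lborel) = (\<integral>\<^sup>+s. ennreal (indicator {0<..} s * (exp (- l * s) * rl_kernel a s)) \<partial>lborel)"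
      by (rule nn_integral_lborel_reflect) measurable
    also have "\<dots> = ennreal (l powr (- a))" by (rule nn_integral_Laplace_rl_kernel[OF a l])
    also have "ennreal ?c * ennreal (l powr (- a)) = ennreal (B * exp (l * t) * (l powr (- a) * (L * K * Gamma a)))"
      using c by (simp add: ennreal_mult'[symmetric] mult_ac)
    also have "\<dots> = ennreal (B / 2 * exp (l * t))" unfolding la by simp
    finally show ?thesis .
  qed
  \<comment> \<open>A one-sided estimate avoids subtraction in [0, \<infinity>]; it is stated for
    arbitrary u and v so that it can be applied in both orders.\<close>
  have one: "duhamel f Y u t x \<le> duhamel f Y v t x + ennreal (B / 2 * exp (l * t))"
    if B: "0 \<le> B" and t: "0 < t" "t < T"
      and um[measurable]: "u \<in> borel_measurable (borel \<Otimes>\<^sub>M borel)" and vm[measurable]: "v \<in> borel_measurable (borel \<Otimes>\<^sub>M borel)"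
      and ae: "AE p in lborel. 0 < fst p \<and> fst p < T \<longrightarrow> u p \<le> ennreal M \<and> v p \<le> ennreal M \<and> \<bar>enn2real (u p) - enn2real (v p)\<bar> \<le> B * exp (l * fst p)"
    for u v :: "real \<times> 'a \<Rightarrow> ennreal" and B t x
  proof -
    have "AE s in lborel. AE y in lborel. 0 < s \<and> s < T \<longrightarrow> u (s, y) \<le> ennreal M \<and> v (s, y) \<le> ennreal M \<and> \<bar>enn2real (u (s, y)) - enn2real (v (s, y))\<bar> \<le> B * exp (l * s)"
      using lborel_pair.AE_pair[OF ae[folded lborel_prod]] by simp
    then have ae2: "AE s in lborel. (\<integral>\<^sup>+y. Y (t - s) (x - y) * nonlinearity f (u (s, y)) \<partial>lborel) * indicator {0<..<t} s \<le>
       (\<integral>\<^sup>+y. Y (t - s) (x - y) * nonlinearity f (v (s, y)) \<partial>lborel) * indicator {0<..<t} s + ennreal (K * (t - s) powr (a - 1)) * ennreal (L * (B * exp (l * s))) * indicator {0<..<t} s"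
    proof eventually_elim
      case (elim s)
      show ?case
      proof (cases "0 < s \<and> s < t")
        case True
        have "(\<integral>\<^sup>+y. Y (t - s) (x - y) * nonlinearity f (u (s, y)) \<partial>lborel) \<le> (\<integral>\<^sup>+y. Y (t - s) (x - y) * nonlinearity f (v (s, y)) + Y (t - s) (x - y) * ennreal (L * (B * exp (l * s))) \<partial>lborel)"
        proof (rule nn_integral_mono_AE)
          show "AE y in lborel. Y (t - s) (x - y) * nonlinearity f (u (s, y)) \<le> Y (t - s) (x - y) * nonlinearity f (v (s, y)) + Y (t - s) (x - y) * ennreal (L * (B * exp (l * s)))"
            using elim
          proof eventually_elim
            case (elim y)
            then have b: "u (s, y) \<le> ennreal M" "v (s, y) \<le> ennreal M" "\<bar>enn2real (u (s, y)) - enn2real (v (s, y))\<bar> \<le> B * exp (l * s)"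
              using True t by auto
            have "enn2real (u (s, y)) \<in> {0..M}" "enn2real (v (s, y)) \<in> {0..M}" using b M by (auto intro: enn2real_leI)
            from lip[OF this] have "f (enn2real (u (s, y))) - f (enn2real (v (s, y))) \<le> L * \<bar>enn2real (u (s, y)) - enn2real (v (s, y))\<bar>" by linarith
            also have "\<dots> \<le> L * (B * exp (l * s))" using b(3) L by (intro mult_left_mono) auto
            finally have "f (enn2real (u (s, y))) \<le> f (enn2real (v (s, y))) + L * (B * exp (l * s))" by simp
            then have "nonlinearity f (u (s, y)) \<le> nonlinearity f (v (s, y)) + ennreal (L * (B * exp (l * s)))"
              unfolding nonlinearity_def using f_nonneg[OF enn2real_nonneg] B L
              by (subst ennreal_plus[symmetric]) (simp_all only: ennreal_leI mult_nonneg_nonneg less_imp_le exp_ge_zero)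
            then show ?case unfolding distrib_left[symmetric] by (rule mult_left_mono) simp
          qed
        qed
        also have "\<dots> = (\<integral>\<^sup>+y. Y (t - s) (x - y) * nonlinearity f (v (s, y)) \<partial>lborel) + (\<integral>\<^sup>+y. Y (t - s) (x - y) * ennreal (L * (B * exp (l * s))) \<partial>lborel)"
          by (rule nn_integral_add) measurable
        also have "\<dots> \<le> (\<integral>\<^sup>+y. Y (t - s) (x - y) * nonlinearity f (v (s, y)) \<partial>lborel) + ennreal (K * (t - s) powr (a - 1)) * ennreal (L * (B * exp (l * s)))"
          using True by (intro add_left_mono nn_integral_kernel_le) auto
        finally show ?thesis using True by simp
      qed simp
    qed
    have "duhamel f Y u t x \<le> (\<integral>\<^sup>+s. (\<integral>\<^sup>+y. Y (t - s) (x - y) * nonlinearity f (v (s, y)) \<partial>lborel) * indicator {0<..<t} s + ennreal (K * (t - s) powr (a - 1)) * ennreal (L * (B * exp (l * s))) * indicator {0<..<t} s \<partial>lborel)"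
      unfolding duhamel_def by (rule nn_integral_mono_AE[OF ae2])
    also have "\<dots> = duhamel f Y v t x + (\<integral>\<^sup>+s. ennreal (K * (t - s) powr (a - 1)) * ennreal (L * (B * exp (l * s))) * indicator {0<..<t} s \<partial>lborel)"
      unfolding duhamel_def by (rule nn_integral_add) measurable
    also have "\<dots> \<le> duhamel f Y v t x + ennreal (B / 2 * exp (l * t))" by (intro add_left_mono conv B)
    finally show ?thesis .
  qed
  have half: "AE p in lborel. 0 < fst p \<and> fst p < T \<longrightarrow> \<bar>enn2real (u p) - enn2real (v p)\<bar> \<le> B / 2 * exp (l * fst p)"
    if B: "0 \<le> B" and ae: "AE p in lborel. 0 < fst p \<and> fst p < T \<longrightarrow> \<bar>enn2real (u p) - enn2real (v p)\<bar> \<le> B * exp (l * fst p)" for B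
  proof -
    have 1: "AE p in lborel. 0 < fst p \<and> fst p < T \<longrightarrow> u p \<le> ennreal M \<and> v p \<le> ennreal M \<and> \<bar>enn2real (u p) - enn2real (v p)\<bar> \<le> B * exp (l * fst p)"
      using ae u v by eventually_elim auto
    have 2: "AE p in lborel. 0 < fst p \<and> fst p < T \<longrightarrow> v p \<le> ennreal M \<and> u p \<le> ennreal M \<and> \<bar>enn2real (v p) - enn2real (u p)\<bar> \<le> B * exp (l * fst p)"
      using 1 by eventually_elim (auto simp: abs_minus_commute)
    show ?thesis using u v
    proof eventually_elim
      case (elim p)
      show ?case
      proof (intro impI)
        assume p: "0 < fst p \<and> fst p < T"
        let ?e = "B / 2 * exp (l * fst p)"
        have e: "0 \<le> ?e" using B by simp
        have d: "duhamel f Y u (fst p) (snd p) \<le> duhamel f Y v (fst p) (snd p) + ennreal ?e"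
          "duhamel f Y v (fst p) (snd p) \<le> duhamel f Y u (fst p) (snd p) + ennreal ?e"
          by (rule one[OF B _ _ um vm 1] one[OF B _ _ vm um 2]; use p in simp)+
        have uv: "u p \<le> v p + ennreal ?e" "v p \<le> u p + ennreal ?e"
          using elim p add_left_mono[OF d(1), of "A (fst p) (snd p)"] add_left_mono[OF d(2), of "A (fst p) (snd p)"]
          by (auto simp: add.assoc)
        have "u p \<le> ennreal M" "v p \<le> ennreal M" using elim p by auto
        then obtain r s where rs: "u p = ennreal r" "v p = ennreal s" "0 \<le> r" "0 \<le> s"
          by (cases "u p"; cases "v p") (auto simp: top_unique)
        then show "\<bar>enn2real (u p) - enn2real (v p)\<bar> \<le> ?e"
        proof -
          have "r \<le> s + ?e" "s \<le> r + ?e"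
            using uv e rs(3,4) unfolding rs(1,2) by (simp_all add: ennreal_plus[symmetric] del: ennreal_plus)
          then have "\<bar>r - s\<bar> \<le> ?e" by linarith
          then show ?thesis using rs by simp
        qed
      qed
    qed
  qed
  have iter: "AE p in lborel. 0 < fst p \<and> fst p < T \<longrightarrow> \<bar>enn2real (u p) - enn2real (v p)\<bar> \<le> M / 2 ^ n * exp (l * fst p)" for n
  proof (induction n)
    case 0
    show ?case using u v
    proof eventually_elim
      case (elim p)
      show ?case
      proof (intro impI)
        assume p: "0 < fst p \<and> fst p < T"
        have "enn2real (u p) \<in> {0..M}" "enn2real (v p) \<in> {0..M}" using elim p M by (auto intro: enn2real_leI)
        then have "\<bar>enn2real (u p) - enn2real (v p)\<bar> \<le> M" unfolding atLeastAtMost_iff by linarith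
        also have "M * 1 \<le> M * exp (l * fst p)" using M l p by (intro mult_left_mono) auto
        finally show "\<bar>enn2real (u p) - enn2real (v p)\<bar> \<le> M / 2 ^ 0 * exp (l * fst p)" by simp
      qed
    qed
  next
    case (Suc n)
    then show ?case using half[of "M / 2 ^ n"] M by (simp add: field_simps)
  qed
  have "AE p in lborel. \<forall>n. 0 < fst p \<and> fst p < T \<longrightarrow> \<bar>enn2real (u p) - enn2real (v p)\<bar> \<le> M / 2 ^ n * exp (l * fst p)"
    unfolding AE_all_countable using iter by blast
  then show ?thesis using u v
  proof eventually_elim
    case (elim p)
    show ?case
    proof (intro impI)
      assume p: "0 < fst p \<and> fst p < T"
      have "(\<lambda>n. M / 2 ^ n * exp (l * fst p)) \<longlonglongrightarrow> 0" by real_asymp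
      then have "\<bar>enn2real (u p) - enn2real (v p)\<bar> \<le> 0"
        by (rule LIMSEQ_le_const) (use elim p in auto)
      then have "enn2real (u p) = enn2real (v p)" by simp
      moreover have "u p < top" "v p < top"
        using elim p le_less_trans[OF _ ennreal_less_top] by blast+
      ultimately show "u p = v p" by (metis ennreal_enn2real)
    qed
  qed
qed

end

subsection \<open>Existence and uniqueness\<close>

lemma local_lipschitz_bounded:
  fixes f :: "real \<Rightarrow> real"
  assumes "local_lipschitz (UNIV :: real set) {0..} (\<lambda>_. f)"
  shows "\<exists>L>0. \<forall>r\<in>{0..M}. \<forall>s\<in>{0..M}. \<bar>f r - f s\<bar> \<le> L * \<bar>r - s\<bar>"
proof -
  have "local_lipschitz {0::real} {0..M} (\<lambda>_. f)"
    by (rule local_lipschitz_subset[OF assms]) auto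
  then obtain L where "\<And>t. t \<in> {0::real} \<Longrightarrow> L-lipschitz_on {0..M} f"
    by (rule local_lipschitz_compact_implies_lipschitz) auto
  then have L: "L-lipschitz_on {0..M} f" by simp
  have "\<bar>f r - f s\<bar> \<le> (L + 1) * \<bar>r - s\<bar>" if "r \<in> {0..M}" "s \<in> {0..M}" for r s
  proof -
    have "\<bar>f r - f s\<bar> \<le> L * \<bar>r - s\<bar>" using lipschitz_onD[OF L that] by (simp add: dist_real_def)
    also have "\<dots> \<le> (L + 1) * \<bar>r - s\<bar>" by (intro mult_right_mono) auto
    finally show ?thesis .
  qed
  moreover have "0 < L + 1" using lipschitz_on_nonneg[OF L] by simp
  ultimately show ?thesis by blast
qed

lemma AE_lborel_reflect:
  fixes x :: "'a::euclidean_space"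
  assumes "AE y in lborel. P y"
  shows "AE y in lborel. P (x - y)"
proof -
  obtain N where "{y \<in> space lborel. \<not> P y} \<subseteq> N" "emeasure lborel N = 0" "N \<in> sets lborel"
    using AE_E[OF assms] by blast
  then have N: "N \<in> null_sets lborel" "\<And>y. \<not> P y \<Longrightarrow> y \<in> N"
    by auto
  have Nm[measurable]: "N \<in> sets borel" using N(1) by auto
  have "(\<integral>\<^sup>+y. indicator N (x - y) \<partial>lborel) = (\<integral>\<^sup>+y. indicator N y \<partial>lborel)"
    by (rule nn_integral_lborel_reflect) simp
  also have "\<dots> = 0" using N(1) by (simp add: null_setsD1)
  finally have "AE y in lborel. indicator N (x - y) = (0::ennreal)"
    by (subst (asm) nn_integral_0_iff_AE) auto
  then show ?thesis
    by eventually_elim (use N(2) in \<open>auto simp: indicator_def split: if_splits\<close>)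
qed

theorem theorem2p1:
  fixes \<alpha> \<beta> k :: real
    and \<nu> :: "'a::euclidean_space measure"
    and f :: "real \<Rightarrow> real"
    and u0 :: "'a \<Rightarrow> real"
  assumes "0 < \<alpha>" "\<alpha> < 1" "0 < \<beta>" "\<beta> < 2"
    and "admissible_spectral_measure \<beta> \<nu>"
    and "local_lipschitz (UNIV :: real set) {0..} (\<lambda>_. f)"
    and "mono_on {0..} f"
    and "f 0 = 0"
    and "\<forall>s>0. 0 < f s"
    and "1 < k" "osgood_type k f"
    and "u0 \<in> borel_measurable lebesgue"
    and "\<exists>M. AE x in lebesgue. \<bar>u0 x\<bar> \<le> M"
    and "AE x in lebesgue. 0 \<le> u0 x"
  shows "\<exists>u. global_integral_solution \<alpha> \<beta> \<nu> f u0 u \<and> u \<in> Linf_loc \<and>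
    (\<forall>v. global_integral_solution \<alpha> \<beta> \<nu> f u0 v \<and> v \<in> Linf_loc \<longrightarrow>
      (AE (t, x) in lebesgue. 0 < t \<longrightarrow> v (t, x) = u (t, x)))"
proof -
  note \<alpha> = assms(1,2) and \<beta> = assms(3,4) and adm = assms(5)
  have f_cont: "continuous_on {0..} f" and f0: "\<And>s. 0 \<le> s \<Longrightarrow> 0 \<le> f s"
    using assms(11) by (auto simp: osgood_type_def)
  note f_mono = assms(7) and lin = osgood_type_linear[OF assms(11)]
  obtain M0 where M0: "AE x in lebesgue. \<bar>u0 x\<bar> \<le> M0" using assms(13) by auto
  \<comment> \<open>A Borel representative of the Lebesgue measurable u0, so that joint
    measurability and Tonelli's theorem are available for the convolution.\<close>
  obtain g0 where g0[measurable]: "g0 \<in> borel_measurable lborel" and g0u: "AE x in lborel. u0 x = g0 x"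
    using completion_ex_borel_measurable_real[OF assms(12)] by auto
  obtain KZ where KZ: "0 < KZ" "\<And>t. 0 < t \<Longrightarrow> (\<integral>\<^sup>+x. ennreal (Z_kernel \<alpha> \<beta> \<nu> t x) \<partial>lborel) \<le> ennreal KZ"
    using nn_integral_Z_kernel_le[OF \<alpha> \<beta> adm] by auto
  obtain K where K: "0 < K" "\<And>t. 0 < t \<Longrightarrow> (\<integral>\<^sup>+x. sub_kernel_nn \<alpha> \<beta> \<nu> t x \<partial>lborel) \<le> ennreal (K * t powr (\<alpha> - 1))"
    using nn_integral_sub_kernel_nn_le[OF \<alpha> \<beta> adm] by auto
  \<comment> \<open>\<open>sub_kernel_nn\<close> is jointly measurable, and off one null set of x it
    agrees with \<open>Y_kernel\<close> for all t > 0 simultaneously (\<open>Yae\<close>); the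
    integrals in y do not see that set.\<close>
  define Y where "Y t x = sub_kernel_nn \<alpha> \<beta> \<nu> t x" for t x
  have Y_meas: "(\<lambda>p. Y (fst p) (snd p)) \<in> borel_measurable (borel \<Otimes>\<^sub>M borel)"
    unfolding Y_def by (rule sub_kernel_nn_measurable[OF \<alpha> \<beta> adm]) auto
  have Yae: "AE x in lborel. \<forall>t>0. ennreal (Y_kernel \<alpha> \<beta> \<nu> t x) = Y t x"
    using AE_good_point[OF \<alpha> \<beta> adm]
    by eventually_elim (simp add: Y_def Y_kernel_eq[OF \<alpha> \<beta> adm] ennreal_sub_kernel[OF \<alpha> \<beta> adm])
  define A where "A t x = (\<integral>\<^sup>+y. ennreal (Z_kernel \<alpha> \<beta> \<nu> t (x - y)) * ennreal (g0 y) \<partial>lborel)" for t x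
  have Z_meas[measurable (raw)]: "(\<lambda>w. Z_kernel \<alpha> \<beta> \<nu> (g w) (h w)) \<in> borel_measurable M"
    if "g \<in> borel_measurable M" "h \<in> borel_measurable M" for g :: "'w \<Rightarrow> real" and h :: "'w \<Rightarrow> 'a" and M
    using that by (rule Z_kernel_measurable[OF \<alpha> \<beta> adm])
  have A_meas: "(\<lambda>p. A (fst p) (snd p)) \<in> borel_measurable (borel \<Otimes>\<^sub>M borel)"
    unfolding A_def using Z_kernel_measurable[OF \<alpha> \<beta> adm] by measurable
  have g0M: "AE y in lborel. g0 y \<le> \<bar>M0\<bar>"
    using M0[unfolded AE_completion_iff] g0u by eventually_elim auto
  have A_le: "A t x \<le> ennreal (KZ * \<bar>M0\<bar>)" if t: "0 < t" for t x
  proof -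
    have [measurable]: "(\<lambda>y. Z_kernel \<alpha> \<beta> \<nu> t y) \<in> borel_measurable borel"
      by (rule Z_kernel_measurable[OF \<alpha> \<beta> adm]) auto
    have "A t x \<le> (\<integral>\<^sup>+y. ennreal (Z_kernel \<alpha> \<beta> \<nu> t (x - y)) * ennreal \<bar>M0\<bar> \<partial>lborel)"
      unfolding A_def using g0M by (intro nn_integral_mono_AE) (auto elim!: eventually_mono intro!: mult_left_mono ennreal_leI)
    also have "\<dots> = (\<integral>\<^sup>+y. ennreal (Z_kernel \<alpha> \<beta> \<nu> t (x - y)) \<partial>lborel) * ennreal \<bar>M0\<bar>"
      by (rule nn_integral_multc) measurable
    also have "(\<integral>\<^sup>+y. ennreal (Z_kernel \<alpha> \<beta> \<nu> t (x - y)) \<partial>lborel) = (\<integral>\<^sup>+y. ennreal (Z_kernel \<alpha> \<beta> \<nu> t y) \<partial>lborel)"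
      by (rule nn_integral_lborel_reflect) measurable
    also have "\<dots> * ennreal \<bar>M0\<bar> \<le> ennreal KZ * ennreal \<bar>M0\<bar>" by (intro mult_right_mono KZ t) auto
    finally show ?thesis using KZ(1) by (simp add: ennreal_mult')
  qed
  let ?D = "duhamel f Y"
  note hyps = \<alpha>(1) K(1) Y_meas A_meas K(2)[folded Y_def] f_cont f_mono f0
 
  have Aleb: "(\<integral>\<^sup>+y. ennreal (Z_kernel \<alpha> \<beta> \<nu> t (x - y)) * ennreal (u0 y) \<partial>lebesgue) = A t x" for t x
    unfolding A_def nn_integral_completion using g0u by (intro nn_integral_cong_AE) (auto elim!: eventually_mono)
  have Dleb: "(\<integral>\<^sup>+s. (\<integral>\<^sup>+y. ennreal (Y_kernel \<alpha> \<beta> \<nu> (t - s) (x - y)) * ennreal (f (enn2real (v (s, y)))) \<partial>lebesgue) * indicator {0<..<t} s \<partial>lebesgue) = ?D w t x"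
    if "AE p in lborel. 0 < fst p \<longrightarrow> v p = w p" for v w t x
  proof -
    have ae: "AE s in lborel. AE y in lborel. 0 < s \<longrightarrow> v (s, y) = w (s, y)"
      using lborel_pair.AE_pair[OF that[folded lborel_prod]] by simp
    have Yr: "AE y in lborel. \<forall>t>0. ennreal (Y_kernel \<alpha> \<beta> \<nu> t (x - y)) = Y t (x - y)" by (rule AE_lborel_reflect[OF Yae])
    show ?thesis
      unfolding duhamel_def nonlinearity_def nn_integral_completion
    proof (rule nn_integral_cong_AE)
      show "AE s in lborel. (\<integral>\<^sup>+y. ennreal (Y_kernel \<alpha> \<beta> \<nu> (t - s) (x - y)) * ennreal (f (enn2real (v (s, y)))) \<partial>lborel) * indicator {0<..<t} s =
        (\<integral>\<^sup>+y. Y (t - s) (x - y) * ennreal (f (enn2real (w (s, y)))) \<partial>lborel) * indicator {0<..<t} s"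
        using ae
      proof eventually_elim
        case (elim s)
        show ?case
        proof (cases "0 < s \<and> s < t")
          case True
          have "(\<integral>\<^sup>+y. ennreal (Y_kernel \<alpha> \<beta> \<nu> (t - s) (x - y)) * ennreal (f (enn2real (v (s, y)))) \<partial>lborel) =
            (\<integral>\<^sup>+y. Y (t - s) (x - y) * ennreal (f (enn2real (w (s, y)))) \<partial>lborel)"
          proof (rule nn_integral_cong_AE)
            show "AE y in lborel. ennreal (Y_kernel \<alpha> \<beta> \<nu> (t - s) (x - y)) * ennreal (f (enn2real (v (s, y)))) = Y (t - s) (x - y) * ennreal (f (enn2real (w (s, y))))"
              using elim Yr by eventually_elim (use True in auto)
          qed
          then show ?thesis by simp
        qed simp
      qed
    qed
  qed
  obtain U V where U[measurable]: "U \<in> borel_measurable (borel \<Otimes>\<^sub>M borel)" and V: "mono_on {0..} V"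
    and UV: "\<And>t x. 0 < t \<Longrightarrow> U (t, x) \<le> ennreal (V t)" and Ueq: "\<And>t x. 0 < t \<Longrightarrow> U (t, x) = A t x + ?D U t x"
    using exists_bounded_solution[OF hyps _ A_le lin] KZ(1) by (metis abs_ge_zero less_imp_le mult_nonneg_nonneg)
  \<comment> \<open>\<open>U\<close> is controlled for t > 0 only; the value 0 elsewhere makes u
    finite at t = 0 as well.\<close>
  define u where "u p = (if 0 < fst p then U p else 0)" for p
  have um: "u \<in> borel_measurable lebesgue"
    unfolding u_def[abs_def] by (rule measurable_completion) (simp add: borel_prod[symmetric])
  have uU: "AE p in lborel. 0 < fst p \<longrightarrow> u p = U p" by (simp add: u_def)
  have sets: "{0..<T} \<times> UNIV \<in> sets (lebesgue :: (real \<times> 'a) measure)" "{0<..} \<times> UNIV \<in> sets (lebesgue :: (real \<times> 'a) measure)" for T :: real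
    by (rule sets_completionI_sets, simp add: borel_prod[symmetric])+
  have "integral_solution \<alpha> \<beta> \<nu> f u0 T u" for T
    unfolding integral_solution_def
  proof (intro conjI)
    show "u \<in> borel_measurable (lebesgue_on ({0..<T} \<times> UNIV))"
      using um by (rule measurable_restrict_space1)
    show "AE (t, x) in lebesgue. t \<in> {0..<T} \<longrightarrow> u (t, x) < \<infinity>"
    proof (rule AE_I2)
      fix p :: "real \<times> 'a"
      show "case p of (t, x) \<Rightarrow> t \<in> {0..<T} \<longrightarrow> u (t, x) < \<infinity>"
        using UV[of "fst p" "snd p"] by (auto simp: u_def split_beta intro: le_less_trans)
    qed
    show "AE (t, x) in lebesgue. t \<in> {0<..<T} \<longrightarrow>
        u (t, x) =
          (\<integral>\<^sup>+y. ennreal (Z_kernel \<alpha> \<beta> \<nu> t (x - y)) * ennreal (u0 y) \<partial>lebesgue) +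
          (\<integral>\<^sup>+s. (\<integral>\<^sup>+y. ennreal (Y_kernel \<alpha> \<beta> \<nu> (t - s) (x - y)) *
             ennreal (f (enn2real (u (s, y)))) \<partial>lebesgue) * indicator {0<..<t} s \<partial>lebesgue)"
      unfolding Aleb Dleb[OF uU] using Ueq by (auto simp: u_def split_beta intro!: AE_I2)
  qed
  then have sol: "global_integral_solution \<alpha> \<beta> \<nu> f u0 u" by (simp add: global_integral_solution_def)
  have uL: "u \<in> Linf_loc"
    unfolding Linf_loc_def
  proof (intro CollectI conjI allI impI)
    show "u \<in> borel_measurable (lebesgue_on ({0<..} \<times> UNIV))"
      using um by (rule measurable_restrict_space1)
    fix T :: real assume T: "0 < T"
    have "t \<in> {0<..<T} \<longrightarrow> u (t, x) \<le> ennreal (V T)" for t x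
    proof
      assume t: "t \<in> {0<..<T}"
      then have "V t \<le> V T" by (intro mono_onD[OF V]) auto
      then show "u (t, x) \<le> ennreal (V T)" using UV[of t x] t by (auto simp: u_def intro: order_trans ennreal_leI)
    qed
    then show "\<exists>M::real. AE (t, x) in lebesgue. t \<in> {0<..<T} \<longrightarrow> u (t, x) \<le> ennreal M"
      by (intro exI[of _ "V T"] AE_I2) auto
  qed
  have unique: "AE (t, x) in lebesgue. 0 < t \<longrightarrow> v (t, x) = u (t, x)"
    if v: "global_integral_solution \<alpha> \<beta> \<nu> f u0 v" "v \<in> Linf_loc" for v
  proof -
    \<comment> \<open>A competitor is used as a measurable function on t > 0 only, so it is cut off
      there before a Borel representative is taken.\<close>
    have "(\<lambda>p. v p * indicator ({0<..} \<times> UNIV) p) \<in> borel_measurable lebesgue"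
      using v(2) borel_measurable_restrict_space_iff_ennreal[of "{0<..} \<times> UNIV" lebesgue v] sets(2)
      by (simp add: Linf_loc_def)
    then obtain w where w[measurable]: "w \<in> borel_measurable lborel" and vw: "AE p in lborel. v p * indicator ({0<..} \<times> UNIV) p = w p"
      using completion_ex_borel_measurable by blast
    have wm: "w \<in> borel_measurable (borel \<Otimes>\<^sub>M borel)" using w by (simp add: borel_prod)
    have vw': "AE p in lborel. 0 < fst p \<longrightarrow> v p = w p"
      using vw by eventually_elim (auto simp: indicator_def split: if_splits)
    have step: "AE p in lborel. 0 < fst p \<and> fst p < T \<longrightarrow> w p = U p" if T: "0 < T" for T
    proof -
      obtain M1 where M1: "AE (t, x) in lebesgue. t \<in> {0<..<T} \<longrightarrow> v (t, x) \<le> ennreal M1"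
        using v(2) T unfolding Linf_loc_def mem_Collect_eq by blast
      \<comment> \<open>A common bound for the competitor and for U on (0, T), so that both take
        values in an interval on which f has one Lipschitz constant.\<close>
      define M where "M = max \<bar>M1\<bar> \<bar>V T\<bar>"
      have M: "0 \<le> M" by (simp add: M_def)
      obtain L where L: "0 < L" "\<And>r s. r \<in> {0..M} \<Longrightarrow> s \<in> {0..M} \<Longrightarrow> \<bar>f r - f s\<bar> \<le> L * \<bar>r - s\<bar>"
        using local_lipschitz_bounded[OF assms(6), of M] by blast
      have veq: "AE p in lborel. fst p \<in> {0<..<T} \<longrightarrow> v p = A (fst p) (snd p) + ?D w (fst p) (snd p)"
      proof -
        have "integral_solution \<alpha> \<beta> \<nu> f u0 T v" using v(1) T unfolding global_integral_solution_def by blast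
        then have "AE (t, x) in lebesgue. t \<in> {0<..<T} \<longrightarrow> v (t, x) = A t x + ?D w t x"
          unfolding integral_solution_def Aleb Dleb[OF vw'] by (elim conjE)
        then show ?thesis unfolding AE_completion_iff by (rule eventually_mono) (simp only: split_beta prod.collapse)
      qed
      have vM: "AE p in lborel. fst p \<in> {0<..<T} \<longrightarrow> v p \<le> ennreal M1"
        using M1 unfolding AE_completion_iff by (rule eventually_mono) (simp only: split_beta prod.collapse)
      show ?thesis
      proof (rule bounded_solutions_eq[OF hyps wm U M L])
        show "AE p in lborel. 0 < fst p \<and> fst p < T \<longrightarrow> w p \<le> ennreal M \<and> w p = A (fst p) (snd p) + ?D w (fst p) (snd p)"
          using veq vM vw'
        proof eventually_elim
          case (elim p)
          have "ennreal M1 \<le> ennreal M" by (intro ennreal_leI) (simp add: M_def)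
          then show ?case using elim by (auto intro: order_trans)
        qed
        have "U p \<le> ennreal M" if p: "0 < fst p" "fst p < T" for p
        proof -
          have "V (fst p) \<le> V T" using p by (intro mono_onD[OF V]) auto
          then have "ennreal (V (fst p)) \<le> ennreal M" by (intro ennreal_leI) (simp add: M_def)
          then show ?thesis using UV[of "fst p" "snd p"] p by (auto intro: order_trans)
        qed
        then show "AE p in lborel. 0 < fst p \<and> fst p < T \<longrightarrow> U p \<le> ennreal M \<and> U p = A (fst p) (snd p) + ?D U (fst p) (snd p)"
          using Ueq by (intro AE_I2) (metis prod.collapse)
      qed
    qed
    \<comment> \<open>The Lipschitz constant depends on T, so equality is first proved up to each T
      and then exhausted along T = n + 1, with countably many null sets.\<close>
    have "AE p in lborel. \<forall>n. 0 < fst p \<and> fst p < real (Suc n) \<longrightarrow> w p = U p"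
      unfolding AE_all_countable using step[of "real (Suc n)" for n] by auto
    then have "AE p in lborel. 0 < fst p \<longrightarrow> v p = u p"
      using vw' uU
    proof eventually_elim
      case (elim p)
      obtain n :: nat where "fst p < real n" using reals_Archimedean2 by blast
      then have "fst p < real (Suc n)" by simp
      then show ?case using elim by auto
    qed
    then show ?thesis unfolding AE_completion_iff by (simp add: split_beta)
  qed
  show ?thesis using sol uL unique by blast
qed

end
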